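(* Let $x_1,x_2,x_3,x_4\in(0,1]$ be given, and let $\mathcal L^{E,\pm}_{x_1,x_2,x_3,x_4}(R)$ and $\mathcal L^{O,\pm}_{x_1,x_2,x_3,x_4}(R)$ be the Lebesgue measures defined in the context. Then these quantities have limits as $R\to\infty$, and for every $\varepsilon>0$ (implied constants depending on $\varepsilon$), $$\mathcal L^{E,\pm}_{x_1,x_2,x_3,x_4}(R)=\frac{2F_\pm}{3\zeta(2)}+O_\varepsilon\big(R^{-1+\varepsilon}\big),$$ $$\mathcal L^{O,+}_{x_1,x_2,x_3,x_4}(R)=\frac{F_+-D_1}{\zeta(2)}+O_\varepsilon\big(R^{-1/2+\varepsilon}\big),\qquad \mathcal L^{O,-}_{x_1,x_2,x_3,x_4}(R)=\frac{F_--D_2-D_3}{\zeta(2)}+O_\varepsilon\big(R^{-1/2+\varepsilon}\big),$$ where $F_\pm=F_\pm(x_1,x_2,x_3,x_4)$ and $D_i=D_i(x_1,x_2,x_3,x_4)$ are given by $$F_\pm=\mp\begin{cases}\operatorname{Li}_2(\mp x_1x_2x_4) & \text{if } x_3\geqslant x_1x_2,\\ \operatorname{Li}_2(\mp x_3x_4)-\log(1\pm x_3x_4)\,\log\dfrac{x_1x_2}{x_3} & \text{if } x_3<x_1x_2,\end{cases}$$ $$D_2=F_-(x_1,x_2,x_3,x_4)-F_-(x_1,x_2,\min\{x_3,g^2\},x_4),\qquad D_1=\sum_{\ell\geqslant1}I_\ell^+,\qquad D_3=\sum_{\ell\geqslant2}I_\ell^-,$$ with $$I_\ell^\pm=\int_{1/x_2}^{A_\ell}dx\int_{x/(2\ell+g)}^{B_\ell(x)}\frac{x_4\,dy}{x\,(x\pm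 x_4y)},$$ $$A_\ell=(2\ell+g)x_1,\qquad B_\ell(x)=\min\Big\{x_3x,\;x_1,\;\frac{x}{2\ell},\;\frac{x-1}{2\ell-1}\Big\},$$ and with the convention that $\int_a^b=0$ whenever $a\geqslant b$.
   Context: Notation: $g=(\sqrt5-1)/2$; $\operatorname{Li}_2(z)=\sum_{n\ge1}z^n/n^2$ is the dilogarithm; $\zeta(2)=\pi^2/6$; $\Omega=[0,1]\setminus\mathbb Q$; $[\cdot]$ and $\{\cdot\}$ are integer and fractional part; $\mathbb N=\{1,2,\dots\}$. Even and odd continued fractions. Let $D_O=\bigcup_{n\in 2\mathbb N}[\frac1{n+1},\frac1n)$ and $D_E=[0,1)\setminus D_O$. For $D\in\{D_E,D_O\}$ and $x\in\Omega$ put $e_D(x)=1$, $a_D(x)=[1/x]$, $T_D(x)=\{1/x\}$ if $x\notin D$, and $e_D(x)=-1$, $a_D(x)=1+[1/x]$, $T_D(x)=1-\{1/x\}$ if $x\in D$. For $x\in\Omega$ set $t_n=T_D^n(x)$, $e_0=1$, and for $n\ge1$: $e_n=e_D(t_{n-1})$, $a_n=a_D(t_{n-1})$. The choice $D=D_E$ gives the expansion $\mathrm{ECF}(x)$ (all $a_n$ even), and $D=D_O$ gives $\mathrm{OCF}(x)$ (all $a_n$ odd). The convergents $p_n/q_n$ are defined by $p_{-1}=1$, $p_0=0$, $p_n=a_np_{n-1}+e_{n-1}p_{n-2}$, and $q_{-1}=0$, $q_0=1$, $q_n=a_nq_{n-1}+e_{n-1}q_{n-2}$ for $n\ge1$.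 Successive convergents $P/Q,P'/Q'$ of $x$ are pairs with $P=p_{n-1}$, $Q=q_{n-1}$, $P'=p_n$, $Q'=q_n$ for some $n\ge1$. Measures. Consider the conditions $$\text{(a)}\quad \frac QR\leqslant x_1,\quad \frac R{Q'}\leqslant x_2,\quad \frac Q{Q'}\leqslant x_3;\qquad \text{(b}_+)\quad 0\leqslant\frac{Q'x-P'}{-Qx+P}\leqslant x_4;\qquad \text{(b}_-)\quad -x_4\leqslant\frac{Q'x-P'}{-Qx+P}\leqslant0 .$$ For $R>1$, $\mathcal L^{E,\pm}_{x_1,x_2,x_3,x_4}(R)$ is the Lebesgue measure of the set of $x\in\Omega$ for which there exist successive convergents $P/Q,P'/Q'$ in $\mathrm{ECF}(x)$ satisfying (a) and (b$_\pm$). $\mathcal L^{O,\pm}_{x_1,x_2,x_3,x_4}(R)$ is the Lebesgue measure of the set of $x\in\Omega$ for which the successive convergents $P/Q=p_{n_R-1}/q_{n_R-1}$, $P'/Q'=p_{n_R}/q_{n_R}$ in $\mathrm{OCF}(x)$ satisfy (a) and (b$_\pm$), where $n_R=\min\{n\in\mathbb N: q_n>R\}$ is the renewal time of the OCF denominators of $x$. *)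

theory Defs
  imports "HOL-Analysis.Analysis"
begin

definition Omega :: "real set" where
  "Omega = {0..1} - \<rat>"

definition D_O :: "real set" where
  "D_O = (\<Union>n \<in> {n :: nat. even n \<and> n \<ge> 2}. {1 / (real n + 1) ..< 1 / real n})"

definition D_E :: "real set" where
  "D_E = {0 ..< 1} - D_O"

definition e_digit :: "real set \<Rightarrow> real \<Rightarrow> int" where
  "e_digit D x = (if x \<in> D then - 1 else 1)"

definition a_digit :: "real set \<Rightarrow> real \<Rightarrow> int" where
  "a_digit D x = (if x \<in> D then 1 + \<lfloor>1 / x\<rfloor> else \<lfloor>1 / x\<rfloor>)"

definition T_map :: "real set \<Rightarrow> real \<Rightarrow> real" where
  "T_map D x = (if x \<in> D then 1 - frac (1 / x) else frac (1 / x))"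

text \<open>The digits $e_n$ and $a_n$ of $x$. The value of \<open>cf_a D x 0\<close> is irrelevant.\<close>

definition cf_e :: "real set \<Rightarrow> real \<Rightarrow> nat \<Rightarrow> int" where
  "cf_e D x n = (if n = 0 then 1 else e_digit D ((T_map D ^^ (n - 1)) x))"

definition cf_a :: "real set \<Rightarrow> real \<Rightarrow> nat \<Rightarrow> int" where
  "cf_a D x n = a_digit D ((T_map D ^^ (n - 1)) x)"

text \<open>The convergents $p_n/q_n$ for $n \ge 0$; the initial values $p_{-1} = 1$ and $q_{-1} = 0$
  are substituted into the recurrence for $n = 1$.\<close>

fun cf_p :: "real set \<Rightarrow> real \<Rightarrow> nat \<Rightarrow> int" where
  "cf_p D x 0 = 0"
| "cf_p D x (Suc 0) = cf_a D x 1 * cf_p D x 0 + cf_e D x 0 * 1"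
| "cf_p D x (Suc (Suc n)) =
     cf_a D x (Suc (Suc n)) * cf_p D x (Suc n) + cf_e D x (Suc n) * cf_p D x n"

fun cf_q :: "real set \<Rightarrow> real \<Rightarrow> nat \<Rightarrow> int" where
  "cf_q D x 0 = 1"
| "cf_q D x (Suc 0) = cf_a D x 1 * cf_q D x 0 + cf_e D x 0 * 0"
| "cf_q D x (Suc (Suc n)) =
     cf_a D x (Suc (Suc n)) * cf_q D x (Suc n) + cf_e D x (Suc n) * cf_q D x n"

definition renewal_time :: "real set \<Rightarrow> real \<Rightarrow> real \<Rightarrow> nat" where
  "renewal_time D R x = (LEAST n. n \<ge> 1 \<and> real_of_int (cf_q D x n) > R)"

definition cond_a :: "real \<Rightarrow> real \<Rightarrow> real \<Rightarrow> real \<Rightarrow> int \<Rightarrow> int \<Rightarrow> bool" where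
  "cond_a x1 x2 x3 R Q Q' \<longleftrightarrow>
     of_int Q / R \<le> x1 \<and> R / of_int Q' \<le> x2 \<and> of_int Q / of_int Q' \<le> x3"

definition gap_ratio :: "real \<Rightarrow> int \<Rightarrow> int \<Rightarrow> int \<Rightarrow> int \<Rightarrow> real" where
  "gap_ratio x P Q P' Q' = (of_int Q' * x - of_int P') / (- of_int Q * x + of_int P)"

text \<open>The interval \<open>J\<close> is the range allowed for the ratio: \<open>{0..x4}\<close> gives condition
  (b$_+$) and \<open>{- x4..0}\<close> gives condition (b$_-$).\<close>

definition successive_ok ::
  "real set \<Rightarrow> real \<Rightarrow> real \<Rightarrow> real \<Rightarrow> real set \<Rightarrow> real \<Rightarrow> real \<Rightarrow> nat \<Rightarrow> bool" where
  "successive_ok D x1 x2 x3 J R x n \<longleftrightarrow>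
     cond_a x1 x2 x3 R (cf_q D x (n - 1)) (cf_q D x n) \<and>
     gap_ratio x (cf_p D x (n - 1)) (cf_q D x (n - 1)) (cf_p D x n) (cf_q D x n) \<in> J"

definition LE_meas :: "real \<Rightarrow> real \<Rightarrow> real \<Rightarrow> real set \<Rightarrow> real \<Rightarrow> real" where
  "LE_meas x1 x2 x3 J R =
     measure lebesgue {x \<in> Omega. \<exists>n \<ge> 1. successive_ok D_E x1 x2 x3 J R x n}"

definition LO_meas :: "real \<Rightarrow> real \<Rightarrow> real \<Rightarrow> real set \<Rightarrow> real \<Rightarrow> real" where
  "LO_meas x1 x2 x3 J R =
     measure lebesgue {x \<in> Omega. successive_ok D_O x1 x2 x3 J R x (renewal_time D_O R x)}"

definition LE_plus :: "real \<Rightarrow> real \<Rightarrow> real \<Rightarrow> real \<Rightarrow> real \<Rightarrow> real" where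
  "LE_plus x1 x2 x3 x4 R = LE_meas x1 x2 x3 {0..x4} R"

definition LE_minus :: "real \<Rightarrow> real \<Rightarrow> real \<Rightarrow> real \<Rightarrow> real \<Rightarrow> real" where
  "LE_minus x1 x2 x3 x4 R = LE_meas x1 x2 x3 {- x4..0} R"

definition LO_plus :: "real \<Rightarrow> real \<Rightarrow> real \<Rightarrow> real \<Rightarrow> real \<Rightarrow> real" where
  "LO_plus x1 x2 x3 x4 R = LO_meas x1 x2 x3 {0..x4} R"

definition LO_minus :: "real \<Rightarrow> real \<Rightarrow> real \<Rightarrow> real \<Rightarrow> real \<Rightarrow> real" where
  "LO_minus x1 x2 x3 x4 R = LO_meas x1 x2 x3 {- x4..0} R"

definition golden :: real where
  "golden = (sqrt 5 - 1) / 2"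

definition zeta2 :: real where
  "zeta2 = pi\<^sup>2 / 6"

text \<open>The dilogarithm on $[-1,1]$, where its series converges; no other arguments occur.\<close>

definition Li2 :: "real \<Rightarrow> real" where
  "Li2 z = (\<Sum>n. z ^ Suc n / (real (Suc n))\<^sup>2)"

definition F_plus :: "real \<Rightarrow> real \<Rightarrow> real \<Rightarrow> real \<Rightarrow> real" where
  "F_plus x1 x2 x3 x4 =
     - (if x3 \<ge> x1 * x2 then Li2 (- (x1 * x2 * x4))
        else Li2 (- (x3 * x4)) - ln (1 + x3 * x4) * ln (x1 * x2 / x3))"

definition F_minus :: "real \<Rightarrow> real \<Rightarrow> real \<Rightarrow> real \<Rightarrow> real" where
  "F_minus x1 x2 x3 x4 =
     (if x3 \<ge> x1 * x2 then Li2 (x1 * x2 * x4)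
      else Li2 (x3 * x4) - ln (1 - x3 * x4) * ln (x1 * x2 / x3))"

definition A_bound :: "real \<Rightarrow> nat \<Rightarrow> real" where
  "A_bound x1 l = (2 * real l + golden) * x1"

definition B_bound :: "real \<Rightarrow> real \<Rightarrow> nat \<Rightarrow> real \<Rightarrow> real" where
  "B_bound x1 x3 l x =
     Min {x3 * x, x1, x / (2 * real l), (x - 1) / (2 * real l - 1)}"

text \<open>The integrals are over sets \<open>{a..b}\<close>, hence \<open>0\<close> for \<open>a \<ge> b\<close>, rather than oriented
  ones.\<close>

definition I_plus :: "real \<Rightarrow> real \<Rightarrow> real \<Rightarrow> real \<Rightarrow> nat \<Rightarrow> real" where
  "I_plus x1 x2 x3 x4 l =
     integral {1 / x2 .. A_bound x1 l} (\<lambda>x.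
       integral {x / (2 * real l + golden) .. B_bound x1 x3 l x} (\<lambda>y.
         x4 / (x * (x + x4 * y))))"

definition I_minus :: "real \<Rightarrow> real \<Rightarrow> real \<Rightarrow> real \<Rightarrow> nat \<Rightarrow> real" where
  "I_minus x1 x2 x3 x4 l =
     integral {1 / x2 .. A_bound x1 l} (\<lambda>x.
       integral {x / (2 * real l + golden) .. B_bound x1 x3 l x} (\<lambda>y.
         x4 / (x * (x - x4 * y))))"

definition D1 :: "real \<Rightarrow> real \<Rightarrow> real \<Rightarrow> real \<Rightarrow> real" where
  "D1 x1 x2 x3 x4 = (\<Sum>l. I_plus x1 x2 x3 x4 (l + 1))"

definition D2 :: "real \<Rightarrow> real \<Rightarrow> real \<Rightarrow> real \<Rightarrow> real" where
  "D2 x1 x2 x3 x4 = F_minus x1 x2 x3 x4 - F_minus x1 x2 (min x3 (golden\<^sup>2)) x4"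

definition D3 :: "real \<Rightarrow> real \<Rightarrow> real \<Rightarrow> real \<Rightarrow> real" where
  "D3 x1 x2 x3 x4 = (\<Sum>l. I_minus x1 x2 x3 x4 (l + 2))"

text \<open>\<open>f\<close> is the quantity, \<open>M\<close> its main term and \<open>a\<close> the exponent of the error. The constant
  in \<open>O\<^sub>\<epsilon>\<close> depends on \<open>\<epsilon>\<close> only: it is uniform in the parameters \<open>x\<^sub>i\<close> and in \<open>R > 1\<close>.\<close>

definition uniform_asymp ::
  "(real \<Rightarrow> real \<Rightarrow> real \<Rightarrow> real \<Rightarrow> real \<Rightarrow> real) \<Rightarrow>
   (real \<Rightarrow> real \<Rightarrow> real \<Rightarrow> real \<Rightarrow> real) \<Rightarrow> real \<Rightarrow> bool" where
  "uniform_asymp f M a \<longleftrightarrow>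
     (\<forall>\<epsilon>>0. \<exists>C. \<forall>x1\<in>{0<..1}. \<forall>x2\<in>{0<..1}. \<forall>x3\<in>{0<..1}. \<forall>x4\<in>{0<..1}. \<forall>R>1.
        \<bar>f x1 x2 x3 x4 R - M x1 x2 x3 x4\<bar> \<le> C * R powr (a + \<epsilon>))"

end

theory Submission
  imports Defs "HOL-Computational_Algebra.Squarefree"
begin

text \<open>The numbers \<open>x\<close> with successive denominators \<open>Q = m\<close>, \<open>Q' = n\<close> and prescribed sign in (b) form an
  interval of length \<open>x4 / (n (n \<plusminus> x4 m))\<close>, provided that \<open>(m, n)\<close> is coprime and the signed ratio
  \<open>\<plusminus> m / n\<close> lies in the window of the expansion. For ECF this turns the measure into a sum of these
  weights over coprime points of opposite parity in a homogeneous region. For OCF one must in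
  addition discard the pairs that pass \<open>R\<close> a second time, after the denominators have dropped back
  below \<open>R\<close>; these fill the wedges that produce \<open>D\<^sub>1\<close> and \<open>D\<^sub>3\<close>, while the window produces \<open>D\<^sub>2\<close>.

  Moebius inversion over dilations of the region removes the coprimality condition. The remaining
  sum over \<open>n\<close> compares with the antiderivative \<open>ln (1 \<plusminus> x4 m / n) / (\<plusminus> m)\<close> and leaves a sum
  of \<open>h (m / R) / m\<close> over \<open>m\<close>, where \<open>h\<close> is nondecreasing with \<open>h y = O(y)\<close>; its integral counterpart
  \<open>\<integral> h y / y dy\<close> is a dilogarithm for \<open>F\<close> and, by Fubini, the integral \<open>I\<^sub>l\<close> for each wedge.\<close>

section \<open>The measure of a pair of successive denominators\<close>

text \<open>The length of an interval involves only the two denominators and not the numerators: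
  read backwards, the denominators determine the digits, and every coprime pair in the window (of
  opposite parity for ECF) arises. So no equidistribution of residues enters, only a count of
  lattice points. Its error is a power of ln R over R for both expansions, which is stronger than
  the exponent -1/2 asserted for OCF.

  Two difficulties shape the estimates. For sign -1 and \<open>x4 = 1\<close> the weight 1 / (n (n -
  m)) is singular at the diagonal and the main term can have an infinite derivative at
  \<open>x1 = 1\<close>. Sums are therefore compared with integrals by monotonicity alone, and the
  row m > R - 1 is treated apart; this also keeps the constants uniform in the parameters. Moreover
  there are infinitely many wedges, so every wedge estimate has to carry a factor 1 / l^2.

  The number g^2 = 1 - g in \<open>D2\<close> is, up to sign, the lower end of the window for odd
  digits; the upper end is 1 + g.\<close>

lemma Omega_iff: "x \<in> Omega \<longleftrightarrow> 0 < x \<and> x < 1 \<and> x \<notin> \<rat>"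
proof -
  have "x \<noteq> 0" "x \<noteq> 1" if "x \<notin> \<rat>"
    using that by auto
  then show ?thesis by (auto simp: Omega_def less_le)
qed

lemma irrational_ne_of_int: "t \<notin> \<rat> \<Longrightarrow> t \<noteq> real_of_int k"
  by auto

lemma inverse_mem_Rats_iff: "1 / t \<in> \<rat> \<longleftrightarrow> (t::real) \<in> \<rat>"
proof
  assume "1 / t \<in> \<rat>"
  then have "1 / (1 / t) \<in> \<rat>" by (rule Rats_divide[OF Rats_1])
  then show "t \<in> \<rat>" by simp
qed (rule Rats_divide[OF Rats_1])

text \<open>The intervals of \<open>D_O\<close> are closed on the left, while the level sets of the
  floor of 1 / t are closed on the right. They differ only at reciprocals of integers, which
  irrationality excludes.\<close>

lemma mem_D_O_iff:
  assumes "t \<in> Omega"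
  shows "t \<in> D_O \<longleftrightarrow> even \<lfloor>1 / t\<rfloor>"
proof -
  have t: "0 < t" "t < 1" "t \<notin> \<rat>" using assms by (auto simp: Omega_iff)
  have inv: "1 / t \<notin> \<rat>" using t by (simp add: inverse_mem_Rats_iff)
  have fl: "\<lfloor>1 / t\<rfloor> \<ge> 1" using t by (simp add: le_floor_iff divide_simps)
  have cell: "t \<in> {1 / (real n + 1) ..< 1 / real n} \<longleftrightarrow> \<lfloor>1 / t\<rfloor> = int n" if "n > 0" for n
  proof -
    have ne: "1 / t \<noteq> real n" "1 / t \<noteq> real n + 1"
      using inv irrational_ne_of_int[OF inv, of "int n"] irrational_ne_of_int[OF inv, of "int n + 1"]
      by auto
    have "1 / (real n + 1) \<le> t \<longleftrightarrow> 1 / t \<le> real n + 1"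
      using t by (simp add: field_simps)
    moreover have "t < 1 / real n \<longleftrightarrow> real n < 1 / t"
      using t that by (simp add: field_simps)
    ultimately show ?thesis using ne by (auto simp: floor_eq_iff less_le)
  qed
  show ?thesis
  proof
    assume "t \<in> D_O"
    then obtain n where "even n" "n \<ge> 2" "t \<in> {1 / (real n + 1) ..< 1 / real n}"
      by (auto simp: D_O_def)
    then show "even \<lfloor>1 / t\<rfloor>" using cell[of n] by auto
  next
    assume ev: "even \<lfloor>1 / t\<rfloor>"
    define n where "n = nat \<lfloor>1 / t\<rfloor>"
    have "int n = \<lfloor>1 / t\<rfloor>" unfolding n_def using fl by (intro nat_0_le) linarith
    moreover have "even n" using ev calculation by (metis even_of_nat)
    moreover have "n \<ge> 2"
    proof -
      have "int n \<ge> 1" using fl \<open>int n = _\<close> by metis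
      with \<open>even n\<close> show ?thesis by presburger
    qed
    ultimately show "t \<in> D_O" using cell[of n] unfolding D_O_def by force
  qed
qed

lemma mem_D_E_iff: "t \<in> Omega \<Longrightarrow> t \<in> D_E \<longleftrightarrow> odd \<lfloor>1 / t\<rfloor>"
  using mem_D_O_iff[of t] by (auto simp: D_E_def Omega_iff)

text \<open>Both expansions at once: \<open>par\<close> is the parity of the digits and (-\<kappa>,
  2 - \<kappa>) the range of the signed ratio rho of successive denominators. A digit a with sign e
  sends rho to e / (a + rho). The two equations say that the ends are the images of rho = -\<kappa>
  under the smallest digits, 2 - \<open>par\<close> with sign 1 and 2 + \<open>par\<close> with sign
  -1. They give \<kappa> = 1 for ECF and the root 1 - g of \<kappa>^2 - 3 \<kappa> + 1 for
  OCF.\<close>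

locale parity_cf =
  fixes D :: "real set" and par :: int and \<kappa> :: real
  assumes mem_D: "\<And>t. t \<in> Omega \<Longrightarrow> t \<in> D \<longleftrightarrow> \<lfloor>1 / t\<rfloor> mod 2 \<noteq> par"
    and par_cases: "par = 0 \<and> \<kappa> = 1 \<or> par = 1 \<and> \<kappa> \<notin> \<rat>"
    and kappa_pos: "0 < \<kappa>" and kappa_le: "\<kappa> \<le> 1"
    and window_plus: "(2 - \<kappa>) * (2 - par - \<kappa>) = 1"
    and window_minus: "\<kappa> * (2 + par - \<kappa>) = 1"
begin

definition digit_ok :: "int \<Rightarrow> int \<Rightarrow> bool" where
  "digit_ok a e \<longleftrightarrow> a mod 2 = par \<and> (e = 1 \<and> a \<ge> 2 - par \<or> e = -1 \<and> a \<ge> 2 + par)"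

lemma window_plus_pos: "2 - par - \<kappa> > 0"
proof (rule ccontr)
  assume "\<not> 2 - par - \<kappa> > 0"
  then have "(2 - \<kappa>) * (2 - par - \<kappa>) \<le> 0"
    using kappa_le by (intro mult_nonneg_nonpos) auto
  with window_plus show False by simp
qed

lemma digit_ok_mod: "digit_ok a e \<Longrightarrow> a mod 2 = par"
  by (simp add: digit_ok_def)

text \<open>Membership in \<open>D\<close> means that the floor of 1 / t has the wrong parity.
  Rounding up instead of down then restores the parity, at the price of the sign -1.\<close>

lemma digit_step:
  assumes "t \<in> Omega"
  shows "T_map D t \<in> Omega"
    and "1 / t = of_int (a_digit D t) + of_int (e_digit D t) * T_map D t"
    and "digit_ok (a_digit D t) (e_digit D t)"
proof -
  have t: "0 < t" "t < 1" "t \<notin> \<rat>" using assms by (auto simp: Omega_iff)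
  have inv: "1 / t \<notin> \<rat>" using t by (simp add: inverse_mem_Rats_iff)
  have fr: "frac (1/t) \<notin> \<rat>"
  proof
    assume "frac (1/t) \<in> \<rat>"
    then have "frac (1/t) + of_int \<lfloor>1/t\<rfloor> \<in> \<rat>" by (intro Rats_add) auto
    with inv show False by (simp add: frac_def)
  qed
  have fr1: "1 - frac (1/t) \<notin> \<rat>"
  proof
    assume "1 - frac (1/t) \<in> \<rat>"
    then have "1 - (1 - frac (1/t)) \<in> \<rat>" by (rule Rats_diff[OF Rats_1])
    moreover have "1 - (1 - frac (1/t)) = frac (1/t)" by simp
    ultimately show False using fr by metis
  qed
  have "frac (1/t) \<noteq> 0" using fr by (metis Rats_0)
  then have fb: "0 < frac (1/t)" "frac (1/t) < 1"
    using frac_ge_0[of "1/t"] frac_lt_1[of "1/t"] by linarith+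
  have fl: "\<lfloor>1 / t\<rfloor> \<ge> 1" using t by (simp add: le_floor_iff divide_simps)
  show "T_map D t \<in> Omega"
    using fb fr fr1 by (auto simp: T_map_def Omega_iff)
  show "1 / t = of_int (a_digit D t) + of_int (e_digit D t) * T_map D t"
    by (auto simp: a_digit_def e_digit_def T_map_def frac_def)
  show "digit_ok (a_digit D t) (e_digit D t)"
  proof -
    obtain f where f: "\<lfloor>1 / t\<rfloor> = f" "f \<ge> 1" using fl by blast
    have cs: "par = 0 \<or> par = 1" using par_cases by blast
    have m: "t \<in> D \<longleftrightarrow> f mod 2 \<noteq> par" using mem_D[OF assms] unfolding f(1) .
    show ?thesis
    proof (cases "t \<in> D")
      case True
      then have "f mod 2 \<noteq> par" using m by blast
      then have "(1 + f) mod 2 = par" "1 + f \<ge> 2 + par" using cs f(2) by presburger+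
      then show ?thesis using True by (simp add: digit_ok_def a_digit_def e_digit_def f(1))
    next
      case False
      then have "f mod 2 = par" using m by blast
      then have "f mod 2 = par" "f \<ge> 2 - par" using cs f(2) by presburger+
      then show ?thesis using False by (simp add: digit_ok_def a_digit_def e_digit_def f(1))
    qed
  qed
qed

text \<open>Each digit with its sign belongs to a full branch of the map: any tail in
  \<open>Omega\<close> may follow, and no rule links consecutive pairs. This freedom is what later
  makes \<open>gap_set\<close> fill an interval up to rational points.\<close>

lemma digit_inverse:
  assumes "t' \<in> Omega" "digit_ok a e"
  defines "t \<equiv> 1 / (of_int a + of_int e * t')"
  shows "t \<in> Omega" "a_digit D t = a" "e_digit D t = e" "T_map D t = t'"
proof -
  have t': "0 < t'" "t' < 1" "t' \<notin> \<rat>" using assms by (auto simp: Omega_iff)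
  define w where "w = of_int a + of_int e * t'"
  have e: "e = 1 \<or> e = -1" using assms(2) by (auto simp: digit_ok_def)
  have ab: "a \<ge> 1" "e = -1 \<Longrightarrow> a \<ge> 2"
    using assms(2) par_cases by (auto simp: digit_ok_def)
  have w1: "w > 1"
    using e ab t' unfolding w_def by auto
  have wr: "w \<notin> \<rat>"
  proof
    assume "w \<in> \<rat>"
    then have "(w - of_int a) * of_int e \<in> \<rat>" by (intro Rats_mult Rats_diff) auto
    with e t' show False by (auto simp: w_def)
  qed
  have tr: "t \<notin> \<rat>" using wr by (simp add: t_def w_def inverse_mem_Rats_iff)
  show tO: "t \<in> Omega"
    using w1 tr by (auto simp: Omega_iff t_def w_def)
  have tw: "1 / t = w" by (simp add: t_def w_def)
  have fl: "\<lfloor>w\<rfloor> = (if e = 1 then a else a - 1)"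
    using e t' unfolding w_def by (auto simp: floor_eq_iff)
  have tD: "t \<in> D \<longleftrightarrow> e = -1"
    unfolding mem_D[OF tO] tw fl using assms(2) e par_cases
    by (auto simp: digit_ok_def) presburger+
  show "a_digit D t = a" "e_digit D t = e"
    using e fl tw tD by (auto simp: a_digit_def e_digit_def)
  have "frac w = (if e = 1 then t' else 1 - t')"
    unfolding frac_def fl using e by (auto simp: w_def)
  then show "T_map D t = t'"
    using e tD unfolding T_map_def tw by auto
qed

lemma orbit_Omega: "x \<in> Omega \<Longrightarrow> (T_map D ^^ n) x \<in> Omega"
  by (induction n) (auto simp: digit_step(1))

lemma digit_ok_orbit: "x \<in> Omega \<Longrightarrow> digit_ok (cf_a D x (Suc n)) (cf_e D x (Suc n))"
  using digit_step(3)[OF orbit_Omega[of x n]] by (simp add: cf_a_def cf_e_def)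

lemma orbit_step:
  assumes "x \<in> Omega"
  shows "(T_map D ^^ n) x * (of_int (cf_a D x (Suc n)) + of_int (cf_e D x (Suc n)) * (T_map D ^^ Suc n) x) = 1"
  using digit_step(2)[OF orbit_Omega[OF assms, of n]] orbit_Omega[OF assms, of n]
  by (simp add: cf_a_def cf_e_def Omega_iff field_simps)

lemma cf_e_cases: "cf_e D x n = 1 \<or> cf_e D x n = -1"
  by (simp add: cf_e_def e_digit_def)

lemma cf_det: "\<bar>cf_p D x n * cf_q D x (Suc n) - cf_p D x (Suc n) * cf_q D x n\<bar> = 1"
proof (induction n)
  case 0
  then show ?case by (simp add: cf_e_def)
next
  case (Suc n)
  have "cf_p D x (Suc n) * cf_q D x (Suc (Suc n)) - cf_p D x (Suc (Suc n)) * cf_q D x (Suc n)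
     = - cf_e D x (Suc n) * (cf_p D x n * cf_q D x (Suc n) - cf_p D x (Suc n) * cf_q D x n)"
    by (simp add: algebra_simps)
  then show ?case using Suc cf_e_cases[of x "Suc n"] by (auto simp: abs_mult)
qed

lemma cf_q_coprime: "coprime (cf_q D x n) (cf_q D x (Suc n))"
proof (rule coprimeI)
  fix c assume "c dvd cf_q D x n" "c dvd cf_q D x (Suc n)"
  then have "c dvd cf_p D x n * cf_q D x (Suc n) - cf_p D x (Suc n) * cf_q D x n"
    by (intro dvd_diff dvd_mult)
  with cf_det[of x n] show "is_unit c" by (metis dvd_abs_iff)
qed

text \<open>The next signed ratio is e q / (a q + r). Since r / q > -\<kappa>, it is bounded by its
  values for the smallest digit of either sign, and there \<open>window_plus\<close> and
  \<open>window_minus\<close> return exactly the ends of the window.\<close>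

lemma window_step:
  assumes "digit_ok a e" "q > 0" "- \<kappa> * q < r"
  shows "of_int a * q + r > 0" "- \<kappa> * (of_int a * q + r) < of_int e * q"
        "of_int e * q < (2 - \<kappa>) * (of_int a * q + r)"
proof -
  let ?n = "of_int a * q + r"
  have n: "?n > (of_int a - \<kappa>) * q" using assms by (simp add: algebra_simps)
  have cs: "par = 0 \<or> par = 1" using par_cases by auto
  have a1: "real_of_int a \<ge> 2 - par" using assms(1) cs by (auto simp: digit_ok_def)
  note b0 = window_plus_pos
  have "(2 - par - \<kappa>) * q \<le> (of_int a - \<kappa>) * q"
    using a1 assms(2) by (intro mult_right_mono) auto
  with n have n1: "?n > (2 - par - \<kappa>) * q" by linarith
  have "(2 - par - \<kappa>) * q > 0" using b0 assms(2) by simp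
  with n1 show pos: "?n > 0" by linarith
  have "(2 - \<kappa>) * ((2 - par - \<kappa>) * q) < (2 - \<kappa>) * ?n"
    using n1 kappa_le by (intro mult_strict_left_mono) auto
  then have up: "q < (2 - \<kappa>) * ?n"
    using window_plus by (metis mult.assoc mult_1)
  show "of_int e * q < (2 - \<kappa>) * ?n"
    using up assms(1,2) by (auto simp: digit_ok_def)
  have lo: "q < \<kappa> * ?n" if "e = -1"
  proof -
    have "real_of_int a \<ge> 2 + par" using assms(1) that by (auto simp: digit_ok_def)
    then have "(2 + par - \<kappa>) * q \<le> (of_int a - \<kappa>) * q"
      using assms(2) by (intro mult_right_mono) auto
    with n have "?n > (2 + par - \<kappa>) * q" by linarith
    then have "\<kappa> * ((2 + par - \<kappa>) * q) < \<kappa> * ?n"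
      using kappa_pos by (intro mult_strict_left_mono) auto
    then show ?thesis using window_minus by (metis mult.assoc mult_1)
  qed
  show "- \<kappa> * ?n < of_int e * q"
  proof (cases "e = -1")
    case True
    then show ?thesis using lo by simp
  next
    case False
    then have "e = 1" using assms(1) by (auto simp: digit_ok_def)
    moreover have "\<kappa> * ?n > 0" using pos kappa_pos by simp
    ultimately show ?thesis using assms(2) by simp
  qed
qed

end

section \<open>Coding of expansions by pairs of successive denominators\<close>

context parity_cf
begin

text \<open>The signed ratio of successive denominators lives in the open interval
  \<open>(- \<kappa>, 2 - \<kappa>)\<close>, whose length equals the gap between digits of the same parity; this is what
  makes the digits recoverable from the last two denominators.\<close>

lemma cf_q_window:
  assumes "x \<in> Omega"
  shows "cf_q D x n > 0 \<and> cf_q D x (Suc n) > 0 \<and>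
    - \<kappa> * of_int (cf_q D x (Suc n)) < of_int (cf_e D x (Suc n) * cf_q D x n) \<and>
    of_int (cf_e D x (Suc n) * cf_q D x n) < (2 - \<kappa>) * of_int (cf_q D x (Suc n))"
proof (induction n)
  case 0
  have "digit_ok (cf_a D x (Suc 0)) (cf_e D x (Suc 0))" using digit_ok_orbit[OF assms] .
  from window_step[OF this, of 1 0] kappa_pos show ?case by simp
next
  case (Suc n)
  have d: "digit_ok (cf_a D x (Suc (Suc n))) (cf_e D x (Suc (Suc n)))" using digit_ok_orbit[OF assms] .
  from Suc have "real_of_int (cf_q D x (Suc n)) > 0"
    "- \<kappa> * of_int (cf_q D x (Suc n)) < of_int (cf_e D x (Suc n) * cf_q D x n)" by auto
  from window_step[OF d this]
  have *: "real_of_int (cf_q D x (Suc (Suc n))) > 0"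
    "- \<kappa> * real_of_int (cf_q D x (Suc (Suc n))) < of_int (cf_e D x (Suc (Suc n)) * cf_q D x (Suc n))"
    "of_int (cf_e D x (Suc (Suc n)) * cf_q D x (Suc n)) < (2 - \<kappa>) * real_of_int (cf_q D x (Suc (Suc n)))"
    by simp_all
  have "cf_q D x (Suc (Suc n)) > 0" using *(1) by linarith
  then show ?case using Suc *(2,3) by (intro conjI) (blast, assumption+)
qed

lemma cf_q_pos: "x \<in> Omega \<Longrightarrow> cf_q D x n > 0"
  using cf_q_window by blast

text \<open>The number as a Moebius transform of its tail, with the denominator cleared. The
  inductive step multiplies by 1 / t = a + e' t', which turns the old tail into the next digit and
  the next tail.\<close>

lemma cf_value:
  assumes "x \<in> Omega"
  shows "x * (of_int (cf_q D x (Suc n)) + of_int (cf_e D x (Suc n)) * (T_map D ^^ Suc n) x * of_int (cf_q D x n))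
    = of_int (cf_p D x (Suc n)) + of_int (cf_e D x (Suc n)) * (T_map D ^^ Suc n) x * of_int (cf_p D x n)"
proof (induction n)
  case 0
  then show ?case using orbit_step[OF assms, of 0] by (simp add: cf_e_def)
next
  case (Suc n)
  define t where "t = (T_map D ^^ Suc n) x"
  define t' where "t' = (T_map D ^^ Suc (Suc n)) x"
  define a e e' where "a = real_of_int (cf_a D x (Suc (Suc n)))" and
    "e = real_of_int (cf_e D x (Suc n))" and "e' = real_of_int (cf_e D x (Suc (Suc n)))"
  have t: "t * (a + e' * t') = 1" and "t > 0"
    using orbit_step[OF assms, of "Suc n"] orbit_Omega[OF assms, of "Suc n"]
    by (auto simp: t_def t'_def a_def e'_def Omega_iff)
  define Q0 Q P0 P where defs: "Q0 = real_of_int (cf_q D x n)" "Q = real_of_int (cf_q D x (Suc n))"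
    "P0 = real_of_int (cf_p D x n)" "P = real_of_int (cf_p D x (Suc n))"
  have IH: "x * (Q + e * t * Q0) = P + e * t * P0"
    using Suc unfolding defs t_def e_def by simp
  have "(a + e' * t') * (x * (Q + e * t * Q0)) = (a + e' * t') * (P + e * t * P0)"
    using IH by simp
  moreover have "(a + e' * t') * (x * (Q + e * t * Q0)) = x * ((a + e' * t') * Q + e * (t * (a + e' * t')) * Q0)"
    by (simp add: algebra_simps)
  moreover have "(a + e' * t') * (P + e * t * P0) = (a + e' * t') * P + e * (t * (a + e' * t')) * P0"
    by (simp add: algebra_simps)
  ultimately have "x * ((a + e' * t') * Q + e * Q0) = (a + e' * t') * P + e * P0"
    unfolding t by simp
  then have "x * ((a * Q + e * Q0) + e' * t' * Q) = (a * P + e * P0) + e' * t' * P"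
    by (simp add: algebra_simps)
  then show ?case unfolding a_def e_def e'_def t'_def defs by simp
qed

text \<open>The window for the remainder has length 2 q, so the two quotients differ by less than 2;
  equal parity then forces equality.\<close>

lemma same_parity_close:
  fixes a b :: int
  assumes "a mod 2 = b mod 2" "q > 0" "of_int a * q + r = of_int b * q + r'"
    "- \<kappa> * q < r" "r < (2 - \<kappa>) * q" "- \<kappa> * q < r'" "r' < (2 - \<kappa>) * q"
  shows "a = b"
proof -
  have "of_int (a - b) * q = r' - r" using assms(3) by (simp add: algebra_simps)
  then have "\<bar>of_int (a - b) * q\<bar> < 2 * q" using assms(4-7) by (simp add: algebra_simps)
  then have "\<bar>real_of_int (a - b)\<bar> < 2" using assms(2) by (simp add: abs_mult)
  then have "\<bar>a - b\<bar> < 2" by linarith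
  with assms(1) show ?thesis by presburger
qed

text \<open>A division algorithm run backwards: the remainder window and the parity determine the
  last digit from the two denominators, the rest gives the sign and the previous denominator, and
  the descent ends at q_0 = 1. The numerators follow because they obey the same recurrence with the
  same digits and signs.\<close>

lemma cf_pair_unique:
  assumes "x \<in> Omega" "y \<in> Omega"
    "cf_q D x n = cf_q D y k" "cf_q D x (Suc n) = cf_q D y (Suc k)"
  shows "n = k \<and> cf_p D x n = cf_p D y k \<and> cf_p D x (Suc n) = cf_p D y (Suc k)"
  using assms
proof (induction n arbitrary: k x y rule: less_induct)
  case (less n)
  show ?case
  proof (cases n; cases k)
    assume [simp]: "n = 0" "k = 0"
    show ?thesis using less.prems by (simp add: cf_e_def)
  next
    \<comment> \<open>One descent has reached its start while the other has not. At the start the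
      remainder is q_{-1} = 0, so equal digits would force a vanishing denominator in the other
      expansion.\<close>
    have sep: False if "x \<in> Omega" "y \<in> Omega" "cf_q D x 0 = cf_q D y (Suc j)"
      "cf_q D x (Suc 0) = cf_q D y (Suc (Suc j))" for x y j
    proof -
      have 1: "cf_q D y (Suc j) = 1" using that by simp
      have w: "- \<kappa> < of_int (cf_e D y (Suc j) * cf_q D y j)"
        "of_int (cf_e D y (Suc j) * cf_q D y j) < (2 - \<kappa>)"
        using cf_q_window[OF that(2), of j] 1 by auto
      have eq: "cf_a D x (Suc 0) = cf_a D y (Suc (Suc j)) + cf_e D y (Suc j) * cf_q D y j"
        using that(4) 1 by simp
      have "cf_a D x (Suc 0) = cf_a D y (Suc (Suc j))"
        by (rule same_parity_close[of _ _ 1 0 "of_int (cf_e D y (Suc j) * cf_q D y j)"])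
           (use w kappa_pos kappa_le eq digit_ok_mod[OF digit_ok_orbit[OF that(1), of 0]]
              digit_ok_mod[OF digit_ok_orbit[OF that(2), of "Suc j"]] in auto)
      with eq have "cf_q D y j = 0" using cf_e_cases[of y "Suc j"] by auto
      with cf_q_pos[OF that(2), of j] show False by simp
    qed
    {
      fix j assume [simp]: "n = 0" "k = Suc j"
      show ?thesis using sep[OF less.prems(1,2), of j] less.prems by simp
    next
      fix j assume [simp]: "n = Suc j" "k = 0"
      show ?thesis using sep[OF less.prems(2,1), of j] less.prems by simp
    }
  next
    fix n' k' assume [simp]: "n = Suc n'" "k = Suc k'"
    define Q where "Q = cf_q D x (Suc n')"
    have Q: "cf_q D y (Suc k') = Q" "Q > 0"
      using less.prems cf_q_pos[OF less.prems(1), of "Suc n'"] by (simp_all add: Q_def)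
    have eq: "cf_a D x (Suc n) * Q + cf_e D x n * cf_q D x n'
        = cf_a D y (Suc k) * Q + cf_e D y k * cf_q D y k'"
      using less.prems Q by (simp add: Q_def)
    have "real_of_int (cf_a D x (Suc n) * Q + cf_e D x n * cf_q D x n')
        = real_of_int (cf_a D y (Suc k) * Q + cf_e D y k * cf_q D y k')"
      using eq by simp
    then have eqr: "real_of_int (cf_a D x (Suc n)) * real_of_int Q + of_int (cf_e D x n * cf_q D x n')
        = real_of_int (cf_a D y (Suc k)) * of_int Q + of_int (cf_e D y k * cf_q D y k')" by simp
    have a: "cf_a D x (Suc n) = cf_a D y (Suc k)"
      by (rule same_parity_close[OF _ _ eqr])
         (use Q cf_q_window[OF less.prems(1), of n'] cf_q_window[OF less.prems(2), of k']
            digit_ok_mod[OF digit_ok_orbit[OF less.prems(1), of n]]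
            digit_ok_mod[OF digit_ok_orbit[OF less.prems(2), of k]]
           in \<open>auto simp: Q_def\<close>)
    with eq have "cf_e D x n * cf_q D x n' = cf_e D y k * cf_q D y k'" by simp
    then have e: "cf_e D x n = cf_e D y k" "cf_q D x n' = cf_q D y k'"
      using cf_e_cases[of x n] cf_e_cases[of y k] cf_q_pos[OF less.prems(1), of n'] cf_q_pos[OF less.prems(2), of k']
      by auto
    have "n' = k' \<and> cf_p D x n' = cf_p D y k' \<and> cf_p D x (Suc n') = cf_p D y (Suc k')"
      using less.prems e by (intro less.IH) auto
    then have p: "n' = k'" "cf_p D x n' = cf_p D y k'" "cf_p D x n = cf_p D y k" by auto
    have "cf_p D x (Suc n) = cf_p D y (Suc k)"
      using p(2,3) a e(1) unfolding \<open>n = Suc n'\<close> \<open>k = Suc k'\<close> cf_p.simps by metis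
    with p show ?thesis using \<open>n = Suc n'\<close> \<open>k = Suc k'\<close> by blast
  qed
qed

text \<open>Modulo 2 an even digit merely swaps the two denominators, starting from the odd q_0 and
  the even q_1, so their sum stays odd. With odd digits all three coprime classes modulo 2 occur,
  and coprimality is the only arithmetic condition.\<close>

definition pair_ok :: "int \<Rightarrow> int \<Rightarrow> bool" where
  "pair_ok m n \<longleftrightarrow> coprime m n \<and> (par = 0 \<longrightarrow> odd (m + n))"

lemma cf_q_pair_ok:
  assumes "x \<in> Omega"
  shows "pair_ok (cf_q D x n) (cf_q D x (Suc n))"
proof -
  have "odd (cf_q D x n + cf_q D x (Suc n))" if "par = 0"
  proof (induction n)
    case 0
    then show ?case using digit_ok_mod[OF digit_ok_orbit[OF assms, of 0]] that by auto
  next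
    case (Suc n)
    have "even (cf_a D x (Suc (Suc n)))"
      using digit_ok_mod[OF digit_ok_orbit[OF assms, of "Suc n"]] that by auto
    moreover have "odd (cf_e D x (Suc n))" using cf_e_cases[of x "Suc n"] by auto
    ultimately show ?case using Suc by auto
  qed
  then show ?thesis using cf_q_coprime by (auto simp: pair_ok_def)
qed

text \<open>Division with a quotient of prescribed parity: consecutive admissible quotients differ
  by 2, so the remainders fill a half-open interval of length 2 m, here placed at the window of the
  signed ratio.\<close>

lemma parity_remainder:
  fixes m n :: int
  assumes "m > 0" "pair_ok m n"
  obtains a r where "n = a * m + r" "a mod 2 = par" "- \<kappa> * of_int m < of_int r" "of_int r < (2 - \<kappa>) * of_int m"
proof -
  define a where "a = 2 * \<lfloor>(real_of_int n / of_int m + \<kappa> - par) / 2\<rfloor> + par"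
  define r where "r = n - a * m"
  have par: "a mod 2 = par" using par_cases by (auto simp: a_def)
  let ?z = "(real_of_int n / of_int m + \<kappa> - par) / 2"
  have "of_int \<lfloor>?z\<rfloor> \<le> ?z" "?z < of_int \<lfloor>?z\<rfloor> + 1" by linarith+
  moreover have "of_int a = 2 * of_int \<lfloor>?z\<rfloor> + real_of_int par" by (simp add: a_def)
  ultimately have "of_int a \<le> real_of_int n / of_int m + \<kappa> \<and> real_of_int n / of_int m + \<kappa> < of_int a + 2"
    by argo
  then have lo: "- \<kappa> * of_int m \<le> of_int r" and up: "of_int r < (2 - \<kappa>) * of_int m"
    using assms(1) by (auto simp: r_def field_simps)
  \<comment> \<open>For OCF the end is irrational. For ECF the remainder r = -m would make m divide
    n, hence m = 1 by coprimality and n = a - 1 odd, against the opposite parity of m and n.\<close>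
  have "- \<kappa> * of_int m \<noteq> of_int r"
  proof
    assume eq: "- \<kappa> * of_int m = of_int r"
    have k: "\<kappa> = of_int (-r) / of_int m" using eq assms(1) by (simp add: field_simps)
    have "par = 0" "\<kappa> = 1" using par_cases k Rats_of_int Rats_divide by metis+
    with eq have "r = - m" by simp
    then have "n = (a - 1) * m" by (simp add: r_def algebra_simps)
    then have "m dvd n" by simp
    then have "m = 1" using assms by (auto simp: pair_ok_def)
    have "odd (m + n)" "even a" using assms(2) \<open>par = 0\<close> par unfolding pair_ok_def by auto
    with \<open>n = _\<close> \<open>m = 1\<close> show False by simp
  qed
  with lo have "- \<kappa> * of_int m < of_int r" by simp
  with up par show ?thesis using that[of a r] by (simp add: r_def)
qed

text \<open>Euclid's algorithm with the remainders of \<open>parity_remainder\<close>: (m, n) is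
  preceded by (|r|, m) with the sign of r, and r = 0 means that the start is reached. The index N is
  chosen before the tail t, so one index serves the whole set of numbers with these
  denominators.\<close>

lemma cf_pair_exists:
  assumes "m > 0" "n > 0" "pair_ok m n" "e = 1 \<or> e = -1"
    "- \<kappa> * of_int n < of_int (e * m)" "of_int (e * m) < (2 - \<kappa>) * of_int n"
  shows "\<exists>N. \<forall>t\<in>Omega. \<exists>x\<in>Omega. cf_q D x N = m \<and> cf_q D x (Suc N) = n \<and>
    cf_e D x (Suc N) = e \<and> (T_map D ^^ Suc N) x = t"
  using assms
proof (induction "nat (m + n)" arbitrary: m n e rule: less_induct)
  case less
  obtain a r where ar: "n = a * m + r" "a mod 2 = par"
    and r: "- \<kappa> * of_int m < of_int r" "of_int r < (2 - \<kappa>) * of_int m"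
    using parity_remainder[OF less.prems(1,3)] by blast
  have cs: "par = 0 \<or> par = 1" using par_cases by auto
  have am: "(of_int a + (2 - \<kappa>)) * of_int m > real_of_int n"
    using r ar by (simp add: algebra_simps)
  \<comment> \<open>The bound on e m / n and n < (a + 2 - \<kappa>) m, combined through the equation
    for the relevant end of the window, bound a from below. Parity then raises the bound to the one
    required by \<open>digit_ok\<close>.\<close>
  have a_par: "e = 1 \<Longrightarrow> a > - par" "e = -1 \<Longrightarrow> a > par"
  proof -
    assume "e = 1"
    then have "(2 - par - \<kappa>) * of_int m < (2 - par - \<kappa>) * ((2 - \<kappa>) * of_int n)"
      using less.prems(6) window_plus_pos \<open>e = 1\<close> by (intro mult_strict_left_mono) auto
    also have "\<dots> = of_int n" using window_plus by (metis mult.assoc mult.commute mult_1)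
    also note am
    finally have "2 - par - \<kappa> < of_int a + (2 - \<kappa>)" using less.prems(1) by simp
    then show "a > - par" by simp
  next
    assume "e = -1"
    then have "(2 + par - \<kappa>) * of_int m < (2 + par - \<kappa>) * (\<kappa> * of_int n)"
      using less.prems(5) kappa_le cs by (intro mult_strict_left_mono) auto
    also have "\<dots> = of_int n" using window_minus by (metis mult.assoc mult.commute mult_1)
    also note am
    finally have "2 + par - \<kappa> < of_int a + (2 - \<kappa>)" using less.prems(1) by simp
    then show "a > par" by simp
  qed
  have dok: "digit_ok a e"
    using ar(2) a_par less.prems(4) cs unfolding digit_ok_def by auto presburger+
  show ?case
  proof (cases "r = 0")
    case True
    have "m = 1" using less.prems(1,3) ar True by (simp add: pair_ok_def)
    show ?thesis
    proof (intro exI[of _ 0] ballI)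
      fix t assume t: "t \<in> Omega"
      show "\<exists>x\<in>Omega. cf_q D x 0 = m \<and> cf_q D x (Suc 0) = n \<and> cf_e D x (Suc 0) = e \<and> (T_map D ^^ Suc 0) x = t"
        using digit_inverse[OF t dok] ar True \<open>m = 1\<close>
        by (intro bexI[of _ "1 / (of_int a + of_int e * t)"]) (auto simp: cf_a_def cf_e_def)
    qed
  next
    case False
    define e' m' where "e' = sgn r" and "m' = \<bar>r\<bar>"
    have em: "e' * m' = r" "m' > 0" "e' = 1 \<or> e' = -1"
      using False by (auto simp: e'_def m'_def sgn_if)
    have ok: "pair_ok m' m"
    proof -
      have "coprime r m" using less.prems(3) ar unfolding pair_ok_def
        by (metis add.commute coprime_commute coprime_iff_gcd_eq_1 gcd_add_mult)
      moreover have "odd (r + m)" if "par = 0"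
        using that less.prems(3) ar unfolding pair_ok_def by auto
      ultimately show ?thesis by (auto simp: pair_ok_def m'_def)
    qed
    have a1: "a \<ge> 1" using dok cs by (auto simp: digit_ok_def)
    \<comment> \<open>For OCF the remainder may exceed m, so the descent is in m + n and needs m' <
      n. For r > 0 this is n = a m + r. For r < 0 it follows from a \<ge> 2 and m' < m for ECF, and
      from 2 m' < m for OCF.\<close>
    have "m' < n"
    proof (cases "r > 0")
      case True
      have "a * m \<ge> 1 * m" using a1 less.prems(1) by (intro mult_right_mono) auto
      then show ?thesis using True ar less.prems(1) by (simp add: m'_def)
    next
      case r0: False
      have "\<kappa> * of_int m > real_of_int m'" using r r0 by (simp add: m'_def)
      have n': "n = a * m - m'" using ar r0 by (simp add: m'_def)
      show ?thesis
      proof (cases "par = 0")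
        case True
        then have "a \<ge> 2" using a1 ar(2) by presburger
        then have "a * m \<ge> 2 * m" using less.prems(1) by (intro mult_right_mono) auto
        moreover have "m > m'" using \<open>\<kappa> * of_int m > real_of_int m'\<close> par_cases True by auto
        ultimately show ?thesis using n' by linarith
      next
        case pF: False
        have pr: "par = 1" using pF cs by auto
        have "\<kappa> \<le> 1/2"
        proof (rule ccontr)
          assume "\<not> \<kappa> \<le> 1/2"
          moreover have "\<kappa> * (3 - \<kappa>) \<ge> \<kappa> * 2" using kappa_le kappa_pos by (intro mult_left_mono) auto
          ultimately have "\<kappa> * (3 - \<kappa>) > 1" by linarith
          with window_minus pr show False by simp
        qed
        then have "real_of_int m' < 1/2 * of_int m"
          using \<open>\<kappa> * of_int m > real_of_int m'\<close> less.prems(1)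
          by (smt (verit) mult_right_mono of_int_0_le_iff)
        then have "2 * m' < m" by linarith
        moreover have "a * m \<ge> 1 * m" using a1 less.prems(1) by (intro mult_right_mono) auto
        ultimately show ?thesis using n' by linarith
      qed
    qed
    then have "nat (m' + m) < nat (m + n)" using em less.prems by auto
    from less.hyps[OF this em(2) less.prems(1) ok em(3)] r em
    obtain N where N: "\<forall>t\<in>Omega. \<exists>x\<in>Omega. cf_q D x N = m' \<and> cf_q D x (Suc N) = m \<and>
        cf_e D x (Suc N) = e' \<and> (T_map D ^^ Suc N) x = t"
      by auto
    show ?thesis
    proof (intro exI[of _ "Suc N"] ballI)
      fix t assume t: "t \<in> Omega"
      define u where "u = 1 / (of_int a + of_int e * t)"
      note u = digit_inverse[OF t dok, folded u_def]
      obtain x where x: "x \<in> Omega" "cf_q D x N = m'" "cf_q D x (Suc N) = m"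
        "cf_e D x (Suc N) = e'" "(T_map D ^^ Suc N) x = u"
        using N u(1) by blast
      have "cf_a D x (Suc (Suc N)) = a" "cf_e D x (Suc (Suc N)) = e" "(T_map D ^^ Suc (Suc N)) x = t"
        using x(5) u by (auto simp: cf_a_def cf_e_def)
      then show "\<exists>x\<in>Omega. cf_q D x (Suc N) = m \<and> cf_q D x (Suc (Suc N)) = n \<and>
          cf_e D x (Suc (Suc N)) = e \<and> (T_map D ^^ Suc (Suc N)) x = t"
        using x em ar by (intro bexI[of _ x]) (auto simp: algebra_simps)
    qed
  qed
qed

end

section \<open>The set of numbers with a given pair of denominators\<close>

lemma Omega_nonempty: "Omega \<noteq> {}"
proof
  assume "Omega = {}"
  then have "{0..1::real} \<subseteq> \<rat>" by (auto simp: Omega_def)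
  then have "countable {0..1::real}" using countable_rat countable_subset by blast
  then show False using uncountable_closed_interval[of "0::real" 1] by simp
qed

lemma Rats_null_lebesgue: "(\<rat> :: real set) \<in> null_sets lebesgue"
  using countable_rat countable_imp_null_set_lborel null_sets_completionI by blast

lemma divide_le_divide_cross:
  fixes a b x y :: real
  assumes "0 < a" "0 < b" "x * b \<le> y * a"
  shows "x / a \<le> y / b"
  using assms by (simp add: field_simps)

definition gap_range :: "int \<Rightarrow> real \<Rightarrow> real set" where
  "gap_range s c = {z. 0 \<le> of_int s * z \<and> of_int s * z \<le> c}"

lemma gap_range_simps: "gap_range 1 c = {0..c}" "gap_range (-1) c = {- c..0}"
  by (auto simp: gap_range_def)

context parity_cf
begin

text \<open>Solving \<open>cf_value\<close> for the tail: the quotient in (b) is the tail with its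
  sign. So the sign in (b) selects e, and \<open>x4\<close> becomes an upper bound for the
  tail.\<close>

lemma gap_ratio_orbit:
  assumes "x \<in> Omega"
  shows "gap_ratio x (cf_p D x N) (cf_q D x N) (cf_p D x (Suc N)) (cf_q D x (Suc N))
    = of_int (cf_e D x (Suc N)) * (T_map D ^^ Suc N) x"
proof -
  have "x \<notin> \<rat>" using assms by (simp add: Omega_iff)
  have "of_int (cf_p D x N) - x * of_int (cf_q D x N) \<noteq> 0"
  proof
    assume "of_int (cf_p D x N) - x * of_int (cf_q D x N) = 0"
    then have "x = of_int (cf_p D x N) / of_int (cf_q D x N)"
      using cf_q_pos[OF assms, of N] by (simp add: field_simps)
    then have "x \<in> \<rat>" by (metis Rats_divide Rats_of_int)
    with \<open>x \<notin> \<rat>\<close> show False by blast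
  qed
  then show ?thesis using cf_value[OF assms, of N] unfolding gap_ratio_def
    by (simp add: field_simps del: cf_p.simps cf_q.simps funpow.simps)
qed

definition gap_set :: "int \<Rightarrow> real \<Rightarrow> int \<Rightarrow> int \<Rightarrow> real set" where
  "gap_set s c m n = {x \<in> Omega. \<exists>N. cf_q D x N = m \<and> cf_q D x (Suc N) = n \<and>
     gap_ratio x (cf_p D x N) m (cf_p D x (Suc N)) n \<in> gap_range s c}"

text \<open>The triples that actually occur: \<open>gap_set_admissible\<close> gives necessity,
  \<open>cf_pair_exists\<close> sufficiency.\<close>

definition admissible :: "int \<Rightarrow> int \<Rightarrow> int \<Rightarrow> bool" where
  "admissible s m n \<longleftrightarrow> m > 0 \<and> n > 0 \<and> pair_ok m n \<and>
     - \<kappa> * of_int n < of_int (s * m) \<and> of_int (s * m) < (2 - \<kappa>) * of_int n"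

lemma gap_set_sign:
  assumes "x \<in> Omega" "s = 1 \<or> s = -1"
    "gap_ratio x (cf_p D x N) (cf_q D x N) (cf_p D x (Suc N)) (cf_q D x (Suc N)) \<in> gap_range s c"
  shows "cf_e D x (Suc N) = s"
proof -
  have "(T_map D ^^ Suc N) x > 0" using orbit_Omega[OF assms(1), of "Suc N"] by (simp only: Omega_iff)
  then show ?thesis
    using assms(2,3) cf_e_cases[of x "Suc N"] unfolding gap_ratio_orbit[OF assms(1)] gap_range_def by auto
qed

lemma gap_set_admissible:
  assumes "x \<in> gap_set s c m n" "s = 1 \<or> s = -1"
  shows "admissible s m n"
proof -
  obtain N where N: "x \<in> Omega" "cf_q D x N = m" "cf_q D x (Suc N) = n"
    "gap_ratio x (cf_p D x N) m (cf_p D x (Suc N)) n \<in> gap_range s c"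
    using assms(1) by (auto simp: gap_set_def)
  have "cf_e D x (Suc N) = s" using gap_set_sign[OF N(1) assms(2), of N c] N by blast
  then show ?thesis
    using cf_q_window[OF N(1), of N] cf_q_pair_ok[OF N(1), of N] N(2,3) by (simp add: admissible_def)
qed

text \<open>The index N and, by \<open>cf_pair_unique\<close>, the numerators P and P' are common to
  all x in the set, while the tail t takes every value in \<open>Omega\<close> up to c. Thus x = (P'
  + s t P) / (n + s t m), a Moebius map of determinant 1 or -1. It starts at P' / n for t = 0 and
  has moved by t / (n (n + s t m)), which increases with t; \<delta> records the direction.
  Irrational x and irrational t correspond to each other.\<close>

lemma gap_set_interval:
  assumes adm: "admissible s m n" and s: "s = 1 \<or> s = -1" and c: "0 < c" "c \<le> 1"
  obtains \<delta> b where "\<delta> = 1 \<or> \<delta> = -1" "b \<in> \<rat>"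
    "gap_set s c m n = {x. x \<notin> \<rat> \<and> 0 \<le> \<delta> * (x - b) \<and> \<delta> * (x - b) \<le> c / (of_int n * (of_int n + of_int s * c * of_int m))}"
proof -
  have mn: "m > 0" "n > 0" "pair_ok m n"
    and w: "- \<kappa> * of_int n < of_int (s * m)" "of_int (s * m) < (2 - \<kappa>) * of_int n"
    using adm by (auto simp: admissible_def)
  obtain N where N: "\<And>t. t \<in> Omega \<Longrightarrow> \<exists>x\<in>Omega. cf_q D x N = m \<and> cf_q D x (Suc N) = n \<and>
      cf_e D x (Suc N) = s \<and> (T_map D ^^ Suc N) x = t"
    using cf_pair_exists[OF mn s w] by blast
  obtain t0 where "t0 \<in> Omega" using Omega_nonempty by blast
  from N[OF this] obtain x0 where x0: "x0 \<in> Omega" "cf_q D x0 N = m" "cf_q D x0 (Suc N) = n" by blast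
  define P P' where P: "P = cf_p D x0 N" "P' = cf_p D x0 (Suc N)"
  define M K where MK: "M = real_of_int m" "K = real_of_int n"
  define S where "S = real_of_int s"
  define \<Delta> where "\<Delta> = real_of_int (P * n - P' * m)"
  have Dl: "\<Delta> = 1 \<or> \<Delta> = -1"
  proof -
    have "\<bar>P * n - P' * m\<bar> = 1" using cf_det[of x0 N] unfolding x0(2,3) P .
    then have "P * n - P' * m = 1 \<or> P * n - P' * m = -1" by linarith
    then show ?thesis unfolding \<Delta>_def by fastforce
  qed
  have S: "S = 1 \<or> S = -1" using s by (auto simp: S_def)
  have MK0: "M > 0" "K > 0" using mn by (auto simp: MK)
  have SM: "S * M > - K"
  proof -
    have "\<kappa> * K \<le> 1 * K" using kappa_le MK0 by (intro mult_right_mono) auto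
    then show ?thesis using w(1) by (simp add: MK S_def)
  qed
  have pos: "K + S * t * M > 0" if "0 \<le> t" "t \<le> 1" for t
  proof -
    have "t * (K + S * M) + (1 - t) * K > 0"
    proof (cases "t = 0")
      case False
      then have "t * (K + S * M) > 0" using that SM by (intro mult_pos_pos) auto
      moreover have "(1 - t) * K \<ge> 0" using that MK0 by simp
      ultimately show ?thesis by linarith
    qed (use MK0 in auto)
    then show ?thesis by (simp add: algebra_simps)
  qed
  have key: "S * \<Delta> * (x - of_int P' / K) = t / (K * (K + S * t * M))"
    if "x * (K + S * t * M) = of_int P' + S * t * of_int P" "0 \<le> t" "t \<le> 1" for x t
  proof -
    have x: "x = (of_int P' + S * t * of_int P) / (K + S * t * M)"
      using that(1) pos[OF that(2,3)] by (simp add: field_simps)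
    have "S * \<Delta> * (x - of_int P' / K) = S * \<Delta> * (S * t * \<Delta>) / (K * (K + S * t * M))"
      unfolding x using MK0 pos[OF that(2,3)] by (simp add: field_simps \<Delta>_def MK)
    also have "S * \<Delta> * (S * t * \<Delta>) = t" using S Dl by auto
    finally show ?thesis .
  qed
  have eq: "gap_set s c m n = {x. x \<notin> \<rat> \<and> 0 \<le> S * \<Delta> * (x - of_int P' / K) \<and> S * \<Delta> * (x - of_int P' / K) \<le> c / (K * (K + S * c * M))}"
    (is "_ = ?I")
  proof (intro equalityI subsetI)
    fix x assume "x \<in> gap_set s c m n"
    then obtain N' where x: "x \<in> Omega" "cf_q D x N' = m" "cf_q D x (Suc N') = n"
      "gap_ratio x (cf_p D x N') m (cf_p D x (Suc N')) n \<in> gap_range s c"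
      by (auto simp: gap_set_def)
    have u: "N' = N" "cf_p D x N' = P" "cf_p D x (Suc N') = P'"
      using cf_pair_unique[OF x(1) x0(1), of N' N] x x0 unfolding P by auto
    define t where "t = (T_map D ^^ Suc N') x"
    have e: "cf_e D x (Suc N') = s" using gap_set_sign[OF x(1) s, of N' c] x by blast
    have t: "0 < t" "t < 1" using orbit_Omega[OF x(1), of "Suc N'"] by (auto simp only: t_def Omega_iff)
    have tc: "t \<le> c"
      using x(4) gap_ratio_orbit[OF x(1), of N'] s x(2,3) unfolding e gap_range_def t_def by auto
    have "x * (K + S * t * M) = of_int P' + S * t * of_int P"
      using cf_value[OF x(1), of N'] unfolding e x(2,3) u(2,3) t_def[symmetric] by (simp add: MK S_def)
    note k = key[OF this less_imp_le[OF t(1)] less_imp_le[OF t(2)]]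
    have "t * (K + S * c * M) \<le> c * (K + S * t * M)"
      using tc MK0 by (simp add: algebra_simps)
    then have cr: "K * (t * (K + S * c * M)) \<le> K * (c * (K + S * t * M))"
      using MK0 by (intro mult_left_mono) auto
    have pp: "K * (K + S * t * M) > 0" "K * (K + S * c * M) > 0"
      using MK0 pos[of t] pos[of c] t c by (intro mult_pos_pos; simp)+
    have "t / (K * (K + S * t * M)) \<le> c / (K * (K + S * c * M))"
      by (rule divide_le_divide_cross[OF pp]) (use cr in \<open>simp only: mult.left_commute\<close>)
    moreover have "t / (K * (K + S * t * M)) \<ge> 0"
      by (rule divide_nonneg_pos[OF less_imp_le[OF t(1)] pp(1)])
    moreover have "x \<notin> \<rat>" using x(1) Omega_iff by blast
    ultimately show "x \<in> ?I" unfolding mem_Collect_eq k by blast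
  next
    fix x assume "x \<in> ?I"
    then have xr: "x \<notin> \<rat>" and wb: "0 \<le> S * \<Delta> * (x - of_int P' / K)" "S * \<Delta> * (x - of_int P' / K) \<le> c / (K * (K + S * c * M))" by auto
    define v where "v = S * \<Delta> * (x - of_int P' / K)"
    have SD: "S * \<Delta> = 1 \<or> S * \<Delta> = -1" using S Dl by auto
    have Kr: "K \<in> \<rat>" "S \<in> \<rat>" "M \<in> \<rat>" "S * \<Delta> \<in> \<rat>" by (auto simp: MK S_def \<Delta>_def)
    have xv: "x = S * \<Delta> * v + of_int P' / K" using SD by (auto simp: v_def)
    have v: "0 \<le> v" "v * (K * (K + S * c * M)) \<le> c"
      using wb pos[of c] MK0 c unfolding v_def[symmetric] by (simp_all add: pos_le_divide_eq)
    \<comment> \<open>Solving v = t / (K (K + S t M)) for t yields K^2 v / (1 - S M K v), so this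
      denominator must be positive before t can be defined.\<close>
    have d: "1 - S * M * K * v > 0"
    proof (cases "S = 1")
      case True
      then have "v * K * (K + c * M) \<le> c" using v by (simp add: algebra_simps)
      moreover have "v * K * (c * M) * 1 \<le> c * (v * (K * M))" by (simp add: algebra_simps)
      moreover have "v * K * K \<ge> 0" using v MK0 by simp
      ultimately have le: "c * (v * (K * M)) \<le> c * 1" by (simp add: algebra_simps)
      then have le1: "v * (K * M) \<le> 1" using c by simp
      have "v * (K * M) \<noteq> 1"
      proof
        assume v1: "v * (K * M) = 1"
        then have "v > 0" using v by (cases "v = 0") auto
        then have "v * K * K > 0" using MK0 by simp
        moreover have "v * K * (K + c * M) = v * K * K + c * (v * (K * M))" by (simp add: algebra_simps)
        ultimately show False using \<open>v * K * (K + c * M) \<le> c\<close> v1 by simp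
      qed
      with le1 True show ?thesis by (simp add: algebra_simps)
    next
      case False
      then have "S = -1" using S by simp
      moreover have "M * K * v \<ge> 0" using MK0 v by simp
      ultimately show ?thesis by simp
    qed
    define t where "t = K * K * v / (1 - S * M * K * v)"
    have t0: "t \<ge> 0" using d v MK0 by (simp add: t_def)
    have "K * K * v \<le> c * (1 - S * M * K * v)" using v(2) by (simp add: algebra_simps)
    then have tc: "t \<le> c" using d by (simp add: t_def pos_divide_le_eq)
    have tv: "v = t / (K * (K + S * t * M))"
    proof -
      have "t * (1 - S * M * K * v) = K * K * v" using d by (simp add: t_def)
      then have "v * (K * (K + S * t * M)) = t" by (simp add: algebra_simps)
      moreover have "K * (K + S * t * M) \<noteq> 0" using pos[of t] t0 tc c MK0 by simp
      ultimately show ?thesis by (metis nonzero_mult_div_cancel_right)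
    qed
    have tr: "t \<notin> \<rat>"
    proof
      assume "t \<in> \<rat>"
      then have "v \<in> \<rat>" unfolding tv by (intro Rats_divide Rats_mult Rats_add Kr(1,2,3))
      then have "x \<in> \<rat>" unfolding xv
        by (intro Rats_add Rats_mult[OF Kr(4)] Rats_divide[OF Rats_of_int Kr(1)])
      with xr show False by simp
    qed
    then have "t \<noteq> 0" "t \<noteq> 1" by (metis Rats_0, metis Rats_1)
    then have tO: "t \<in> Omega" using t0 tc c tr unfolding Omega_iff by linarith
    obtain y where y: "y \<in> Omega" "cf_q D y N = m" "cf_q D y (Suc N) = n"
      "cf_e D y (Suc N) = s" "(T_map D ^^ Suc N) y = t" using N[OF tO] by blast
    have u: "cf_p D y N = P" "cf_p D y (Suc N) = P'"
      using cf_pair_unique[OF y(1) x0(1), of N N] y x0 unfolding P by auto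
    have "y * (K + S * t * M) = of_int P' + S * t * of_int P"
      using cf_value[OF y(1), of N] unfolding y u by (simp add: MK S_def)
    from key[OF this t0] tc c have "S * \<Delta> * (y - of_int P' / K) = v" using tv by simp
    then have "y = x" using SD unfolding v_def by auto
    moreover have "y \<in> gap_set s c m n"
    proof -
      have "gap_ratio y (cf_p D y N) m (cf_p D y (Suc N)) n = of_int s * t"
        using gap_ratio_orbit[OF y(1), of N] unfolding y(2-5) .
      moreover have "of_int s * t \<in> gap_range s c" using s t0 tc by (auto simp: gap_range_def)
      ultimately have "gap_ratio y (cf_p D y N) m (cf_p D y (Suc N)) n \<in> gap_range s c" by metis
      then show ?thesis using y(1-3) unfolding gap_set_def by blast
    qed
    ultimately show "x \<in> gap_set s c m n" by simp
  qed
  show ?thesis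
  proof (rule that)
    show "S * \<Delta> = 1 \<or> S * \<Delta> = -1" using S Dl by auto
    show "of_int P' / K \<in> \<rat>" by (auto simp: MK)
  qed (use eq in \<open>simp add: MK S_def\<close>)
qed

end

context parity_cf
begin

lemma gap_set_measure:
  assumes s: "s = 1 \<or> s = -1" and c: "0 < c" "c \<le> 1"
  shows "gap_set s c m n \<in> lmeasurable"
    and "measure lebesgue (gap_set s c m n) =
      (if admissible s m n then c / (of_int n * (of_int n + of_int s * c * of_int m)) else 0)"
proof -
  have "gap_set s c m n \<in> lmeasurable \<and> measure lebesgue (gap_set s c m n) =
      (if admissible s m n then c / (of_int n * (of_int n + of_int s * c * of_int m)) else 0)"
  proof (cases "admissible s m n")
    case False
    then have "x \<notin> gap_set s c m n" for x using gap_set_admissible[of x s c m n, OF _ s] by (rule contrapos_nn)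
    then have "gap_set s c m n = {}" by (metis equals0I)
    moreover have "({} :: real set) \<in> lmeasurable" by simp
    ultimately show ?thesis using False by (simp only: if_False measure_empty simp_thms)
  next
    case True
    define L where "L = c / (of_int n * (of_int n + of_int s * c * real_of_int m))"
    obtain \<delta> b where d: "\<delta> = 1 \<or> \<delta> = -1"
      "gap_set s c m n = {x. x \<notin> \<rat> \<and> 0 \<le> \<delta> * (x - b) \<and> \<delta> * (x - b) \<le> L}"
      unfolding L_def by (rule gap_set_interval[OF True s c])
    have Lpos: "L \<ge> 0"
    proof -
      have "n > 0" "- \<kappa> * of_int n < of_int (s * m)" "m > 0" using True by (auto simp: admissible_def)
      have "\<kappa> * of_int n \<le> 1 * real_of_int n" using kappa_le \<open>n > 0\<close> by (intro mult_right_mono) auto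
      then have "of_int s * of_int m > - real_of_int n" using \<open>- \<kappa> * of_int n < of_int (s * m)\<close> by simp
      have "of_int s * c * real_of_int m \<ge> - of_int n"
      proof (cases "s = 1")
        case True
        have "0 \<le> c * real_of_int m" "0 < real_of_int n" using c \<open>m > 0\<close> \<open>n > 0\<close> by auto
        then show ?thesis using True by simp
      next
        case False
        then have "s = -1" using s by simp
        have "c * real_of_int m \<le> 1 * real_of_int m" using c \<open>m > 0\<close> by (intro mult_right_mono) auto
        then show ?thesis using \<open>of_int s * of_int m > - real_of_int n\<close> \<open>s = -1\<close> by simp
      qed
      then have "of_int n + of_int s * c * real_of_int m \<ge> 0" by linarith
      moreover have "real_of_int n \<ge> 0" "c \<ge> 0" using \<open>n > 0\<close> c by simp_all
      ultimately show ?thesis unfolding L_def by (intro divide_nonneg_nonneg mult_nonneg_nonneg)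
    qed
    define I where "I = (if \<delta> = 1 then {b..b + L} else {b - L..b})"
    have "gap_set s c m n = I - \<rat>" unfolding d(2) I_def using d(1) by (cases "\<delta> = 1") auto
    moreover have "measure lebesgue I = L" "I \<in> lmeasurable" using Lpos unfolding I_def by (cases "\<delta> = 1"; simp)+
    moreover have "I - \<rat> \<in> lmeasurable"
      using \<open>I \<in> lmeasurable\<close> Rats_null_lebesgue by (intro fmeasurable_Diff) (auto simp: null_sets_def)
    moreover have "measure lebesgue (I - \<rat>) = measure lebesgue I"
      using \<open>I \<in> lmeasurable\<close> by (intro measure_Diff_null_set[OF _ Rats_null_lebesgue]) (auto simp: fmeasurable_def)
    ultimately show ?thesis using True by (metis L_def)
  qed
  then show "gap_set s c m n \<in> lmeasurable" "measure lebesgue (gap_set s c m n) =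
      (if admissible s m n then c / (of_int n * (of_int n + of_int s * c * of_int m)) else 0)" by auto
qed

end

section \<open>Lattice sums over coprime pairs\<close>

definition moebius :: "nat \<Rightarrow> real" where
  "moebius n = (if squarefree n then (-1) ^ card (prime_factors n) else 0)"

lemma abs_moebius_le: "\<bar>moebius n\<bar> \<le> 1"
  by (simp add: moebius_def)

lemma moebius_1 [simp]: "moebius (Suc 0) = 1"
  by (simp add: moebius_def)

lemma squarefree_prime_mult_iff:
  fixes p d :: nat
  assumes "prime p"
  shows "squarefree (p * d) \<longleftrightarrow> squarefree d \<and> \<not> p dvd d"
proof
  assume sf: "squarefree (p * d)"
  have "\<not> p dvd d"
  proof
    assume "p dvd d"
    then have "p ^ 2 dvd p * d" by (simp add: power2_eq_square)
    then have "p dvd 1" using squarefreeD[OF sf] by blast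
    with assms show False by auto
  qed
  moreover have "squarefree d" using squarefree_mono[OF _ sf] by simp
  ultimately show "squarefree d \<and> \<not> p dvd d" by simp
next
  assume "squarefree d \<and> \<not> p dvd d"
  then show "squarefree (p * d)"
    using assms by (intro squarefree_mult_coprime) (auto intro: prime_imp_coprime squarefree_prime)
qed

lemma moebius_prime_mult:
  assumes "prime p" "\<not> p dvd d"
  shows "moebius (p * d) = - moebius d"
proof (cases "squarefree d")
  case True
  have d0: "d \<noteq> 0" using assms by (metis dvd_0_right)
  have "prime_factors (p * d) = insert p (prime_factors d)"
    using assms(1) d0 by (subst prime_factors_product) (auto simp: prime_prime_factors prime_gt_0_nat)
  moreover have "p \<notin> prime_factors d" using assms(2) by auto
  ultimately show ?thesis using True assms squarefree_prime_mult_iff[OF assms(1), of d]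
    by (simp add: moebius_def)
next
  case False
  then show ?thesis using squarefree_prime_mult_iff[OF assms(1), of d] by (simp add: moebius_def)
qed

text \<open>For \<open>n > 1\<close> the divisors \<open>d\<close> and \<open>p d\<close> cancel, for a fixed prime \<open>p\<close> dividing \<open>n\<close>.\<close>

lemma sum_moebius_divisors:
  assumes "n > 0"
  shows "(\<Sum>d | d dvd n. moebius d) = (if n = 1 then 1 else 0)"
proof (cases "n = 1")
  case False
  then obtain p where p: "prime p" "p dvd n" using prime_factor_nat by blast
  define B where "B = {d. d dvd n \<and> \<not> p dvd d \<and> squarefree d}"
  define C where "C = {d. d dvd n \<and> p dvd d \<and> squarefree d}"
  have fin: "finite {d. d dvd n}" using assms by simp
  then have fBC: "finite B" "finite C" by (auto simp: B_def C_def)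
  have C: "C = (*) p ` B"
  proof (intro equalityI subsetI)
    fix c assume c: "c \<in> C"
    then obtain d where d: "c = p * d" by (auto simp: C_def)
    have "d dvd n" using c d by (auto simp: C_def dest: dvd_mult_right)
    moreover have "squarefree d \<and> \<not> p dvd d"
      using c d squarefree_prime_mult_iff[OF p(1), of d] by (simp add: C_def)
    ultimately have "d \<in> B" by (simp add: B_def)
    with d show "c \<in> (*) p ` B" by (intro image_eqI)
  next
    fix c assume "c \<in> (*) p ` B"
    then obtain d where d: "c = p * d" "d \<in> B" by auto
    have "coprime p d" using p(1) d(2) by (auto simp: B_def intro: prime_imp_coprime)
    then have "p * d dvd n" using p(2) d(2) by (intro divides_mult) (auto simp: B_def)
    then show "c \<in> C" using d squarefree_prime_mult_iff[OF p(1), of d] by (auto simp: B_def C_def)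
  qed
  have "(\<Sum>d | d dvd n. moebius d) = (\<Sum>d\<in>B \<union> C. moebius d)"
    using fin by (intro sum.mono_neutral_right) (auto simp: B_def C_def moebius_def)
  also have "\<dots> = (\<Sum>d\<in>B. moebius d) + (\<Sum>d\<in>C. moebius d)"
    using fBC by (intro sum.union_disjoint) (auto simp: B_def C_def)
  also have "(\<Sum>d\<in>C. moebius d) = (\<Sum>d\<in>B. moebius (p * d))"
    unfolding C using p(1) by (subst sum.reindex) (auto simp: inj_on_def prime_gt_0_nat)
  also have "\<dots> = (\<Sum>d\<in>B. - moebius d)"
    by (intro sum.cong refl moebius_prime_mult[OF p(1)]) (auto simp: B_def)
  finally show ?thesis using False by (simp add: sum_negf)
qed auto

lemma le_nat_floor_iff: "k \<ge> 1 \<Longrightarrow> k \<le> nat \<lfloor>R\<rfloor> \<longleftrightarrow> real k \<le> R"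
proof -
  assume "k \<ge> 1"
  then have "k \<le> nat \<lfloor>R\<rfloor> \<longleftrightarrow> int k \<le> \<lfloor>R\<rfloor>" by linarith
  also have "\<dots> \<longleftrightarrow> real k \<le> R" by (simp add: le_floor_iff)
  finally show ?thesis .
qed

lemma infsum_finite_sum:
  fixes f :: "'i \<Rightarrow> 'a \<Rightarrow> real"
  assumes "finite I" "\<And>i. i \<in> I \<Longrightarrow> f i summable_on A"
  shows "(\<Sum>\<^sub>\<infinity>x\<in>A. \<Sum>i\<in>I. f i x) = (\<Sum>i\<in>I. infsum (f i) A)"
    and "(\<lambda>x. \<Sum>i\<in>I. f i x) summable_on A"
proof -
  have "(\<Sum>\<^sub>\<infinity>x\<in>A. \<Sum>i\<in>I. f i x) = (\<Sum>i\<in>I. infsum (f i) A) \<and> (\<lambda>x. \<Sum>i\<in>I. f i x) summable_on A"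
    using assms by (induction I rule: finite_induct) (simp_all add: infsum_add summable_on_add)
  then show "(\<Sum>\<^sub>\<infinity>x\<in>A. \<Sum>i\<in>I. f i x) = (\<Sum>i\<in>I. infsum (f i) A)"
    "(\<lambda>x. \<Sum>i\<in>I. f i x) summable_on A" by auto
qed

text \<open>The cutoff \<open>m \<le> R\<close> loses nothing: all regions below satisfy \<open>m \<le> x1 R\<close> with \<open>x1 \<le> 1\<close>.\<close>

definition lat_sum :: "(real \<Rightarrow> nat \<Rightarrow> nat \<Rightarrow> bool) \<Rightarrow> (nat \<Rightarrow> nat \<Rightarrow> real) \<Rightarrow> real \<Rightarrow> real" where
  "lat_sum A f R = (\<Sum>m\<in>{1..nat \<lfloor>R\<rfloor>}. \<Sum>\<^sub>\<infinity>n\<in>{n. n \<ge> 1 \<and> A R m n}. f m n)"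

text \<open>The sum of \<open>moebius d\<close> over the common divisors d of m and n detects
  coprimality; after exchanging sums, the points divisible by d are rescaled to the region for R /
  d. The set \<Delta> holds the dilations that respect a congruence condition: if m and n must have
  opposite parity, only odd d survive. The cutoff m \<le> R keeps the sum over d finite.\<close>

lemma lat_sum_coprime:
  fixes A :: "real \<Rightarrow> nat \<Rightarrow> nat \<Rightarrow> bool" and f :: "nat \<Rightarrow> nat \<Rightarrow> real"
  assumes hom: "\<And>d m n. d \<ge> 1 \<Longrightarrow> m \<ge> 1 \<Longrightarrow> n \<ge> 1 \<Longrightarrow> A R (d * m) (d * n) \<longleftrightarrow> d \<in> \<Delta> \<and> A (R / d) m n"
    and hom_f: "\<And>d m n. d \<ge> 1 \<Longrightarrow> m \<ge> 1 \<Longrightarrow> n \<ge> 1 \<Longrightarrow> f (d * m) (d * n) = f m n / (real d)\<^sup>2"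
    and summ: "\<And>m. m \<ge> 1 \<Longrightarrow> f m summable_on {n. n \<ge> 1 \<and> A R m n}"
  shows "lat_sum (\<lambda>R m n. A R m n \<and> coprime m n) f R
    = (\<Sum>d\<in>{1..nat \<lfloor>R\<rfloor>} \<inter> \<Delta>. moebius d / (real d)\<^sup>2 * lat_sum A f (R / d))"
proof -
  define M where "M = nat \<lfloor>R\<rfloor>"
  define S where "S m = {n. n \<ge> 1 \<and> A R m n}" for m
  have cop: "(\<Sum>d\<in>{1..M}. if d dvd m \<and> d dvd n then moebius d * f m n else 0)
      = (if coprime m n then f m n else 0)" if m: "m \<in> {1..M}" and n: "n \<ge> 1" for m n
  proof -
    have "(\<Sum>d\<in>{1..M}. if d dvd m \<and> d dvd n then moebius d * f m n else 0)
      = (\<Sum>d\<in>{1..M} \<inter> {d. d dvd gcd m n}. moebius d * f m n)"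
      by (subst sum.inter_restrict) (auto intro!: sum.cong)
    also have "{1..M} \<inter> {d. d dvd gcd m n} = {d. d dvd gcd m n}"
    proof -
      have "1 \<le> d \<and> d \<le> M" if "d dvd m" for d
        using that m dvd_imp_le[OF that] by (cases "d = 0") auto
      then show ?thesis by auto
    qed
    also have "(\<Sum>d | d dvd gcd m n. moebius d * f m n) = (if gcd m n = 1 then 1 else 0) * f m n"
      using m by (subst sum_moebius_divisors[symmetric]) (auto simp: sum_distrib_right)
    finally show ?thesis by (auto simp: coprime_iff_gcd_eq_1)
  qed
  have smd: "(\<lambda>n. if d dvd m \<and> d dvd n then moebius d * f m n else 0) summable_on S m" if "m \<ge> 1" for d m
  proof -
    have "(\<lambda>n. moebius d * f m n) summable_on S m"
      using summ[OF that] by (auto simp: S_def intro: summable_on_cmult_right)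
    then have "(\<lambda>n. moebius d * f m n) summable_on {n \<in> S m. d dvd m \<and> d dvd n}"
      by (rule summable_on_subset_banach) auto
    then show ?thesis by (rule summable_on_cong_neutral[THEN iffD1, rotated -1]) auto
  qed
  have "lat_sum (\<lambda>R m n. A R m n \<and> coprime m n) f R
      = (\<Sum>m\<in>{1..M}. \<Sum>\<^sub>\<infinity>n\<in>S m. \<Sum>d\<in>{1..M}. if d dvd m \<and> d dvd n then moebius d * f m n else 0)"
    unfolding lat_sum_def M_def[symmetric]
  proof (intro sum.cong refl)
    fix m assume m: "m \<in> {1..M}"
    have "(\<Sum>\<^sub>\<infinity>n\<in>S m. \<Sum>d\<in>{1..M}. if d dvd m \<and> d dvd n then moebius d * f m n else 0)
      = (\<Sum>\<^sub>\<infinity>n\<in>S m. if coprime m n then f m n else 0)"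
      using cop[OF m] by (intro infsum_cong) (auto simp: S_def)
    also have "\<dots> = (\<Sum>\<^sub>\<infinity>n\<in>{n. n \<ge> 1 \<and> A R m n \<and> coprime m n}. f m n)"
      by (intro infsum_cong_neutral) (auto simp: S_def)
    finally show "(\<Sum>\<^sub>\<infinity>n\<in>{n. n \<ge> 1 \<and> A R m n \<and> coprime m n}. f m n) =
      (\<Sum>\<^sub>\<infinity>n\<in>S m. \<Sum>d\<in>{1..M}. if d dvd m \<and> d dvd n then moebius d * f m n else 0)" ..
  qed
  also have "\<dots> = (\<Sum>m\<in>{1..M}. \<Sum>d\<in>{1..M}. \<Sum>\<^sub>\<infinity>n\<in>S m. if d dvd m \<and> d dvd n then moebius d * f m n else 0)"
    using smd by (intro sum.cong refl infsum_finite_sum) auto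
  also have "\<dots> = (\<Sum>d\<in>{1..M}. \<Sum>m\<in>{1..M}. \<Sum>\<^sub>\<infinity>n\<in>S m. if d dvd m \<and> d dvd n then moebius d * f m n else 0)"
    by (rule sum.swap)
  also have "\<dots> = (\<Sum>d\<in>{1..M}. if d \<in> \<Delta> then moebius d / (real d)\<^sup>2 * lat_sum A f (R / d) else 0)"
  proof (intro sum.cong refl)
    fix d assume d: "d \<in> {1..M}"
    then have d1: "d \<ge> 1" by simp
    have img: "{m \<in> {1..M}. d dvd m} = (*) d ` {1..nat \<lfloor>R / d\<rfloor>}"
    proof -
      have "d * k \<le> M \<longleftrightarrow> k \<le> nat \<lfloor>R / d\<rfloor>" if "k \<ge> 1" for k
      proof -
        have "d * k \<le> M \<longleftrightarrow> real (d * k) \<le> R"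
          using that d1 unfolding M_def by (intro le_nat_floor_iff) simp
        also have "\<dots> \<longleftrightarrow> real k \<le> R / d" using d1 by (simp add: field_simps)
        also have "\<dots> \<longleftrightarrow> k \<le> nat \<lfloor>R / d\<rfloor>"
          using that by (intro le_nat_floor_iff[symmetric])
        finally show ?thesis .
      qed
      then show ?thesis using d1 by (auto simp: dvd_def image_iff Suc_le_eq)
    qed
    have "(\<Sum>m\<in>{1..M}. \<Sum>\<^sub>\<infinity>n\<in>S m. if d dvd m \<and> d dvd n then moebius d * f m n else 0)
      = (\<Sum>m\<in>{m \<in> {1..M}. d dvd m}. \<Sum>\<^sub>\<infinity>n\<in>S m. if d dvd m \<and> d dvd n then moebius d * f m n else 0)"
      by (intro sum.mono_neutral_right) (auto intro!: infsum_0)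
    also have "\<dots> = (\<Sum>m\<in>{1..nat \<lfloor>R / d\<rfloor>}. \<Sum>\<^sub>\<infinity>n\<in>S (d * m). if d dvd n then moebius d * f (d * m) n else 0)"
      unfolding img using d1 by (subst sum.reindex) (auto simp: inj_on_def)
    also have "\<dots> = (\<Sum>m\<in>{1..nat \<lfloor>R / d\<rfloor>}. if d \<in> \<Delta> then moebius d / (real d)\<^sup>2 *
        (\<Sum>\<^sub>\<infinity>n\<in>{n. n \<ge> 1 \<and> A (R / d) m n}. f m n) else 0)"
    proof (intro sum.cong refl)
      fix m assume m: "m \<in> {1..nat \<lfloor>R / d\<rfloor>}"
      have eqS: "{n \<in> S (d * m). d dvd n} = (*) d ` {n. n \<ge> 1 \<and> d \<in> \<Delta> \<and> A (R / d) m n}"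
        using d1 m hom[of d m] by (auto simp: S_def image_iff dvd_def Suc_le_eq)
      have "(\<Sum>\<^sub>\<infinity>n\<in>S (d * m). if d dvd n then moebius d * f (d * m) n else 0)
        = (\<Sum>\<^sub>\<infinity>n\<in>{n \<in> S (d * m). d dvd n}. moebius d * f (d * m) n)"
        by (intro infsum_cong_neutral) auto
      also have "\<dots> = (\<Sum>\<^sub>\<infinity>n\<in>{n. n \<ge> 1 \<and> d \<in> \<Delta> \<and> A (R / d) m n}. moebius d * f (d * m) (d * n))"
        unfolding eqS using d1 by (subst infsum_reindex) (auto simp: inj_on_def o_def)
      also have "\<dots> = (\<Sum>\<^sub>\<infinity>n\<in>{n. n \<ge> 1 \<and> d \<in> \<Delta> \<and> A (R / d) m n}. moebius d / (real d)\<^sup>2 * f m n)"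
        using d1 m hom_f[of d m] by (intro infsum_cong) auto
      also have "\<dots> = (if d \<in> \<Delta> then moebius d / (real d)\<^sup>2 * (\<Sum>\<^sub>\<infinity>n\<in>{n. n \<ge> 1 \<and> A (R / d) m n}. f m n) else 0)"
        by (cases "d \<in> \<Delta>") (simp_all only: simp_thms if_True if_False infsum_cmult_right' Collect_empty_eq infsum_empty empty_def[symmetric])
      finally show "(\<Sum>\<^sub>\<infinity>n\<in>S (d * m). if d dvd n then moebius d * f (d * m) n else 0) = \<dots>" .
    qed
    also have "\<dots> = (if d \<in> \<Delta> then moebius d / (real d)\<^sup>2 * lat_sum A f (R / d) else 0)"
      by (simp add: lat_sum_def sum_distrib_left)
    finally show "(\<Sum>m\<in>{1..M}. \<Sum>\<^sub>\<infinity>n\<in>S m. if d dvd m \<and> d dvd n then moebius d * f m n else 0) = \<dots>" .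
  qed
  also have "\<dots> = (\<Sum>d\<in>{1..M} \<inter> \<Delta>. moebius d / (real d)\<^sup>2 * lat_sum A f (R / d))"
    by (subst sum.inter_restrict) auto
  finally show ?thesis by (simp add: M_def)
qed

section \<open>Partial sums of harmonic and zeta type\<close>

lemma harmonic_le_ln:
  assumes "N \<ge> 1"
  shows "(\<Sum>d\<in>{1..N}. 1 / real d) \<le> 1 + ln (real N)"
  using assms
proof (induction N rule: dec_induct)
  case (step N)
  have "ln (real N / (real N + 1)) \<le> real N / (real N + 1) - 1"
    using step by (intro ln_le_minus_one) auto
  also have "\<dots> = - (1 / (real N + 1))" using step by (simp add: field_simps)
  finally have "1 / (real N + 1) \<le> ln (real N + 1) - ln (real N)"
    using step by (simp add: ln_div)
  then show ?case using step by (simp add: add.commute)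
qed auto

lemma harmonic_le_ln_real:
  assumes "R \<ge> 1"
  shows "(\<Sum>d\<in>{1..nat \<lfloor>R\<rfloor>}. 1 / real d) \<le> 1 + ln R"
proof -
  have N: "nat \<lfloor>R\<rfloor> \<ge> 1" using assms le_nat_floor_iff[of 1 R] by simp
  have "real (nat \<lfloor>R\<rfloor>) \<le> R" using assms by simp
  then have "ln (real (nat \<lfloor>R\<rfloor>)) \<le> ln R" using N by (subst ln_le_cancel_iff) auto
  with harmonic_le_ln[OF N] show ?thesis by linarith
qed

lemma inverse_squares_tail:
  assumes "N \<ge> 1"
  shows "(\<Sum>k\<in>{N<..K}. 1 / (real k)\<^sup>2) \<le> 1 / real N"
proof -
  have "(\<Sum>k\<in>{N<..K}. 1 / (real k)\<^sup>2) \<le> 1 / real N - 1 / real K" if "K \<ge> N"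
    using that
  proof (induction K rule: dec_induct)
    case (step K)
    have K: "real K > 0" using step assms by simp
    have "1 / (real (Suc K))\<^sup>2 \<le> 1 / (real K * real (Suc K))"
      using K by (intro divide_left_mono) (auto simp: power2_eq_square intro: mult_right_mono)
    also have "\<dots> = 1 / real K - 1 / real (Suc K)" using K by (simp add: field_simps)
    finally have *: "1 / (real (Suc K))\<^sup>2 \<le> 1 / real K - 1 / real (Suc K)" .
    have "{N<..Suc K} = insert (Suc K) {N<..K}" using step by auto
    then have "(\<Sum>k\<in>{N<..Suc K}. 1 / (real k)\<^sup>2) = 1 / (real (Suc K))\<^sup>2 + (\<Sum>k\<in>{N<..K}. 1 / (real k)\<^sup>2)"
      by simp
    with step.IH * show ?case by linarith
  qed auto
  moreover have "1 / real K \<ge> 0" by simp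
  ultimately have "K \<ge> N \<Longrightarrow> ?thesis" by linarith
  then show ?thesis by (cases "K \<ge> N") simp_all
qed

lemma zeta_partial_sum:
  fixes \<Delta> :: "nat set"
  assumes Z: "(\<lambda>n. if Suc n \<in> \<Delta> then 1 / (real (Suc n))\<^sup>2 else 0) sums Z" and R: "R \<ge> 1"
  shows "\<bar>(\<Sum>k\<in>{1..nat \<lfloor>R\<rfloor>}. if k \<in> \<Delta> then 1 / (real k)\<^sup>2 else 0) - Z\<bar> \<le> 2 / R"
proof -
  define N where "N = nat \<lfloor>R\<rfloor>"
  have N: "N \<ge> 1" using R le_nat_floor_iff[of 1 R] by (simp add: N_def)
  \<comment> \<open>Taking the floor loses at most a factor 2 because R \<ge> 1; this is the 2 in
    the bound.\<close>
  have NR: "real N \<ge> R / 2"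
  proof -
    have "R < real N + 1" unfolding N_def using R by linarith
    then show ?thesis using N by linarith
  qed
  define g where "g k = (if k \<in> \<Delta> then 1 / (real k)\<^sup>2 else 0)" for k
  have lim: "(\<lambda>K. \<Sum>k\<in>{1..K}. g k) \<longlonglongrightarrow> Z"
  proof -
    have "(\<lambda>K. \<Sum>n<K. g (Suc n)) \<longlonglongrightarrow> Z" using Z by (simp add: sums_def g_def)
    moreover have "(\<Sum>n<K. g (Suc n)) = (\<Sum>k\<in>{1..K}. g k)" for K
      by (rule sum.reindex_bij_witness[of _ "\<lambda>k. k - 1" Suc]) auto
    ultimately show ?thesis by simp
  qed
  have split: "(\<Sum>k\<in>{1..K}. g k) = (\<Sum>k\<in>{1..N}. g k) + (\<Sum>k\<in>{N<..K}. g k)" if "K \<ge> N" for K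
    using that N by (subst sum.union_disjoint[symmetric]) (auto intro!: sum.cong)
  have t: "0 \<le> (\<Sum>k\<in>{N<..K}. g k)" "(\<Sum>k\<in>{N<..K}. g k) \<le> 1 / real N" for K
  proof -
    show "0 \<le> (\<Sum>k\<in>{N<..K}. g k)" by (intro sum_nonneg) (auto simp: g_def)
    have "(\<Sum>k\<in>{N<..K}. g k) \<le> (\<Sum>k\<in>{N<..K}. 1 / (real k)\<^sup>2)" by (intro sum_mono) (auto simp: g_def)
    also note inverse_squares_tail[OF N]
    finally show "(\<Sum>k\<in>{N<..K}. g k) \<le> 1 / real N" .
  qed
  have "Z \<ge> (\<Sum>k\<in>{1..N}. g k)"
  proof (rule tendsto_lowerbound[OF lim])
    show "\<forall>\<^sub>F K in sequentially. (\<Sum>k\<in>{1..N}. g k) \<le> (\<Sum>k\<in>{1..K}. g k)"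
      using eventually_ge_at_top[of N]
    proof eventually_elim
      case (elim K)
      then show ?case using split[OF elim] t(1)[of K] by linarith
    qed
  qed simp
  moreover have "Z \<le> (\<Sum>k\<in>{1..N}. g k) + 1 / real N"
  proof (rule tendsto_upperbound[OF lim])
    show "\<forall>\<^sub>F K in sequentially. (\<Sum>k\<in>{1..K}. g k) \<le> (\<Sum>k\<in>{1..N}. g k) + 1 / real N"
      using eventually_ge_at_top[of N]
    proof eventually_elim
      case (elim K)
      then show ?case using split[OF elim] t(2)[of K] by linarith
    qed
  qed simp
  moreover have "1 / real N \<le> 2 / R" using NR N R by (simp add: field_simps)
  ultimately have "\<bar>(\<Sum>k\<in>{1..N}. g k) - Z\<bar> \<le> 2 / R" by linarith
  then show ?thesis by (simp add: g_def N_def)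
qed

text \<open>Evaluating \<open>lat_sum_coprime\<close> on the diagonal \<open>m = n\<close>, whose only coprime point is
  \<open>(1, 1)\<close>, gives the partial sums of \<open>\<mu>(d) / d\<^sup>2\<close> without any infinite product.\<close>

lemma sum_moebius_over_squares:
  fixes \<Delta> :: "nat set"
  assumes Z: "(\<lambda>n. if Suc n \<in> \<Delta> then 1 / (real (Suc n))\<^sup>2 else 0) sums Z"
    and one: "1 \<in> \<Delta>" and mult: "\<And>d m. d \<ge> 1 \<Longrightarrow> m \<ge> 1 \<Longrightarrow> d * m \<in> \<Delta> \<longleftrightarrow> d \<in> \<Delta> \<and> m \<in> \<Delta>"
    and R: "R \<ge> 1"
  shows "\<bar>(\<Sum>d\<in>{1..nat \<lfloor>R\<rfloor>} \<inter> \<Delta>. moebius d / (real d)\<^sup>2) * Z - 1\<bar> \<le> 2 * (1 + ln R) / R"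
proof -
  define N where "N = nat \<lfloor>R\<rfloor>"
  have N: "N \<ge> 1" using R le_nat_floor_iff[of 1 R] by (simp add: N_def)
  define Zp where "Zp R = (\<Sum>k\<in>{1..nat \<lfloor>R\<rfloor>}. if k \<in> \<Delta> then 1 / (real k)\<^sup>2 else 0)" for R :: real
  let ?A = "\<lambda>(R::real) m n. m = n \<and> m \<in> \<Delta>" and ?f = "\<lambda>m (n::nat). 1 / (real m)\<^sup>2"
  have dg: "{n. n \<ge> 1 \<and> m = n \<and> m \<in> \<Delta>} = (if m \<in> \<Delta> then {m} else {})" if "m \<ge> 1" for m
    using that by auto
  have ls: "lat_sum ?A ?f R' = Zp R'" for R'
    unfolding lat_sum_def Zp_def by (intro sum.cong refl) (subst dg, auto)
  have "lat_sum (\<lambda>R m n. ?A R m n \<and> coprime m n) ?f R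
    = (\<Sum>m\<in>{1..N}. if m = 1 then 1 else 0)"
    unfolding lat_sum_def N_def[symmetric]
  proof (intro sum.cong refl)
    fix m assume m: "m \<in> {1..N}"
    have "{n. n \<ge> 1 \<and> ?A R m n \<and> coprime m n} = (if m = 1 then {1} else {})"
      using m one by auto
    then show "(\<Sum>\<^sub>\<infinity>n\<in>{n. n \<ge> 1 \<and> ?A R m n \<and> coprime m n}. ?f m n) = (if m = 1 then 1 else 0)"
      by simp
  qed
  also have "\<dots> = 1" using N by (subst sum.delta) auto
  finally have "1 = (\<Sum>d\<in>{1..N} \<inter> \<Delta>. moebius d / (real d)\<^sup>2 * Zp (R / d))"
    unfolding N_def ls[symmetric]
    by (subst (asm) lat_sum_coprime[where \<Delta> = \<Delta>]) (use mult dg in \<open>auto simp: power_mult_distrib\<close>)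
  then have "(\<Sum>d\<in>{1..N} \<inter> \<Delta>. moebius d / (real d)\<^sup>2) * Z - 1
      = (\<Sum>d\<in>{1..N} \<inter> \<Delta>. moebius d / (real d)\<^sup>2 * (Z - Zp (R / d)))"
    by (simp add: sum_distrib_right sum_subtractf right_diff_distrib)
  also have "\<bar>\<dots>\<bar> \<le> (\<Sum>d\<in>{1..N} \<inter> \<Delta>. 2 / R * (1 / real d))"
  proof (rule sum_abs[THEN order_trans], intro sum_mono)
    fix d assume d: "d \<in> {1..N} \<inter> \<Delta>"
    then have d1: "d \<ge> 1" "real d \<le> R" using R le_nat_floor_iff[of d R] by (auto simp: N_def)
    then have "\<bar>Z - Zp (R / d)\<bar> \<le> 2 / (R / d)"
      using zeta_partial_sum[OF Z, of "R / d"] by (simp add: Zp_def abs_minus_commute)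
    moreover have "\<bar>moebius d / (real d)\<^sup>2\<bar> \<le> 1 / (real d)\<^sup>2"
      using abs_moebius_le[of d] by (simp add: abs_divide divide_right_mono)
    ultimately have "\<bar>moebius d / (real d)\<^sup>2\<bar> * \<bar>Z - Zp (R / d)\<bar> \<le> 1 / (real d)\<^sup>2 * (2 / (R / d))"
      by (intro mult_mono) auto
    also have "\<dots> = 2 / R * (1 / real d)" using d1 by (simp add: power2_eq_square)
    finally show "\<bar>moebius d / (real d)\<^sup>2 * (Z - Zp (R / d))\<bar> \<le> 2 / R * (1 / real d)" by (simp add: abs_mult)
  qed
  also have "\<dots> \<le> (\<Sum>d\<in>{1..N}. 2 / R * (1 / real d))"
    using R by (intro sum_mono2) auto
  also have "\<dots> = 2 / R * (\<Sum>d\<in>{1..N}. 1 / real d)" by (simp add: sum_distrib_left)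
  also have "\<dots> \<le> 2 / R * (1 + ln R)"
    using harmonic_le_ln_real[OF R] R unfolding N_def by (intro mult_left_mono) auto
  finally show ?thesis by (simp add: N_def)
qed

text \<open>\<open>Z\<close> is the sum of 1 / d^2 over \<Delta>, so
  \<open>sum_moebius_over_squares\<close> turns the Moebius sum into 1 / Z. With L = 1 + ln R, the
  dilation by d costs at most C L^2 / (R d), and summing 1 / d over d \<le> R supplies the third
  factor L. Truncating the Moebius sum accounts for the term with |I|.\<close>

lemma lat_sum_coprime_asymp:
  fixes A :: "real \<Rightarrow> nat \<Rightarrow> nat \<Rightarrow> bool" and f :: "nat \<Rightarrow> nat \<Rightarrow> real"
  assumes Z: "(\<lambda>n. if Suc n \<in> \<Delta> then 1 / (real (Suc n))\<^sup>2 else 0) sums Z"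
    and one: "1 \<in> \<Delta>" and mult: "\<And>d m. d \<ge> 1 \<Longrightarrow> m \<ge> 1 \<Longrightarrow> d * m \<in> \<Delta> \<longleftrightarrow> d \<in> \<Delta> \<and> m \<in> \<Delta>"
    and R: "R \<ge> 1"
    and hom: "\<And>d m n. d \<ge> 1 \<Longrightarrow> m \<ge> 1 \<Longrightarrow> n \<ge> 1 \<Longrightarrow> A R (d * m) (d * n) \<longleftrightarrow> d \<in> \<Delta> \<and> A (R / d) m n"
    and hom_f: "\<And>d m n. d \<ge> 1 \<Longrightarrow> m \<ge> 1 \<Longrightarrow> n \<ge> 1 \<Longrightarrow> f (d * m) (d * n) = f m n / (real d)\<^sup>2"
    and summ: "\<And>m. m \<ge> 1 \<Longrightarrow> f m summable_on {n. n \<ge> 1 \<and> A R m n}"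
    and asy: "\<And>R. R \<ge> 1 \<Longrightarrow> \<bar>lat_sum A f R - I\<bar> \<le> C * (1 + ln R)\<^sup>2 / R"
  shows "\<bar>lat_sum (\<lambda>R m n. A R m n \<and> coprime m n) f R - I / Z\<bar> \<le> (C + 2 * \<bar>I\<bar>) * (1 + ln R) ^ 3 / R"
proof -
  define N where "N = nat \<lfloor>R\<rfloor>"
  let ?X = "{1..N} \<inter> \<Delta>"
  define L where "L = 1 + ln R"
  have L: "L \<ge> 1" using R by (simp add: L_def)
  have C: "C \<ge> 0" using asy[of 1] by simp
  have Z1: "Z \<ge> 1"
  proof -
    have "(\<Sum>n<1. if Suc n \<in> \<Delta> then 1 / (real (Suc n))\<^sup>2 else 0) \<le> Z"
      using sum_le_suminf[OF sums_summable[OF Z], of "{..<1}"] sums_unique[OF Z] by simp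
    then show ?thesis using one by simp
  qed
  have eq: "lat_sum (\<lambda>R m n. A R m n \<and> coprime m n) f R
      = (\<Sum>d\<in>?X. moebius d / (real d)\<^sup>2 * lat_sum A f (R / d))"
    unfolding N_def by (rule lat_sum_coprime[OF hom hom_f summ])
  have "\<bar>(\<Sum>d\<in>?X. moebius d / (real d)\<^sup>2 * (lat_sum A f (R / d) - I))\<bar> \<le> (\<Sum>d\<in>?X. C * L\<^sup>2 / R * (1 / real d))"
  proof (rule sum_abs[THEN order_trans], intro sum_mono)
    fix d assume d: "d \<in> ?X"
    then have d1: "d \<ge> 1" "real d \<le> R" using R le_nat_floor_iff[of d R] by (auto simp: N_def)
    then have Rd: "R / d \<ge> 1" by simp
    have "R / d \<le> R" using d1 R by (simp add: field_simps)
    then have "1 + ln (R / d) \<le> L" "1 + ln (R / d) \<ge> 0" using Rd R unfolding L_def by auto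
    then have "(1 + ln (R / d))\<^sup>2 \<le> L\<^sup>2" by (intro power_mono)
    then have "C * (1 + ln (R / d))\<^sup>2 / (R / d) \<le> C * L\<^sup>2 / (R / d)"
      using C Rd by (intro divide_right_mono mult_left_mono) auto
    with asy[OF Rd] have "\<bar>lat_sum A f (R / d) - I\<bar> \<le> C * L\<^sup>2 / (R / d)" by linarith
    moreover have "\<bar>moebius d / (real d)\<^sup>2\<bar> \<le> 1 / (real d)\<^sup>2"
      using abs_moebius_le[of d] by (simp add: abs_divide divide_right_mono)
    ultimately have "\<bar>moebius d / (real d)\<^sup>2\<bar> * \<bar>lat_sum A f (R / d) - I\<bar> \<le> 1 / (real d)\<^sup>2 * (C * L\<^sup>2 / (R / d))"
      by (intro mult_mono) auto
    also have "\<dots> = C * L\<^sup>2 / R * (1 / real d)" using d1 by (simp add: power2_eq_square)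
    finally show "\<bar>moebius d / (real d)\<^sup>2 * (lat_sum A f (R / d) - I)\<bar> \<le> C * L\<^sup>2 / R * (1 / real d)" by (simp add: abs_mult)
  qed
  also have "\<dots> \<le> (\<Sum>d\<in>{1..N}. C * L\<^sup>2 / R * (1 / real d))"
    using R C by (intro sum_mono2) auto
  also have "\<dots> = C * L\<^sup>2 / R * (\<Sum>d\<in>{1..N}. 1 / real d)" by (simp add: sum_distrib_left)
  also have "\<dots> \<le> C * L\<^sup>2 / R * L"
    using harmonic_le_ln_real[OF R] R C unfolding N_def L_def by (intro mult_left_mono) auto
  also have "\<dots> = C * L ^ 3 / R" by (simp add: power2_eq_square power3_eq_cube)
  finally have 1: "\<bar>(\<Sum>d\<in>?X. moebius d / (real d)\<^sup>2 * (lat_sum A f (R / d) - I))\<bar> \<le> C * L ^ 3 / R" .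
  define W where "W = (\<Sum>d\<in>?X. moebius d / (real d)\<^sup>2)"
  have "\<bar>W * Z - 1\<bar> \<le> 2 * L / R"
    using sum_moebius_over_squares[OF Z one mult R] by (simp add: W_def N_def L_def)
  moreover have "\<bar>(W * Z - 1) / Z\<bar> \<le> \<bar>W * Z - 1\<bar>"
    using Z1 mult_left_mono[of 1 Z "\<bar>W * Z - 1\<bar>"] by (simp add: abs_divide divide_le_eq)
  ultimately have "\<bar>I * ((W * Z - 1) / Z)\<bar> \<le> \<bar>I\<bar> * (2 * L / R)"
    unfolding abs_mult[of I] by (intro mult_left_mono) auto
  also have "\<dots> \<le> \<bar>I\<bar> * (2 * L ^ 3 / R)"
    using R L by (intro mult_left_mono divide_right_mono) (auto simp: self_le_power)
  finally have 2: "\<bar>I * W - I / Z\<bar> \<le> 2 * \<bar>I\<bar> * L ^ 3 / R"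
    using Z1 by (simp add: field_simps)
  have "lat_sum (\<lambda>R m n. A R m n \<and> coprime m n) f R - I / Z
    = (\<Sum>d\<in>?X. moebius d / (real d)\<^sup>2 * (lat_sum A f (R / d) - I)) + (I * W - I / Z)"
    unfolding eq W_def by (simp add: right_diff_distrib diff_divide_distrib sum_subtractf sum_distrib_left mult.commute)
  with 1 2 show ?thesis unfolding L_def[symmetric] by (simp add: distrib_right add_divide_distrib)
qed

lemma mvt_bounds:
  fixes \<Psi> \<phi> :: "real \<Rightarrow> real"
  assumes "u < v" "\<And>x. u \<le> x \<Longrightarrow> x \<le> v \<Longrightarrow> (\<Psi> has_real_derivative - \<phi> x) (at x)"
    and "\<And>x. u \<le> x \<Longrightarrow> x \<le> v \<Longrightarrow> \<phi> v \<le> \<phi> x \<and> \<phi> x \<le> \<phi> u"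
  shows "(v - u) * \<phi> v \<le> \<Psi> u - \<Psi> v" "\<Psi> u - \<Psi> v \<le> (v - u) * \<phi> u"
proof -
  obtain z where z: "u < z" "z < v" "\<Psi> v - \<Psi> u = (v - u) * - \<phi> z"
    using MVT2[OF assms(1), of \<Psi> "\<lambda>x. - \<phi> x"] assms(2) by auto
  have "\<phi> v \<le> \<phi> z" "\<phi> z \<le> \<phi> u" using assms(3)[of z] z by auto
  then have "(v - u) * \<phi> v \<le> (v - u) * \<phi> z" "(v - u) * \<phi> z \<le> (v - u) * \<phi> u"
    using assms(1) by (auto intro!: mult_left_mono)
  then show "(v - u) * \<phi> v \<le> \<Psi> u - \<Psi> v" "\<Psi> u - \<Psi> v \<le> (v - u) * \<phi> u" using z(3) by auto
qed

section \<open>Summation of the weights over one variable\<close>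

text \<open>The set \<open>U\<close> is an integer ray starting at \<open>V\<close>, with the endpoint included or not.\<close>

lemma progression_tail:
  fixes \<Psi> \<phi> :: "real \<Rightarrow> real" and k r :: nat
  assumes V: "V \<ge> 0" and k: "k \<ge> 1"
    and der: "\<And>x. V \<le> x \<Longrightarrow> (\<Psi> has_real_derivative - \<phi> x) (at x)"
    and dec: "\<And>x y. V \<le> x \<Longrightarrow> x \<le> y \<Longrightarrow> \<phi> y \<le> \<phi> x"
    and nonneg: "\<And>x. V \<le> x \<Longrightarrow> 0 \<le> \<phi> x"
    and lim: "(\<Psi> \<longlongrightarrow> 0) at_top"
    and U: "\<And>n. n \<in> U \<Longrightarrow> V \<le> real n" "\<And>n. V < real n \<Longrightarrow> n \<in> U"
  defines "W \<equiv> {n \<in> U. n mod k = r mod k}"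
  shows "(\<lambda>n. \<phi> (real n)) summable_on W"
    and "\<bar>(\<Sum>\<^sub>\<infinity>n\<in>W. \<phi> (real n)) - \<Psi> V / k\<bar> \<le> \<phi> V"
proof -
  have kpos: "real k > 0" using k by simp
  have ex: "\<exists>n\<in>W. real n \<le> V + k"
  proof -
    define q where "q = nat (\<lfloor>V\<rfloor> + 1)"
    have q: "V < real q" "real q \<le> V + 1" using V unfolding q_def by linarith+
    obtain n where n: "q \<le> n" "n < q + k" "n mod k = r mod k"
    proof -
      \<comment> \<open>The distance from q to the next number congruent to r. Adding k q, which is
        at least q, keeps the subtraction of naturals from being truncated.\<close>
      define d where "d = (r + k * q - q) mod k"
      have d: "d < k" using k by (simp add: d_def)
      have "q \<le> k * q" using k by simp
      then have "(q + d) mod k = (q + (r + k * q - q)) mod k" unfolding d_def by (simp add: mod_add_right_eq)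
      also have "q + (r + k * q - q) = r + k * q" using \<open>q \<le> k * q\<close> by linarith
      finally show ?thesis using d that[of "q + d"] by simp
    qed
    have "n \<in> W" using U(2)[of n] q n by (auto simp: W_def)
    moreover have "real n \<le> V + k" using q n by linarith
    ultimately show ?thesis by blast
  qed
  define n0 where "n0 = (LEAST n. n \<in> W)"
  have n0W: "n0 \<in> W" using ex unfolding n0_def by (auto intro: LeastI)
  have n0V: "V \<le> real n0" using n0W U(1) by (auto simp: W_def)
  have n0k: "real n0 \<le> V + k"
  proof -
    obtain n where "n \<in> W" "real n \<le> V + k" using ex by blast
    moreover have "n0 \<le> n" unfolding n0_def using \<open>n \<in> W\<close> by (rule Least_le)
    ultimately show ?thesis by (meson of_nat_mono order_trans)
  qed
  define e where "e j = n0 + k * j" for j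
  have bij: "bij_betw e UNIV W"
  proof -
    have "inj e" using k by (auto simp: inj_def e_def)
    moreover have "range e = W"
    proof (intro equalityI subsetI)
      fix n assume "n \<in> range e"
      then obtain j where j: "n = n0 + k * j" by (auto simp: e_def)
      show "n \<in> W"
      proof (cases "j = 0")
        case False
        then have "k * j \<ge> 1" using k by simp
        then have "real n \<ge> real n0 + 1" using j by (metis add_left_mono of_nat_1 of_nat_add of_nat_le_iff)
        then have "n \<in> U" using U(2)[of n] n0V by simp
        then show ?thesis using j n0W by (simp add: W_def)
      qed (use j n0W in simp)
    next
      fix n assume n: "n \<in> W"
      then have "n0 \<le> n" unfolding n0_def by (rule Least_le)
      moreover have "n mod k = n0 mod k" using n n0W by (simp add: W_def)
      ultimately have "k dvd n - n0" by (simp add: mod_eq_dvd_iff_nat)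
      then obtain j where "n - n0 = k * j" by blast
      then have "n = e j" using \<open>n0 \<le> n\<close> by (simp add: e_def)
      then show "n \<in> range e" by simp
    qed
    ultimately show ?thesis by (simp add: bij_betw_def)
  qed
  have eV: "V \<le> real (e j)" for j using n0V by (simp add: e_def add_increasing2)
  have step: "k * \<phi> (e (Suc j)) \<le> \<Psi> (e j) - \<Psi> (e (Suc j))" "\<Psi> (e j) - \<Psi> (e (Suc j)) \<le> k * \<phi> (e j)" for j
  proof -
    have lt: "real (e j) < real (e (Suc j))" using k by (simp add: e_def)
    have d: "real (e (Suc j)) - real (e j) = k" by (simp add: e_def algebra_simps)
    have Vx: "V \<le> x" if "real (e j) \<le> x" for x using eV[of j] that by simp
    have A: "(\<Psi> has_real_derivative - \<phi> x) (at x)" if "real (e j) \<le> x" for x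
      by (rule der[OF Vx[OF that]])
    have B: "\<phi> (e (Suc j)) \<le> \<phi> x \<and> \<phi> x \<le> \<phi> (e j)" if "real (e j) \<le> x" "x \<le> real (e (Suc j))" for x
      using dec[OF Vx[OF that(1)] that(2)] dec[OF eV that(1)] by simp
    show "k * \<phi> (e (Suc j)) \<le> \<Psi> (e j) - \<Psi> (e (Suc j))" "\<Psi> (e j) - \<Psi> (e (Suc j)) \<le> k * \<phi> (e j)"
      using mvt_bounds[OF lt A B] unfolding d by blast+
  qed
  have \<Psi>_nonneg: "\<Psi> x \<ge> 0" if x: "V \<le> x" for x
  proof (rule tendsto_upperbound[OF lim])
    show "\<forall>\<^sub>F y in at_top. \<Psi> y \<le> \<Psi> x"
      using eventually_gt_at_top[of x]
    proof eventually_elim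
      case (elim y)
      have "(y - x) * \<phi> y \<le> \<Psi> x - \<Psi> y"
        by (rule mvt_bounds(1)[OF elim]) (use der dec x in \<open>auto intro: order_trans\<close>)
      moreover have "(y - x) * \<phi> y \<ge> 0" using elim nonneg[of y] x by simp
      ultimately show ?case by linarith
    qed
  qed simp
  have ends: "\<Psi> n0 \<le> \<Psi> V" "\<Psi> V - k * \<phi> V \<le> \<Psi> n0"
  proof -
    have "\<Psi> n0 \<le> \<Psi> V \<and> \<Psi> V - k * \<phi> V \<le> \<Psi> n0"
    proof (cases "real n0 = V")
      case True
      then show ?thesis using kpos nonneg[of V] by simp
    next
      case False
      then have lt: "V < real n0" using n0V by simp
      have *: "(n0 - V) * \<phi> n0 \<le> \<Psi> V - \<Psi> n0" "\<Psi> V - \<Psi> n0 \<le> (n0 - V) * \<phi> V"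
        using mvt_bounds[OF lt, of \<Psi> \<phi>] der dec by auto
      moreover have "(n0 - V) * \<phi> n0 \<ge> 0" using lt nonneg[of n0] by simp
      moreover have "(n0 - V) * \<phi> V \<le> k * \<phi> V" using n0k nonneg[of V] by (intro mult_right_mono) auto
      ultimately show ?thesis by linarith
    qed
    then show "\<Psi> n0 \<le> \<Psi> V" "\<Psi> V - k * \<phi> V \<le> \<Psi> n0" by auto
  qed
  have up: "k * (\<Sum>j<J. \<phi> (e j)) \<le> k * \<phi> V + \<Psi> V" for J
  proof -
    have "k * (\<Sum>j<Suc J. \<phi> (e j)) \<le> k * \<phi> n0 + (\<Psi> n0 - \<Psi> (e J))" for J
    proof (induction J)
      case (Suc J)
      then show ?case using step(1)[of J] by (simp add: algebra_simps)
    qed (simp add: e_def)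
    from this[of J] have "k * (\<Sum>j<Suc J. \<phi> (e j)) \<le> k * \<phi> V + \<Psi> V"
      using ends \<Psi>_nonneg[OF eV[of J]] mult_left_mono[OF dec[OF order_refl n0V] less_imp_le[OF kpos]] by linarith
    moreover have "k * \<phi> (e J) \<ge> 0" using nonneg[OF eV] kpos by simp
    ultimately show ?thesis by (simp add: algebra_simps)
  qed
  have low: "\<Psi> n0 - \<Psi> (e J) \<le> k * (\<Sum>j<J. \<phi> (e j))" for J
  proof (induction J)
    case (Suc J)
    then show ?case using step(2)[of J] by (simp add: algebra_simps)
  qed (simp add: e_def)
  have sm: "summable (\<lambda>j. \<phi> (e j))"
  proof (rule bounded_imp_summable)
    show "\<phi> (real (e j)) \<ge> 0" for j using nonneg[OF eV] .
    show "(\<Sum>j\<le>J. \<phi> (e j)) \<le> (k * \<phi> V + \<Psi> V) / k" for J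
      using up[of "Suc J"] kpos by (simp add: pos_le_divide_eq mult.commute lessThan_Suc_atMost)
  qed
  have hs: "((\<lambda>j. \<phi> (e j)) has_sum (\<Sum>j. \<phi> (e j))) UNIV"
    using sums_nonneg_imp_has_sum[OF summable_sums[OF sm]] nonneg[OF eV] by blast
  then have "((\<lambda>n. \<phi> (real n)) has_sum (\<Sum>j. \<phi> (e j))) W"
    using has_sum_reindex_bij_betw[OF bij, of "\<lambda>n. \<phi> (real n)"] by simp
  then have inf: "(\<Sum>\<^sub>\<infinity>n\<in>W. \<phi> (real n)) = (\<Sum>j. \<phi> (e j))" and "(\<lambda>n. \<phi> (real n)) summable_on W"
    by (auto simp: infsumI summable_on_def)
  then show "(\<lambda>n. \<phi> (real n)) summable_on W" by simp
  have lims: "(\<lambda>J. k * (\<Sum>j<J. \<phi> (e j))) \<longlonglongrightarrow> k * (\<Sum>j. \<phi> (e j))"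
    using summable_LIMSEQ[OF sm] by (intro tendsto_mult_left)
  have eJ: "(\<lambda>J. \<Psi> (real (e J))) \<longlonglongrightarrow> 0"
  proof (rule filterlim_compose[OF lim])
    show "filterlim (\<lambda>J. real (e J)) at_top sequentially"
    proof (rule filterlim_at_top_mono[OF filterlim_real_sequentially])
      have "J \<le> e J" for J using k by (simp add: e_def trans_le_add2)
      then show "\<forall>\<^sub>F J in sequentially. real J \<le> real (e J)" by simp
    qed
  qed
  have "k * (\<Sum>j. \<phi> (e j)) \<le> k * \<phi> V + \<Psi> V"
    by (rule tendsto_upperbound[OF lims]) (use up in auto)
  moreover have "\<Psi> n0 - 0 \<le> k * (\<Sum>j. \<phi> (e j))"
    by (rule tendsto_le[OF _ lims tendsto_diff[OF tendsto_const eJ]]) (use low in auto)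
  ultimately have "\<bar>k * (\<Sum>j. \<phi> (e j)) - \<Psi> V\<bar> \<le> k * \<phi> V" using ends by linarith
  then show "\<bar>(\<Sum>\<^sub>\<infinity>n\<in>W. \<phi> (real n)) - \<Psi> V / k\<bar> \<le> \<phi> V"
    unfolding inf using kpos by (simp add: abs_le_iff field_simps)
qed

definition wt :: "int \<Rightarrow> real \<Rightarrow> real \<Rightarrow> real \<Rightarrow> real" where
  "wt s c m v = c / (v * (v + of_int s * c * m))"

text \<open>The integral of \<open>wt s c m\<close> from v to infinity.\<close>

definition wt_tail :: "int \<Rightarrow> real \<Rightarrow> real \<Rightarrow> real \<Rightarrow> real" where
  "wt_tail s c m v = of_int s * ln (1 + of_int s * c * m / v) / m"

lemma wt_pos:
  fixes c m x :: real
  assumes s: "s = 1 \<or> s = -1" and c: "0 < c" "c \<le> 1" and m: "0 < m" and x: "m < x"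
  shows "x + of_int s * c * m > 0" "x > 0"
proof -
  have "c * m \<le> m" using c m by simp
  moreover have "0 < c * m" using c m by simp
  moreover have "of_int s * c * m = c * m \<or> of_int s * c * m = - (c * m)" using s by auto
  ultimately show "x + of_int s * c * m > 0" "x > 0" using x m by linarith+
qed

lemma wt_tail_has_derivative:
  fixes c m x :: real
  assumes s: "s = 1 \<or> s = -1" and c: "0 < c" "c \<le> 1" and m: "0 < m" and x: "m < x"
  shows "(wt_tail s c m has_real_derivative - wt s c m x) (at x)"
proof -
  note pos = wt_pos[OF assms]
  have "1 + of_int s * c * m / x > 0" using pos by (simp add: field_simps)
  then have "((\<lambda>v. of_int s * ln (1 + of_int s * c * m / v) / m) has_real_derivative
      of_int s * (inverse (1 + of_int s * c * m / x) * (- (of_int s * c * m) / (x * x))) / m) (at x)"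
    using pos m by (auto intro!: derivative_eq_intros simp: divide_inverse)
  moreover have "of_int s * (inverse (1 + of_int s * c * m / x) * (- (of_int s * c * m) / (x * x))) / m = - wt s c m x"
  proof -
    have "inverse (1 + of_int s * c * m / x) = x / (x + of_int s * c * m)" using pos by (simp add: field_simps)
    moreover have "of_int s * (of_int s * c * m) = c * m" using s by auto
    ultimately have "of_int s * (inverse (1 + of_int s * c * m / x) * (- (of_int s * c * m) / (x * x))) / m
      = - (x / (x + of_int s * c * m)) * (c * m) / (x * x) / m" by simp
    also have "\<dots> = - wt s c m x" using pos m unfolding wt_def by (simp add: divide_simps)
    finally show ?thesis .
  qed
  ultimately show ?thesis unfolding wt_tail_def by simp
qed

lemma wt_progression:
  fixes k r :: nat
  assumes s: "s = 1 \<or> s = -1" and c: "0 < c" "c \<le> 1" and m: "0 < m" and V: "m < V" and k: "k \<ge> 1"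
    and U: "\<And>n. n \<in> U \<Longrightarrow> V \<le> real n" "\<And>n. V < real n \<Longrightarrow> n \<in> U"
  shows "(\<lambda>n. wt s c m (real n)) summable_on {n \<in> U. n mod k = r mod k}"
    and "\<bar>(\<Sum>\<^sub>\<infinity>n\<in>{n \<in> U. n mod k = r mod k}. wt s c m (real n)) - wt_tail s c m V / k\<bar> \<le> wt s c m V"
proof -
  have pos: "x + of_int s * c * m > 0" "x > 0" if "V \<le> x" for x
    using wt_pos[OF s c m, of x] that V by auto
  have der: "(wt_tail s c m has_real_derivative - wt s c m x) (at x)" if x: "V \<le> x" for x
    using wt_tail_has_derivative[OF s c m, of x] x V by auto
  have dec: "wt s c m y \<le> wt s c m x" if "V \<le> x" "x \<le> y" for x y
    unfolding wt_def using pos[of x] pos[of y] that c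
    by (intro divide_left_mono mult_mono mult_pos_pos) auto
  have nonneg: "0 \<le> wt s c m x" if "V \<le> x" for x
    unfolding wt_def using pos[of x] that c by (intro divide_nonneg_nonneg mult_nonneg_nonneg) auto
  have lim: "(wt_tail s c m \<longlongrightarrow> 0) at_top"
  proof -
    have "((\<lambda>v. of_int s * c * m / v) \<longlongrightarrow> 0) at_top"
      by (intro tendsto_divide_0[OF tendsto_const] filterlim_at_top_imp_at_infinity filterlim_ident)
    then have "((\<lambda>v. of_int s * ln (1 + of_int s * c * m / v) / m) \<longlongrightarrow> of_int s * ln (1 + 0) / m) at_top"
      by (intro tendsto_intros) (use m in auto)
    then show ?thesis unfolding wt_tail_def[abs_def] by simp
  qed
  have "V \<ge> 0" using V m by simp
  from progression_tail[OF this k der dec nonneg lim U, of r]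
  show "(\<lambda>n. wt s c m (real n)) summable_on {n \<in> U. n mod k = r mod k}"
    "\<bar>(\<Sum>\<^sub>\<infinity>n\<in>{n \<in> U. n mod k = r mod k}. wt s c m (real n)) - wt_tail s c m V / k\<bar> \<le> wt s c m V"
    by auto
qed

text \<open>The case s = -1, c = 1 is extremal, since v + s c m \<ge> v - m in all cases; its weight
  1 / (v (v - m)) bounds every other one.\<close>

lemma wt_bounds:
  assumes s: "s = 1 \<or> s = -1" and c: "0 < c" "c \<le> 1" and m: "0 \<le> m" and v: "m < v"
  shows "0 \<le> wt s c m v" "wt s c m v \<le> 1 / (v * (v - m))"
proof -
  have p: "v + of_int s * c * m \<ge> v - m"
  proof -
    have "0 \<le> c * m" "c * m \<le> m" using c m mult_right_mono[of c 1 m] by simp_all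
    moreover have "of_int s * c * m = c * m \<or> of_int s * c * m = - (c * m)" using s by auto
    ultimately show ?thesis using m by linarith
  qed
  then show "0 \<le> wt s c m v" unfolding wt_def using c m v by (intro divide_nonneg_nonneg mult_nonneg_nonneg) auto
  show "wt s c m v \<le> 1 / (v * (v - m))"
    unfolding wt_def using c m v p by (intro frac_le mult_left_mono mult_pos_pos) auto
qed

text \<open>The quotient h y / y need not be monotone, so the integral test does not apply to it.
  Instead each increment of \<open>J\<close> over a step 1 / R is bounded by freezing h at one end
  and 1 / y at the other, and the mismatch between the denominators m and m + 1 costs a multiple of
  \<Lambda> / m. The upper bound of the induction carries the last term h (n / R) / n, so that the
  differences of h telescope.\<close>

lemma outer_sum:
  fixes h J :: "real \<Rightarrow> real"
  assumes R: "R > 0" and N: "N \<ge> 1"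
    and inc: "\<And>a b. 0 < a \<Longrightarrow> a \<le> b \<Longrightarrow> b \<le> N / R \<Longrightarrow> (b - a) * h a / b \<le> J b - J a \<and> J b - J a \<le> (b - a) * h b / a"
    and h: "\<And>m. 1 \<le> m \<Longrightarrow> m \<le> N \<Longrightarrow> 0 \<le> h (real m / R) \<and> h (real m / R) \<le> \<Lambda> * m"
  shows "\<bar>(\<Sum>m\<in>{1..N}. h (real m / R) / m) - (J (N / R) - J (1 / R))\<bar> \<le> 3 * \<Lambda> * (1 + ln N)"
proof -
  define H where "H n = (\<Sum>m\<in>{1..n}. 1 / real m)" for n :: nat
  have lam: "\<Lambda> \<ge> 0" using h[of 1] N by simp
  have "n \<le> N \<longrightarrow> - 2 * \<Lambda> * H n \<le> (\<Sum>m\<in>{1..n}. h (real m / R) / m) - (J (n / R) - J (1 / R)) \<and>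
     (\<Sum>m\<in>{1..n}. h (real m / R) / m) - (J (n / R) - J (1 / R)) \<le> h (real n / R) / n + \<Lambda> * H n" if "n \<ge> 1" for n :: nat
    using that
  proof (induction n rule: dec_induct)
    case base
    then show ?case using h[of 1] N lam by (auto simp: H_def)
  next
    case (step n)
    show ?case
    proof
      assume le: "Suc n \<le> N"
      have n: "real n > 0" using step by simp
      have "real (Suc n) / R \<le> N / R" using le R by (intro divide_right_mono) auto
      moreover have "0 < n / R" "n / R \<le> real (Suc n) / R" using n R by (auto intro: divide_right_mono)
      ultimately have I: "(Suc n / R - n / R) * h (n / R) / (Suc n / R) \<le> J (Suc n / R) - J (n / R)"
        "J (Suc n / R) - J (n / R) \<le> (Suc n / R - n / R) * h (Suc n / R) / (n / R)" using inc by blast+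
      have e1: "(Suc n / R - n / R) * h (n / R) / (Suc n / R) = h (n / R) / Suc n"
        using R by (simp add: diff_divide_distrib[symmetric])
      have e2: "(Suc n / R - n / R) * h (Suc n / R) / (n / R) = h (Suc n / R) / n"
        using R by (simp add: diff_divide_distrib[symmetric])
      have hS: "0 \<le> h (Suc n / R)" "h (Suc n / R) \<le> \<Lambda> * Suc n" using h[of "Suc n"] le by auto
      have hn: "0 \<le> h (n / R)" "h (n / R) \<le> \<Lambda> * n" using h[of n] le step by auto
      have HS: "H (Suc n) = H n + 1 / Suc n" by (simp add: H_def)
      have a: "h (n / R) / n - h (n / R) / Suc n \<le> \<Lambda> / Suc n"
      proof -
        have "h (n / R) / n - h (n / R) / Suc n = (h (n / R) / n) / Suc n" using n by (simp add: field_simps)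
        also have "\<dots> \<le> \<Lambda> / Suc n" using hn n by (intro divide_right_mono) (auto simp: field_simps)
        finally show ?thesis .
      qed
      have b: "h (Suc n / R) / n - h (Suc n / R) / Suc n \<le> 2 * \<Lambda> / Suc n"
      proof -
        have "h (Suc n / R) / n - h (Suc n / R) / Suc n = (h (Suc n / R) / Suc n) / n" using n by (simp add: field_simps)
        also have "\<dots> \<le> \<Lambda> / n" using hS n by (intro divide_right_mono) (auto simp: field_simps)
        also have "\<dots> \<le> 2 * \<Lambda> / Suc n" 
        proof -
          have "real n + 1 \<le> 2 * n" using step by simp
          then have "\<Lambda> * (real n + 1) \<le> \<Lambda> * (2 * n)" using lam by (intro mult_left_mono)
          then show ?thesis using n by (simp add: field_simps)
        qed
        finally show ?thesis .
      qed
      have dist: "- 2 * \<Lambda> * H (Suc n) = - 2 * \<Lambda> * H n - 2 * \<Lambda> / Suc n" "\<Lambda> * H (Suc n) = \<Lambda> * H n + \<Lambda> / Suc n"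
        unfolding HS by (simp_all add: algebra_simps)
      have sm: "(\<Sum>m\<in>{1..Suc n}. h (real m / R) / m) = (\<Sum>m\<in>{1..n}. h (real m / R) / m) + h (Suc n / R) / Suc n" by simp
      show "- 2 * \<Lambda> * H (Suc n) \<le> (\<Sum>m\<in>{1..Suc n}. h (real m / R) / m) - (J (Suc n / R) - J (1 / R)) \<and>
        (\<Sum>m\<in>{1..Suc n}. h (real m / R) / m) - (J (Suc n / R) - J (1 / R)) \<le> h (Suc n / R) / Suc n + \<Lambda> * H (Suc n)"
        using step.IH le I a b unfolding e1 e2 dist sm by linarith
    qed
  qed
  from this[OF N] have *: "- 2 * \<Lambda> * H N \<le> (\<Sum>m\<in>{1..N}. h (real m / R) / m) - (J (N / R) - J (1 / R))"
    "(\<Sum>m\<in>{1..N}. h (real m / R) / m) - (J (N / R) - J (1 / R)) \<le> h (real N / R) / N + \<Lambda> * H N" by auto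
  have "h (real N / R) / N \<le> \<Lambda>" using h[of N] N by (simp add: field_simps)
  moreover have "H N \<le> 1 + ln N" using harmonic_le_ln[OF N] by (simp add: H_def)
  then have "\<Lambda> * H N \<le> \<Lambda> * (1 + ln N)" using lam by (intro mult_left_mono)
  moreover have "\<Lambda> * ln N \<ge> 0" using lam N by simp
  ultimately show ?thesis using * by (simp add: algebra_simps abs_le_iff)
qed

section \<open>The function F\<close>

lemma summable_Li2: "\<bar>z\<bar> \<le> 1 \<Longrightarrow> summable (\<lambda>n. z ^ Suc n / (real (Suc n))\<^sup>2)"
  and Li2_uniform_limit: "uniform_limit {-1..1} (\<lambda>N z. \<Sum>n<N. z ^ Suc n / (real (Suc n))\<^sup>2) Li2 sequentially"
proof -
  have b: "norm (z ^ Suc n / (real (Suc n))\<^sup>2) \<le> 1 / (real n + 1)\<^sup>2" if "\<bar>z\<bar> \<le> 1" for z :: real and n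
    using power_le_one[of "\<bar>z\<bar>" "Suc n"] that
    by (simp add: abs_divide power_abs[symmetric] divide_right_mono abs_mult add.commute)
  have s: "summable (\<lambda>n. 1 / (real n + 1)\<^sup>2)"
    using inverse_squares_sums by (simp add: sums_iff add.commute)
  show "\<bar>z\<bar> \<le> 1 \<Longrightarrow> summable (\<lambda>n. z ^ Suc n / (real (Suc n))\<^sup>2)"
    by (rule summable_comparison_test[OF _ s]) (use b in blast)
  show "uniform_limit {-1..1} (\<lambda>N z. \<Sum>n<N. z ^ Suc n / (real (Suc n))\<^sup>2) Li2 sequentially"
    unfolding Li2_def[abs_def] by (rule Weierstrass_m_test[OF _ s]) (use b in auto)
qed

lemma continuous_on_Li2: "continuous_on {-1..1} Li2"
  by (rule uniform_limit_theorem[OF _ Li2_uniform_limit])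
     (auto intro!: always_eventually continuous_intros)

lemma Li2_0 [simp]: "Li2 0 = 0"
  by (simp add: Li2_def)

lemma Li2_has_derivative:
  assumes "\<bar>z\<bar> < 1" "z \<noteq> 0"
  shows "(Li2 has_real_derivative - ln (1 - z) / z) (at z)"
proof -
  \<comment> \<open>Division by zero makes \<open>a 0 = 0\<close>, so the power series begins with
    the linear term, as \<open>Li2\<close> does.\<close>
  define a where "a n = 1 / (real n)\<^sup>2" for n
  have sa: "summable (\<lambda>n. a n * w ^ n)" if "\<bar>w\<bar> \<le> 1" for w
    using summable_Li2[OF that] unfolding a_def
    by (subst summable_Suc_iff[symmetric]) simp
  have Li: "Li2 w = (\<Sum>n. a n * w ^ n)" if "\<bar>w\<bar> < 1" for w
    using suminf_split_head[OF sa[of w]] that by (simp add: Li2_def a_def)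
  have "((\<lambda>w. \<Sum>n. a n * w ^ n) has_real_derivative (\<Sum>n. diffs a n * z ^ n)) (at z)"
    by (rule termdiffs_strong[OF sa[of 1]]) (use assms in auto)
  moreover have "(\<Sum>n. diffs a n * z ^ n) = - ln (1 - z) / z"
  proof -
    have ser: "ln (1 - z) = (\<Sum>n. (- 1) ^ n * (1 / real (n + 1)) * (1 - z - 1) ^ Suc n)"
      using assms by (intro ln_series) auto
    have "(- 1) ^ n * (1 / real (n + 1)) * (1 - z - 1) ^ Suc n = - z * (z ^ n / real (n + 1))" for n
      using power_mult_distrib[of "-1" "-z" n] by simp
    then have "ln (1 - z) = (\<Sum>n. - z * (z ^ n / real (n + 1)))" unfolding ser by (intro suminf_cong)
    also have "\<dots> = - z * (\<Sum>n. z ^ n / real (n + 1))"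
    proof (rule suminf_mult)
      show "summable (\<lambda>n. z ^ n / real (n + 1))"
      proof (rule summable_comparison_test[OF _ summable_geometric[of "\<bar>z\<bar>"]])
        show "\<exists>N. \<forall>n\<ge>N. norm (z ^ n / real (n + 1)) \<le> \<bar>z\<bar> ^ n"
          by (intro exI[of _ 0] allI impI) (simp add: abs_divide power_abs divide_le_eq mult_right_le_one_le  distrib_left)
      qed (use assms in simp)
    qed
    also have "(\<Sum>n. z ^ n / real (n + 1)) = (\<Sum>n. diffs a n * z ^ n)"
      by (simp add: diffs_def a_def power2_eq_square)
    finally show ?thesis using assms by simp
  qed
  ultimately have "((\<lambda>w. \<Sum>n. a n * w ^ n) has_real_derivative - ln (1 - z) / z) (at z)" by simp
  then show ?thesis
    by (rule has_field_derivative_transform_within_open[of _ _ _ "{-1<..<1}"]) (use assms Li in auto)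
qed

text \<open>\<open>F_sgn 1\<close> and \<open>F_sgn (-1)\<close> are the functions \<open>F\<^sub>\<pm>\<close>. The bounds \<open>min\<close> and \<open>max\<close> merge the two
  cases of their definition into one expression, continuous in \<open>y\<close>.\<close>

definition F_sgn :: "int \<Rightarrow> real \<Rightarrow> real \<Rightarrow> real \<Rightarrow> real \<Rightarrow> real" where
  "F_sgn s c x2 x3 y = - of_int s * (Li2 (- of_int s * c * min (x2 * y) x3)
     - ln (1 + of_int s * c * x3) * ln (max 1 (y * x2 / x3)))"

lemma F_sgn_plus:
  assumes "x3 > 0"
  shows "F_sgn 1 c x2 x3 y = F_plus y x2 x3 c"
proof (cases "x3 \<ge> y * x2")
  case True
  then have "min (x2 * y) x3 = x2 * y" "max 1 (y * x2 / x3) = 1" using assms by (auto simp: mult.commute)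
  then show ?thesis using True by (simp add: F_sgn_def F_plus_def mult_ac)
next
  case False
  then have "min (x2 * y) x3 = x3" "max 1 (y * x2 / x3) = y * x2 / x3" using assms by (auto simp: mult.commute)
  then show ?thesis using False by (simp add: F_sgn_def F_plus_def mult_ac)
qed

lemma F_sgn_minus:
  assumes "x3 > 0"
  shows "F_sgn (-1) c x2 x3 y = F_minus y x2 x3 c"
proof (cases "x3 \<ge> y * x2")
  case True
  then have "min (x2 * y) x3 = x2 * y" "max 1 (y * x2 / x3) = 1" using assms by (auto simp: mult.commute)
  then show ?thesis using True by (simp add: F_sgn_def F_minus_def mult_ac)
next
  case False
  then have "min (x2 * y) x3 = x3" "max 1 (y * x2 / x3) = y * x2 / x3" using assms by (auto simp: mult.commute)
  then show ?thesis using False by (simp add: F_sgn_def F_minus_def mult_ac)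
qed

text \<open>The tail integral of the weight, times m, at the beginning of row m: for y = m / R the
  ratio m / n is there equal to min (x2 y) x3. Its quotient by y is the derivative of
  \<open>F_sgn\<close>.\<close>

definition h_F :: "int \<Rightarrow> real \<Rightarrow> real \<Rightarrow> real \<Rightarrow> real \<Rightarrow> real" where
  "h_F s c x2 x3 y = of_int s * ln (1 + of_int s * c * min (x2 * y) x3)"

lemma minus_ln_le: "0 \<le> y \<Longrightarrow> y \<le> 1 / 2 \<Longrightarrow> - ln (1 - y) \<le> 2 * (y::real)"
proof -
  assume y: "0 \<le> y" "y \<le> 1 / 2"
  have "- y - 2 * y\<^sup>2 \<le> ln (1 - y)" using ln_one_minus_pos_lower_bound[of y] y by simp
  moreover have "y * y \<le> 1 / 2 * y" using y by (intro mult_right_mono) auto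
  ultimately show ?thesis by (simp add: power2_eq_square)
qed

context
  fixes s :: int and c x2 x3 :: real
  assumes s: "s = 1 \<or> s = -1" and c: "0 < c" "c \<le> 1" and x2: "0 < x2" "x2 \<le> 1" and x3: "0 < x3" "x3 \<le> 1"
begin

lemma F_arg_bounds:
  assumes "0 \<le> y" "y \<le> 1"
  shows "0 \<le> c * min (x2 * y) x3" "c * min (x2 * y) x3 \<le> y"
proof -
  show "0 \<le> c * min (x2 * y) x3" using assms c x2 x3 by simp
  have "min (x2 * y) x3 \<le> 1 * y" using x2 assms mult_right_mono[of x2 1 y] by (simp add: min_le_iff_disj)
  then have "c * min (x2 * y) x3 \<le> 1 * (1 * y)" using c assms x2 x3 by (intro mult_mono) auto
  then show "c * min (x2 * y) x3 \<le> y" by simp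
qed

lemma continuous_on_F_sgn: "continuous_on {0..1} (F_sgn s c x2 x3)"
proof -
  have "continuous_on {0..1} (\<lambda>y. Li2 (- of_int s * c * min (x2 * y) x3))"
  proof (rule continuous_on_compose2[OF continuous_on_Li2])
    show "continuous_on {0..1} (\<lambda>y. - of_int s * c * min (x2 * y) x3)" by (intro continuous_intros)
    show "(\<lambda>y. - of_int s * c * min (x2 * y) x3) ` {0..1} \<subseteq> {-1..1}"
      using F_arg_bounds s by fastforce
  qed
  then show ?thesis unfolding F_sgn_def[abs_def] using x3
    by (intro continuous_intros) auto
qed

lemma F_sgn_0: "F_sgn s c x2 x3 0 = 0"
  using x3 by (simp add: F_sgn_def)

lemma F_sgn_has_derivative:
  assumes y: "0 < y" "y < 1" and ne: "x2 * y \<noteq> x3"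
  shows "(F_sgn s c x2 x3 has_real_derivative h_F s c x2 x3 y / y) (at y)"
proof (cases "x2 * y < x3")
  case True
  have z: "0 < c * (x2 * y)" "c * (x2 * y) < 1"
  proof -
    have "min (x2 * y) x3 = x2 * y" using True by simp
    then have "c * (x2 * y) \<le> y" using F_arg_bounds(2)[of y] y by simp
    then show "c * (x2 * y) < 1" using y by linarith
    show "0 < c * (x2 * y)" using c x2 y by simp
  qed
  define z where "z = - of_int s * c * (x2 * y)"
  have zz: "\<bar>z\<bar> < 1" "z \<noteq> 0" using z s by (auto simp: z_def)
  have "((\<lambda>y. - of_int s * Li2 (- of_int s * c * (x2 * y))) has_real_derivative
      - of_int s * (- ln (1 - z) / z * (- of_int s * c * x2))) (at y)"
    unfolding z_def
    by (rule DERIV_cmult, rule DERIV_chain2[of Li2 _ "\<lambda>y. - of_int s * c * (x2 * y)" y "- of_int s * c * x2",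
          OF Li2_has_derivative[OF zz, unfolded z_def]])
       (auto intro!: derivative_eq_intros)
  also have "- of_int s * (- ln (1 - z) / z * (- of_int s * c * x2)) = h_F s c x2 x3 y / y"
    using True s c x2 y by (auto simp: z_def h_F_def mult_ac)
  finally show ?thesis
  proof (rule has_field_derivative_transform_within_open)
    show "open {w. x2 * w < x3}" by (intro open_Collect_less continuous_intros)
    show "y \<in> {w. x2 * w < x3}" using True by simp
    fix w assume "w \<in> {w. x2 * w < x3}"
    then have "min (x2 * w) x3 = x2 * w" "max 1 (w * x2 / x3) = 1" using x3 by (auto simp: mult.commute)
    then show "- of_int s * Li2 (- of_int s * c * (x2 * w)) = F_sgn s c x2 x3 w" by (simp add: F_sgn_def)
  qed
next
  case False
  then have gt: "x3 < x2 * y" using ne by simp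
  let ?l = "ln (1 + of_int s * c * x3)"
  have "((\<lambda>y. - of_int s * (Li2 (- of_int s * c * x3) - ?l * ln (y * x2 / x3))) has_real_derivative
      - of_int s * (0 - ?l * (1 / (y * x2 / x3) * (x2 / x3)))) (at y)"
    using y x2 x3 by (auto intro!: derivative_eq_intros)
  also have "- of_int s * (0 - ?l * (1 / (y * x2 / x3) * (x2 / x3))) = h_F s c x2 x3 y / y"
    using gt x2 x3 y by (simp add: h_F_def)
  finally show ?thesis
  proof (rule has_field_derivative_transform_within_open)
    show "open {w. x3 < x2 * w}" by (intro open_Collect_less continuous_intros)
    show "y \<in> {w. x3 < x2 * w}" using gt by simp
    fix w assume "w \<in> {w. x3 < x2 * w}"
    then have "min (x2 * w) x3 = x3" "max 1 (w * x2 / x3) = w * x2 / x3" using x3 by (auto simp: mult.commute)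
    then show "- of_int s * (Li2 (- of_int s * c * x3) - ?l * ln (w * x2 / x3)) = F_sgn s c x2 x3 w"
      by (simp add: F_sgn_def)
  qed
qed

text \<open>Comparison of derivatives. The two branches of \<open>F_sgn\<close> meet at w = x3 / x2,
  where no derivative is at hand, so the interval is split there and continuity joins the
  pieces.\<close>

lemma F_sgn_le:
  assumes ab: "0 \<le> a" "a \<le> b" "b \<le> 1" and G: "continuous_on {a..b} G"
    and der: "\<And>y. a < y \<Longrightarrow> y < b \<Longrightarrow> (G has_real_derivative g y) (at y)"
    and le: "\<And>y. a < y \<Longrightarrow> y < b \<Longrightarrow> h_F s c x2 x3 y / y \<le> g y"
  shows "F_sgn s c x2 x3 b - F_sgn s c x2 x3 a \<le> G b - G a"
proof -
  let ?D = "\<lambda>y. F_sgn s c x2 x3 y - G y"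
  have piece: "?D v \<le> ?D u" if uv: "a \<le> u" "u \<le> v" "v \<le> b" "\<And>y. u < y \<Longrightarrow> y < v \<Longrightarrow> x2 * y \<noteq> x3" for u v
  proof (rule DERIV_nonpos_imp_decreasing_open[OF uv(2)])
    show "continuous_on {u..v} ?D"
      using uv ab by (intro continuous_intros continuous_on_subset[OF continuous_on_F_sgn] continuous_on_subset[OF G]) auto
    fix y assume y: "u < y" "y < v"
    have "(?D has_real_derivative h_F s c x2 x3 y / y - g y) (at y)"
      using y uv ab by (intro DERIV_diff F_sgn_has_derivative der) auto
    moreover have "h_F s c x2 x3 y / y - g y \<le> 0" using le[of y] y uv by simp
    ultimately show "\<exists>d. (?D has_real_derivative d) (at y) \<and> d \<le> 0" by blast
  qed
  define w where "w = x3 / x2"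
  have w: "x2 * y \<noteq> x3" if "y \<noteq> w" for y using that x2 by (auto simp: w_def field_simps)
  show ?thesis
  proof (cases "a \<le> w \<and> w \<le> b")
    case True
    have "?D b \<le> ?D w" "?D w \<le> ?D a" using True ab w by (intro piece; auto)+
    then show ?thesis by linarith
  next
    case False
    have "?D b \<le> ?D a"
    proof (intro piece ab order_refl)
      fix y assume "a < y" "y < b"
      then have "y \<noteq> w" using False by auto
      then show "x2 * y \<noteq> x3" by (rule w)
    qed
    then show ?thesis by linarith
  qed
qed

lemma F_sgn_ge:
  assumes ab: "0 \<le> a" "a \<le> b" "b \<le> 1" and le: "\<And>y. a < y \<Longrightarrow> y < b \<Longrightarrow> K \<le> h_F s c x2 x3 y / y"
  shows "K * (b - a) \<le> F_sgn s c x2 x3 b - F_sgn s c x2 x3 a"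
proof -
  let ?D = "\<lambda>y. K * y - F_sgn s c x2 x3 y"
  have piece: "?D v \<le> ?D u" if uv: "a \<le> u" "u \<le> v" "v \<le> b" "\<And>y. u < y \<Longrightarrow> y < v \<Longrightarrow> x2 * y \<noteq> x3" for u v
  proof (rule DERIV_nonpos_imp_decreasing_open[OF uv(2)])
    show "continuous_on {u..v} ?D"
      using uv ab by (intro continuous_intros continuous_on_subset[OF continuous_on_F_sgn]) auto
    fix y assume y: "u < y" "y < v"
    have "(?D has_real_derivative K * 1 - h_F s c x2 x3 y / y) (at y)"
      using y uv ab by (intro DERIV_diff F_sgn_has_derivative DERIV_cmult DERIV_ident) auto
    moreover have "K * 1 - h_F s c x2 x3 y / y \<le> 0" using le[of y] y uv by simp
    ultimately show "\<exists>d. (?D has_real_derivative d) (at y) \<and> d \<le> 0" by blast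
  qed
  define w where "w = x3 / x2"
  have w: "x2 * y \<noteq> x3" if "y \<noteq> w" for y using that x2 by (auto simp: w_def field_simps)
  show ?thesis
  proof (cases "a \<le> w \<and> w \<le> b")
    case True
    have "?D b \<le> ?D w" "?D w \<le> ?D a" using True ab w by (intro piece; auto)+
    then show ?thesis by (simp add: algebra_simps)
  next
    case False
    have "?D b \<le> ?D a"
    proof (intro piece ab order_refl)
      fix y assume "a < y" "y < b"
      then have "y \<noteq> w" using False by auto
      then show "x2 * y \<noteq> x3" by (rule w)
    qed
    then show ?thesis by (simp add: algebra_simps)
  qed
qed

lemma h_F_bounds:
  assumes y: "0 \<le> y" "y < 1"
  shows "0 \<le> h_F s c x2 x3 y" "h_F s c x2 x3 y \<le> - ln (1 - y)"
proof -
  define z where "z = c * min (x2 * y) x3"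
  have z: "0 \<le> z" "z \<le> y" using F_arg_bounds[of y] y by (auto simp: z_def)
  have h: "h_F s c x2 x3 y = of_int s * ln (1 + of_int s * z)" by (simp add: h_F_def z_def mult.assoc)
  have m: "- ln (1 - z) \<le> - ln (1 - y)" using z y by simp
  have "z \<le> - ln (1 - z)" using ln_le_minus_one[of "1 - z"] z y by simp
  moreover have "ln (1 + z) \<le> z" using ln_le_minus_one[of "1 + z"] z by simp
  moreover have "0 \<le> ln (1 + z)" using z by simp
  ultimately show "0 \<le> h_F s c x2 x3 y" "h_F s c x2 x3 y \<le> - ln (1 - y)"
    unfolding h using s m z by auto
qed

lemma h_F_mono:
  assumes y: "0 \<le> a" "a \<le> b" "b < 1"
  shows "h_F s c x2 x3 a \<le> h_F s c x2 x3 b"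
proof -
  have le: "c * min (x2 * a) x3 \<le> c * min (x2 * b) x3"
    using y c x2 by (intro mult_left_mono min.mono) auto
  have "c * min (x2 * b) x3 < 1" "0 \<le> c * min (x2 * a) x3" "0 \<le> c * min (x2 * b) x3" using F_arg_bounds[of b] F_arg_bounds[of a] y by auto
  then show ?thesis using s le by (auto simp: h_F_def)
qed

lemma F_sgn_increment:
  assumes "0 < a" "a \<le> b" "b < 1"
  shows "(b - a) * h_F s c x2 x3 a / b \<le> F_sgn s c x2 x3 b - F_sgn s c x2 x3 a"
    and "F_sgn s c x2 x3 b - F_sgn s c x2 x3 a \<le> (b - a) * h_F s c x2 x3 b / a"
proof -
  have "h_F s c x2 x3 a / b \<le> h_F s c x2 x3 y / y \<and> h_F s c x2 x3 y / y \<le> h_F s c x2 x3 b / a" if "a < y" "y < b" for y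
    using that assms h_F_mono[of a y] h_F_mono[of y b] h_F_bounds[of a] h_F_bounds[of y] h_F_bounds[of b]
    by (intro conjI frac_le) auto
  note bd = this
  have "h_F s c x2 x3 a / b * (b - a) \<le> F_sgn s c x2 x3 b - F_sgn s c x2 x3 a"
    using F_sgn_ge[of a b "h_F s c x2 x3 a / b"] bd assms by auto
  then show "(b - a) * h_F s c x2 x3 a / b \<le> F_sgn s c x2 x3 b - F_sgn s c x2 x3 a" by (simp add: mult.commute)
  have "F_sgn s c x2 x3 b - F_sgn s c x2 x3 a \<le> h_F s c x2 x3 b / a * b - h_F s c x2 x3 b / a * a"
  proof (rule F_sgn_le)
    fix y assume "a < y" "y < b"
    show "((\<lambda>y. h_F s c x2 x3 b / a * y) has_real_derivative h_F s c x2 x3 b / a) (at y)"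
      using DERIV_cmult[OF DERIV_ident, of "h_F s c x2 x3 b / a"] by simp
  qed (use bd assms in \<open>auto intro!: continuous_intros\<close>)
  then show "F_sgn s c x2 x3 b - F_sgn s c x2 x3 a \<le> (b - a) * h_F s c x2 x3 b / a"
    unfolding right_diff_distrib[symmetric] by (simp add: mult.commute)
qed

lemma F_sgn_mono: "0 \<le> a \<Longrightarrow> a \<le> b \<Longrightarrow> b \<le> 1 \<Longrightarrow> F_sgn s c x2 x3 a \<le> F_sgn s c x2 x3 b"
  using F_sgn_ge[of a b 0] h_F_bounds(1) by force

text \<open>In the extremal case the quotient is -ln (1 - y) / y, which has no elementary primitive.
  The majorant has one and keeps the integrable singularity at y = 1.\<close>

lemma h_F_div_le:
  assumes y: "0 < y" "y < 1"
  shows "h_F s c x2 x3 y / y \<le> 2 - 2 * ln (1 - y)"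
proof (cases "y \<le> 1 / 2")
  case True
  have "h_F s c x2 x3 y \<le> 2 * y" using h_F_bounds(2)[of y] minus_ln_le[of y] y True by simp
  moreover have "ln (1 - y) \<le> 0" using y by simp
  ultimately have "h_F s c x2 x3 y / y \<le> 2" using y by (simp add: divide_le_eq)
  with \<open>ln (1 - y) \<le> 0\<close> show ?thesis by linarith
next
  case False
  have l: "- ln (1 - y) \<ge> 0" using y by simp
  have "h_F s c x2 x3 y / y \<le> - ln (1 - y) / (1 / 2)"
    using False h_F_bounds[of y] y by (intro frac_le) auto
  then show ?thesis using l by simp
qed

text \<open>The right side is the increment of 4 y + 2 (1 - y) ln (1 - y), a primitive of the
  majorant in \<open>h_F_div_le\<close>. It stays finite at y = 1, where \<open>h_F\<close> can be
  unbounded.\<close>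

lemma F_sgn_le_explicit:
  assumes ab: "0 \<le> a" "a \<le> b" "b \<le> 1"
  shows "F_sgn s c x2 x3 b - F_sgn s c x2 x3 a \<le> 4 * (b - a) + 2 * ((1 - b) * ln (1 - b) - (1 - a) * ln (1 - a))"
proof -
  define G where "G y = 4 * y + 2 * ((1 - y) * ln (1 - y))" for y :: real
  \<comment> \<open>At 0 the product vanishes through its first factor, whatever the value of
    \<open>ln 0\<close>; the bound 2 sqrt x shows that it is also the limit.\<close>
  have xlx: "continuous_on {0..1} (\<lambda>x::real. x * ln x)"
  proof -
    have "((\<lambda>x::real. x * ln x) \<longlongrightarrow> 0 * ln 0) (at 0 within {0..1})"
    proof -
      have "\<bar>x * ln x\<bar> \<le> 2 * sqrt x" if "0 < x" "x \<le> 1" for x :: real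
      proof -
        have "- ln (sqrt x) \<le> 1 / sqrt x"
          using ln_le_minus_one[of "1 / sqrt x"] that by (simp add: ln_div)
        then have "- ln x \<le> 2 / sqrt x" using that by (simp add: ln_sqrt)
        then have "x * - ln x \<le> x * (2 / sqrt x)" using that by (intro mult_left_mono) auto
        also have "\<dots> = 2 * sqrt x" using that real_div_sqrt[of x] by (simp add: mult.commute[of x 2])
        finally have "- (x * ln x) \<le> 2 * sqrt x" by simp
        moreover have "x * ln x \<le> 0" using that by (simp add: mult_nonneg_nonpos)
        ultimately show ?thesis using that by (simp add: abs_of_nonpos)
      qed
      then have "\<forall>\<^sub>F x in at 0 within {0..1}. norm (x * ln x) \<le> 2 * sqrt x"
        by (auto simp: eventually_at intro!: exI[of _ 1])
      moreover have "((\<lambda>x. 2 * sqrt x) \<longlongrightarrow> 2 * sqrt 0) (at 0 within {0..1})"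
        by (intro tendsto_intros)
      ultimately show ?thesis by (auto intro: Lim_null_comparison)
    qed
    moreover have "isCont (\<lambda>x::real. x * ln x) x" if "x > 0" for x using that by (intro continuous_intros) auto
    ultimately show ?thesis
      unfolding continuous_on_def by (metis atLeastAtMost_iff isCont_def less_eq_real_def tendsto_within_subset subset_UNIV)
  qed
  have "F_sgn s c x2 x3 b - F_sgn s c x2 x3 a \<le> G b - G a"
  proof (rule F_sgn_le[OF ab, of G "\<lambda>y. 2 - 2 * ln (1 - y)"])
    have "continuous_on {a..b} (\<lambda>y. (1 - y) * ln (1 - y))"
      by (rule continuous_on_compose2[OF xlx, of _ "\<lambda>y. 1 - y"]) (use ab in \<open>auto intro!: continuous_intros\<close>)
    from continuous_on_add[OF continuous_on_mult_left[OF continuous_on_id, where c = 4] continuous_on_mult_left[OF this, where c = 2]]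
    show "continuous_on {a..b} G" unfolding G_def .
    fix y assume y: "a < y" "y < b"
    show "(G has_real_derivative 2 - 2 * ln (1 - y)) (at y)"
    proof -
      have y1: "1 - y > 0" using y ab by simp
      have "((\<lambda>y. 1 - y) has_real_derivative - 1) (at y)" "((\<lambda>y. ln (1 - y)) has_real_derivative - 1 / (1 - y)) (at y)"
        using y1 by (auto intro!: derivative_eq_intros)
      from DERIV_add[OF DERIV_cmult[OF DERIV_ident, where c = 4] DERIV_cmult[OF DERIV_mult[OF this], where c = 2]]
      show ?thesis unfolding G_def by (rule DERIV_cong) (use y1 in simp)
    qed
    show "h_F s c x2 x3 y / y \<le> 2 - 2 * ln (1 - y)" using h_F_div_le[of y] y ab by auto
  qed
  then show ?thesis by (simp add: G_def algebra_simps)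
qed

lemma F_sgn_bounds:
  assumes "0 \<le> y" "y \<le> 1"
  shows "0 \<le> F_sgn s c x2 x3 y" "F_sgn s c x2 x3 y \<le> 4"
proof -
  show "0 \<le> F_sgn s c x2 x3 y" using F_sgn_mono[of 0 y] assms by (simp add: F_sgn_0)
  have "F_sgn s c x2 x3 1 \<le> 4" using F_sgn_le_explicit[of 0 1] by (simp add: F_sgn_0)
  then show "F_sgn s c x2 x3 y \<le> 4" using F_sgn_mono[of y 1] assms by simp
qed

lemma F_sgn_small:
  assumes "0 \<le> y" "y \<le> 1 / 2"
  shows "F_sgn s c x2 x3 y \<le> 2 * y"
proof -
  have "F_sgn s c x2 x3 y - F_sgn s c x2 x3 0 \<le> 2 * y - 2 * 0"
  proof (rule F_sgn_le[of 0 y "\<lambda>y. 2 * y" "\<lambda>_. 2"])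
    fix w assume w: "0 < w" "w < y"
    then show "h_F s c x2 x3 w / w \<le> 2"
      using h_F_bounds(2)[of w] minus_ln_le[of w] assms by (simp add: divide_le_eq)
  qed (use assms in \<open>auto intro!: continuous_intros derivative_eq_intros\<close>)
  then show ?thesis by (simp add: F_sgn_0)
qed

text \<open>A modulus of continuity of order \<delta> ln (1 / \<delta>), uniform up to the singular
  end 1. It pays for replacing the point where a sum over m stops by \<open>x1\<close>.\<close>

lemma F_sgn_top:
  assumes x1: "0 \<le> x" "x \<le> 1" and \<delta>: "0 < \<delta>" "\<delta> \<le> 1 / 2"
    and a: "0 \<le> a" "x - \<delta> \<le> a" "a \<le> x"
  shows "F_sgn s c x2 x3 x - F_sgn s c x2 x3 a \<le> \<delta> * (4 - 2 * ln \<delta>)"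
proof -
  have ld: "ln \<delta> \<le> 0" using \<delta> by simp
  show ?thesis
  proof (cases "x \<le> \<delta>")
    case True
    have "F_sgn s c x2 x3 x \<le> 2 * x" using F_sgn_small[of x] True \<delta> x1 by simp
    moreover have "F_sgn s c x2 x3 a \<ge> 0" using F_sgn_bounds[of a] a x1 by simp
    moreover have "\<delta> * (4 - 2 * ln \<delta>) \<ge> \<delta> * 4" using \<delta> ld by (intro mult_left_mono) auto
    ultimately show ?thesis using True x1 by linarith
  next
    case False
    define u where "u = 1 - x"
    have u: "0 \<le> u" by (simp add: u_def x1)
    have "F_sgn s c x2 x3 (x - \<delta>) \<le> F_sgn s c x2 x3 a" using False a x1 by (intro F_sgn_mono) auto
    moreover have "F_sgn s c x2 x3 x - F_sgn s c x2 x3 (x - \<delta>) \<le> 4 * \<delta> + 2 * (u * ln u - (u + \<delta>) * ln (u + \<delta>))"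
      using F_sgn_le_explicit[of "x - \<delta>" x] False x1 \<delta> by (simp add: u_def algebra_simps)
    moreover have "u * ln u \<le> u * ln (u + \<delta>)"
      using u \<delta> by (cases "u = 0") (auto intro!: mult_left_mono)
    moreover have "\<delta> * ln \<delta> \<le> \<delta> * ln (u + \<delta>)" using u \<delta> by (intro mult_left_mono) auto
    ultimately show ?thesis by (simp add: algebra_simps)
  qed
qed

end

text \<open>The weight for s = -1, c = 1 dominates all others, and its sum over n > m is at most its
  integral from m + 1 plus one term. This crude bound serves for summability, for the row next to R,
  and for small R.\<close>

lemma wt_ray_infsum:
  assumes s: "s = 1 \<or> s = -1" and c: "0 < c" "c \<le> 1" and m: "m \<ge> 1" and S: "\<And>n. n \<in> S \<Longrightarrow> m < n"
  shows "(\<lambda>n. wt s c (real m) (real n)) summable_on S"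
    and "0 \<le> (\<Sum>\<^sub>\<infinity>n\<in>S. wt s c (real m) (real n))"
    and "(\<Sum>\<^sub>\<infinity>n\<in>S. wt s c (real m) (real n)) \<le> (1 + ln (real m + 1)) / m"
proof -
  let ?U = "{n. m < n}"
  have U: "{n \<in> ?U. n mod 1 = 0 mod 1} = ?U" by simp
  have m0: "real m > 0" using m by simp
  note p = wt_progression[of "-1" 1 "real m" "real m + 1" 1 ?U 0, unfolded U]
  have sm: "(\<lambda>n. wt (-1) 1 (real m) (real n)) summable_on ?U"
    by (rule p(1)) (use m in auto)
  have b: "\<bar>(\<Sum>\<^sub>\<infinity>n\<in>?U. wt (-1) 1 (real m) (real n)) - wt_tail (-1) 1 (real m) (real m + 1) / real 1\<bar>
      \<le> wt (-1) 1 (real m) (real m + 1)"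
    by (rule p(2)) (use m in auto)
  have pt: "wt s c (real m) (real n) \<le> wt (-1) 1 (real m) (real n)" "0 \<le> wt s c (real m) (real n)" if "m < n" for n
  proof -
    have "wt (-1) 1 (real m) (real n) = 1 / (n * (real n - m))" by (simp add: wt_def)
    then show "wt s c (real m) (real n) \<le> wt (-1) 1 (real m) (real n)" "0 \<le> wt s c (real m) (real n)"
      using wt_bounds[OF s c, of "real m" "real n"] that by auto
  qed
  have smU: "(\<lambda>n. wt s c (real m) (real n)) summable_on ?U"
    by (rule summable_on_comparison_test[OF sm]) (use pt in auto)
  show smS: "(\<lambda>n. wt s c (real m) (real n)) summable_on S"
    by (rule summable_on_subset_banach[OF smU]) (use S in auto)
  show "0 \<le> (\<Sum>\<^sub>\<infinity>n\<in>S. wt s c (real m) (real n))"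
    by (rule infsum_nonneg) (use pt S in auto)
  have "(\<Sum>\<^sub>\<infinity>n\<in>S. wt s c (real m) (real n)) \<le> (\<Sum>\<^sub>\<infinity>n\<in>?U. wt (-1) 1 (real m) (real n))"
  proof (rule infsum_mono_neutral[OF smS sm])
    fix n assume "n \<in> ?U - S"
    then show "0 \<le> wt (- 1) 1 (real m) (real n)" using pt[of n] by auto
  qed (use pt S in auto)
  also have "\<dots> \<le> wt_tail (-1) 1 (real m) (real m + 1) + wt (-1) 1 (real m) (real m + 1)" using b by simp
  also have "wt_tail (-1) 1 (real m) (real m + 1) = ln (real m + 1) / m"
  proof -
    have "1 - real m / (real m + 1) = inverse (real m + 1)" by (simp add: field_simps)
    then show ?thesis by (simp add: wt_tail_def ln_inverse)
  qed
  also have "wt (-1) 1 (real m) (real m + 1) = 1 / (real m + 1)" by (simp add: wt_def)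
  also have "\<dots> \<le> 1 / m" using m0 by (simp add: field_simps)
  finally show "(\<Sum>\<^sub>\<infinity>n\<in>S. wt s c (real m) (real n)) \<le> (1 + ln (real m + 1)) / m"
    by (simp add: add_divide_distrib)
qed

text \<open>For \<open>k = 1\<close> the last condition is void; for \<open>k = 2\<close> it says that \<open>m\<close> and \<open>n\<close> have opposite
  parity.\<close>

definition reg_F :: "nat \<Rightarrow> real \<Rightarrow> real \<Rightarrow> real \<Rightarrow> real \<Rightarrow> nat \<Rightarrow> nat \<Rightarrow> bool" where
  "reg_F k x1 x2 x3 R m n \<longleftrightarrow> real m \<le> x1 * R \<and> R < real n \<and> R \<le> x2 * real n \<and> real m \<le> x3 * real n
     \<and> n mod k = (m + 1) mod k"

lemma harmonic_reverse_le:
  assumes "R \<ge> 1" "N + 1 \<le> R"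
  shows "(\<Sum>m\<in>{1..N}. 1 / (R - real m)) \<le> 1 + ln R"
proof -
  have "(\<Sum>m\<in>{1..N}. 1 / (R - real m)) \<le> (\<Sum>m\<in>{1..N}. 1 / real (N + 1 - m))"
    using assms by (intro sum_mono divide_left_mono) (auto simp: of_nat_diff)
  also have "\<dots> = (\<Sum>m\<in>{1..N}. 1 / real m)"
    by (rule sum.reindex_bij_witness[of _ "\<lambda>m. N + 1 - m" "\<lambda>m. N + 1 - m"]) auto
  also have "\<dots> \<le> (\<Sum>m\<in>{1..nat \<lfloor>R\<rfloor>}. 1 / real m)"
    using assms le_nat_floor[of N R] by (intro sum_mono2) auto
  also have "\<dots> \<le> 1 + ln R" by (rule harmonic_le_ln_real[OF assms(1)])
  finally show ?thesis .
qed

context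
  fixes s :: int and c x1 x2 x3 :: real and k :: nat
  assumes s: "s = 1 \<or> s = -1" and c: "0 < c" "c \<le> 1" and x1: "0 < x1" "x1 \<le> 1"
    and x2: "0 < x2" "x2 \<le> 1" and x3: "0 < x3" "x3 \<le> 1" and k: "k \<ge> 1"
begin

text \<open>For fixed m the region is a ray in a residue class starting at V = max (R / x2) (m /
  x3), and m / V is the argument of the logarithm in \<open>h_F\<close>, up to s c. Since V \<ge> R,
  the endpoint error is at most 1 / (R (R - m)), whose sum over m \<le> R - 1 is O(ln R /
  R).\<close>

lemma F_inner:
  assumes m: "1 \<le> m" "real m \<le> x1 * R" "real m \<le> R - 1"
  shows "\<bar>(\<Sum>\<^sub>\<infinity>n\<in>{n. n \<ge> 1 \<and> reg_F k x1 x2 x3 R m n}. wt s c m n) - h_F s c x2 x3 (m / R) / m / k\<bar>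
    \<le> 1 / (R * (R - m))"
proof -
  define V where "V = max (R / x2) (m / x3)"
  define U where "U = {n. R < real n \<and> R \<le> x2 * real n \<and> real m \<le> x3 * real n}"
  have R: "R > 1" "real m > 0" using m by auto
  have "x2 * R \<le> 1 * R" using x2 R by (intro mult_right_mono) auto
  then have "R / x2 \<ge> R" using x2 R by (simp add: field_simps)
  then have VR: "V \<ge> R" by (simp add: V_def)
  have Uc: "V \<le> real n \<longleftrightarrow> R \<le> x2 * real n \<and> real m \<le> x3 * real n" for n
    using x2 x3 by (simp add: V_def field_simps)
  have set: "{n. n \<ge> 1 \<and> reg_F k x1 x2 x3 R m n} = {n \<in> U. n mod k = (m + 1) mod k}"
    using m R by (auto simp: U_def reg_F_def)
  have "\<bar>(\<Sum>\<^sub>\<infinity>n\<in>{n \<in> U. n mod k = (m + 1) mod k}. wt s c m n) - wt_tail s c m V / k\<bar> \<le> wt s c m V"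
  proof (rule wt_progression(2)[OF s c _ _ k])
    show "V \<le> real n" if "n \<in> U" for n using that Uc[of n] by (simp add: U_def)
    show "n \<in> U" if "V < real n" for n using that Uc[of n] VR by (simp add: U_def)
  qed (use R m VR in auto)
  moreover have "wt_tail s c m V = h_F s c x2 x3 (m / R) / m"
  proof -
    have "m / V = min (x2 * (m / R)) x3"
    proof (cases "R / x2 \<le> m / x3")
      case True
      then have "V = m / x3" by (simp add: V_def)
      moreover have "x3 \<le> x2 * (m / R)" using True x2 x3 R by (simp add: field_simps)
      ultimately show ?thesis using x3 R by simp
    next
      case False
      then have "V = R / x2" by (simp add: V_def)
      moreover have "x2 * (m / R) \<le> x3" using False x2 x3 R by (simp add: field_simps)
      moreover have "m / (R / x2) = x2 * (m / R)" by simp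
      ultimately show ?thesis by simp
    qed
    moreover have "wt_tail s c m V = of_int s * ln (1 + of_int s * c * (m / V)) / m" by (simp add: wt_tail_def)
    ultimately show ?thesis by (simp add: h_F_def)
  qed
  moreover have "wt s c m V \<le> 1 / (R * (R - m))"
  proof -
    have "wt s c m V \<le> 1 / (V * (V - m))" using wt_bounds[OF s c, of m V] VR R m by auto
    also have "\<dots> \<le> 1 / (R * (R - m))"
      using VR R m by (intro divide_left_mono mult_mono mult_pos_pos) auto
    finally show ?thesis .
  qed
  ultimately show ?thesis unfolding set by simp
qed

text \<open>Rows up to N go through \<open>F_inner\<close> and \<open>outer_sum\<close>; the
  primitive at 1 / R is negligible, and \<open>F_sgn_top\<close> with width 2 / R moves the upper
  end from N / R to \<open>x1\<close>. That lemma wants a width of at most 1 / 2, whence R \<ge> 4.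
  The errors add up to (13 L + 6 L^2 + 2) / R with L \<ge> 1.\<close>

lemma F_lat_sum_large:
  assumes R: "R \<ge> 4"
  shows "\<bar>lat_sum (reg_F k x1 x2 x3) (\<lambda>m n. wt s c m n) R - F_sgn s c x2 x3 x1 / k\<bar> \<le> 24 * (1 + ln R)\<^sup>2 / R"
proof -
  define L where "L = 1 + ln R"
  define M where "M = nat \<lfloor>R\<rfloor>"
  define N where "N = nat \<lfloor>min (x1 * R) (R - 1)\<rfloor>"
  define T where "T m = (\<Sum>\<^sub>\<infinity>n\<in>{n. n \<ge> 1 \<and> reg_F k x1 x2 x3 R m n}. wt s c m n)" for m :: nat
  define h where "h = h_F s c x2 x3"
  define J where "J = F_sgn s c x2 x3"
  note bnd = F_sgn_bounds[OF s c x2 x3] and hb = h_F_bounds[OF s c x2 x3]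
  have L1: "L \<ge> 1" using R by (simp add: L_def)
  then have L: "L \<ge> 1" "L\<^sup>2 \<ge> L" using mult_left_mono[of 1 L L] by (simp_all add: power2_eq_square)
  have kr: "real k \<ge> 1" using k by simp
  have x1R: "x1 * R > 0" "x1 * R \<le> R" using x1 R by auto
  have Nle: "1 \<le> m \<Longrightarrow> m \<le> N \<longleftrightarrow> real m \<le> x1 * R \<and> real m \<le> R - 1" for m
    using le_nat_floor_iff[of m "min (x1 * R) (R - 1)"] by (simp add: N_def)
  have N1: "real N \<le> x1 * R" "real N \<le> R - 1"
    using x1R R unfolding N_def by linarith+
  have N2: "real N \<ge> x1 * R - 2" using x1R R unfolding N_def by linarith
  have M: "M \<ge> 1" "real M \<le> R" "R - 1 < real M" using R unfolding M_def by linarith+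
  have "N \<le> M" using N1(2) M by linarith
  have lat: "lat_sum (reg_F k x1 x2 x3) (\<lambda>m n. wt s c m n) R = (\<Sum>m\<in>{1..N}. T m) + (\<Sum>m\<in>{N<..M}. T m)"
  proof -
    have "{1..M} = {1..N} \<union> {N<..M}" using \<open>N \<le> M\<close> by auto
    then show ?thesis unfolding lat_sum_def M_def[symmetric] T_def by (subst sum.union_disjoint[symmetric]) auto
  qed
  have Tb: "0 \<le> T m \<and> T m \<le> (1 + ln (real m + 1)) / m" if "1 \<le> m" for m
    using wt_ray_infsum[OF s c that, of "{n. n \<ge> 1 \<and> reg_F k x1 x2 x3 R m n}"] x1R
    unfolding T_def by (force simp: reg_F_def)
  have T0: "T m = 0" if "real m > x1 * R" for m
    unfolding T_def using that by (intro infsum_0) (auto simp: reg_F_def)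
  \<comment> \<open>Rows between N and M: those with m < M satisfy m \<le> R - 1, hence exceed x1 R
    and are empty. Only the row m = M can contribute, and there the crude bound suffices.\<close>
  have extra: "0 \<le> (\<Sum>m\<in>{N<..M}. T m)" "(\<Sum>m\<in>{N<..M}. T m) \<le> 4 * L / R"
  proof -
    show "0 \<le> (\<Sum>m\<in>{N<..M}. T m)" using Tb by (intro sum_nonneg) auto
    have "(\<Sum>m\<in>{N<..M}. T m) \<le> (\<Sum>m\<in>{N<..M}. if m = M then T M else 0)"
    proof (rule sum_mono)
      fix m assume m: "m \<in> {N<..M}"
      show "T m \<le> (if m = M then T M else 0)"
      proof (cases "m = M")
        case False
        then have "real m + 1 \<le> real M" using m by auto
        then have "real m \<le> R - 1" using M by linarith
        then have "real m > x1 * R" using m Nle[of m] by auto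
        then show ?thesis using T0[of m] False by simp
      qed simp
    qed
    also have "\<dots> \<le> T M" using Tb[OF M(1)] by (cases "M \<in> {N<..M}") (auto simp: sum.delta)
    also have "\<dots> \<le> (1 + ln (real M + 1)) / M" using Tb[OF M(1)] by simp
    also have "\<dots> \<le> (2 + ln R) / (R / 2)"
    proof (intro frac_le)
      have "ln (real M + 1) \<le> ln (2 * R)" using M R by (intro ln_mono) auto
      also have "\<dots> = ln 2 + ln R" using R by (simp add: ln_mult)
      finally show "1 + ln (real M + 1) \<le> 2 + ln R" using ln_2_less_1 by linarith
    qed (use M R in \<open>auto intro: add_nonneg_nonneg\<close>)
    also have "\<dots> \<le> 4 * L / R" using R by (simp add: L_def field_simps)
    finally show "(\<Sum>m\<in>{N<..M}. T m) \<le> 4 * L / R" .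
  qed
  have E1: "\<bar>(\<Sum>m\<in>{1..N}. T m) - (\<Sum>m\<in>{1..N}. h (real m / R) / m) / k\<bar> \<le> L / R"
  proof -
    have "\<bar>(\<Sum>m\<in>{1..N}. T m) - (\<Sum>m\<in>{1..N}. h (real m / R) / m) / k\<bar> = \<bar>\<Sum>m\<in>{1..N}. T m - h (real m / R) / m / k\<bar>"
      by (simp add: sum_subtractf sum_divide_distrib)
    also have "\<dots> \<le> (\<Sum>m\<in>{1..N}. 1 / (R * (R - m)))"
      by (rule sum_abs[THEN order_trans], rule sum_mono) (use F_inner Nle in \<open>auto simp: T_def h_def\<close>)
    also have "\<dots> = (\<Sum>m\<in>{1..N}. 1 / (R - m)) / R" by (simp add: sum_divide_distrib mult.commute)
    also have "\<dots> \<le> L / R"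
      unfolding L_def using N1 R by (intro divide_right_mono harmonic_reverse_le) auto
    finally show ?thesis .
  qed
  have J1R: "0 \<le> J (1 / R)" "J (1 / R) \<le> 2 / R"
    using bnd[of "1 / R"] F_sgn_small[OF s c x2 x3, of "1 / R"] R by (auto simp: J_def)
  have E2: "\<bar>(\<Sum>m\<in>{1..N}. h (real m / R) / m) - J (N / R)\<bar> \<le> 6 * L\<^sup>2 / R + 2 / R"
  proof (cases "N \<ge> 1")
    case False
    then have "N = 0" by simp
    then show ?thesis using F_sgn_0[OF s c x2 x3] R by (simp add: J_def)
  next
    case True
    have NR: "N / R < 1" using N1 R by simp
    have "\<bar>(\<Sum>m\<in>{1..N}. h (real m / R) / m) - (J (N / R) - J (1 / R))\<bar> \<le> 3 * (2 * L / R) * (1 + ln N)"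
    proof (rule outer_sum)
      show "R > 0" "N \<ge> 1" using R True by auto
      show "(b - a) * h a / b \<le> J b - J a \<and> J b - J a \<le> (b - a) * h b / a" if "0 < a" "a \<le> b" "b \<le> N / R" for a b
        using F_sgn_increment[OF s c x2 x3, of a b] that NR by (auto simp: J_def h_def)
      fix m :: nat assume m: "1 \<le> m" "m \<le> N"
      define y where "y = m / R"
      have y: "0 < y" "y \<le> 1 - 1 / R" "y < 1" using m N1 R by (auto simp: y_def field_simps)
      have "h y \<le> - ln (1 - y)" "0 \<le> h y" using hb[of y] y by (auto simp: h_def)
      \<comment> \<open>The rows kept satisfy y \<le> 1 - 1 / R, so the logarithmic singularity
        costs at most ln R. This gives the slope 2 L / R required by
        \<open>outer_sum\<close>.\<close>
      moreover have "- ln (1 - y) \<le> 2 * L * y"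
      proof (cases "y \<le> 1 / 2")
        case True
        have "2 * y \<le> 2 * L * y" using L y by simp
        then show ?thesis using minus_ln_le[of y] True y by linarith
      next
        case False
        have "- ln (1 - y) \<le> - ln (1 / R)" using y R by simp
        also have "\<dots> \<le> L" using R by (simp add: L_def ln_div)
        also have "L * 1 \<le> L * (2 * y)" using L False by (intro mult_left_mono) auto
        finally show ?thesis by (simp add: mult_ac)
      qed
      ultimately show "0 \<le> h (real m / R) \<and> h (real m / R) \<le> 2 * L / R * real m"
        by (simp add: y_def)
    qed
    also have "\<dots> \<le> 3 * (2 * L / R) * L"
      unfolding L_def using True N1 R by (intro mult_left_mono add_left_mono ln_mono) auto
    also have "\<dots> = 6 * L\<^sup>2 / R" by (simp add: power2_eq_square)
    finally show ?thesis using J1R by linarith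
  qed
  have E3: "0 \<le> J x1 - J (N / R)" "J x1 - J (N / R) \<le> 8 * L / R"
  proof -
    have "(x1 * R - 2) / R \<le> N / R" using N2 R by (intro divide_right_mono) auto
    moreover have "(x1 * R - 2) / R = x1 - 2 / R" using R by (simp add: diff_divide_distrib)
    ultimately have a: "N / R \<le> x1" "x1 - 2 / R \<le> N / R" using N1 R by (simp_all add: pos_divide_le_eq)
    show "0 \<le> J x1 - J (N / R)" using F_sgn_mono[OF s c x2 x3, of "N / R" x1] a x1 R by (simp add: J_def)
    have "J x1 - J (N / R) \<le> 2 / R * (4 - 2 * ln (2 / R))"
      unfolding J_def using a x1 R by (intro F_sgn_top[OF s c x2 x3]) auto
    also have "\<dots> \<le> 2 / R * (4 * L)"
    proof (intro mult_left_mono)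
      have "ln (1 / R) \<le> ln (2 / R)" using R by (intro ln_mono divide_right_mono) auto
      moreover have "ln (1 / R) = - ln R" "0 \<le> ln R" using R by (auto simp: ln_div)
      moreover have "4 - 2 * u \<le> 4 * (1 + v)" if "- v \<le> u" "0 \<le> v" for u v :: real using that by simp
      ultimately show "4 - 2 * ln (2 / R) \<le> 4 * L" unfolding L_def by metis
    qed (use R in simp)
    finally show "J x1 - J (N / R) \<le> 8 * L / R" by simp
  qed
  have E23: "\<bar>((\<Sum>m\<in>{1..N}. h (real m / R) / m) - J x1) / k\<bar> \<le> 6 * L\<^sup>2 / R + 2 / R + 8 * L / R"
  proof -
    have "\<bar>((\<Sum>m\<in>{1..N}. h (real m / R) / m) - J x1) / k\<bar> \<le> \<bar>(\<Sum>m\<in>{1..N}. h (real m / R) / m) - J x1\<bar>"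
      using kr mult_left_mono[of 1 k "\<bar>(\<Sum>m\<in>{1..N}. h (real m / R) / m) - J x1\<bar>"] by (simp add: abs_divide divide_le_eq)
    then show ?thesis using E2 E3 by linarith
  qed
  have "\<bar>lat_sum (reg_F k x1 x2 x3) (\<lambda>m n. wt s c m n) R - J x1 / k\<bar>
    \<le> 4 * L / R + L / R + (6 * L\<^sup>2 / R + 2 / R + 8 * L / R)"
    using E1 E23 extra unfolding lat diff_divide_distrib by linarith
  also have "\<dots> = (13 * L + 6 * L\<^sup>2 + 2) / R" by (simp add: add_divide_distrib[symmetric])
  also have "\<dots> \<le> 24 * L\<^sup>2 / R" using L R by (intro divide_right_mono) auto
  finally show ?thesis by (simp add: L_def J_def)
qed

text \<open>Below R = 4 both quantities are bounded: there are at most three rows, each of size at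
  most 2, against a main term of at most 4. The right side is there at least 24 / 4 = 6.\<close>

lemma F_lat_sum:
  assumes R: "R \<ge> 1"
  shows "\<bar>lat_sum (reg_F k x1 x2 x3) (\<lambda>m n. wt s c m n) R - F_sgn s c x2 x3 x1 / k\<bar> \<le> 24 * (1 + ln R)\<^sup>2 / R"
proof (cases "R \<ge> 4")
  case False
  let ?S = "lat_sum (reg_F k x1 x2 x3) (\<lambda>m n. wt s c m n) R"
  have T: "0 \<le> (\<Sum>\<^sub>\<infinity>n\<in>{n. n \<ge> 1 \<and> reg_F k x1 x2 x3 R m n}. wt s c m n) \<and>
      (\<Sum>\<^sub>\<infinity>n\<in>{n. n \<ge> 1 \<and> reg_F k x1 x2 x3 R m n}. wt s c m n) \<le> 2" if m: "1 \<le> m" for m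
  proof -
    have "m < n" if "reg_F k x1 x2 x3 R m n" for n
    proof -
      have "x1 * R \<le> R" using x1 R mult_right_mono[of x1 1 R] by simp
      then have "real m < real n" using that unfolding reg_F_def by linarith
      then show ?thesis by simp
    qed
    note b = wt_ray_infsum[OF s c m, of "{n. n \<ge> 1 \<and> reg_F k x1 x2 x3 R m n}"]
    have "ln (real m + 1) \<le> m" using ln_add_one_self_le_self[of "real m"] by (simp add: add.commute)
    then have "(1 + ln (real m + 1)) / m \<le> 2" using m by (simp add: divide_le_eq)
    then show ?thesis using b \<open>\<And>n. reg_F k x1 x2 x3 R m n \<Longrightarrow> m < n\<close> by force
  qed
  have "?S \<ge> 0" unfolding lat_sum_def using T by (intro sum_nonneg) auto
  moreover have "?S \<le> (\<Sum>m\<in>{1..nat \<lfloor>R\<rfloor>}. 2)" unfolding lat_sum_def using T by (intro sum_mono) auto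
  moreover have "\<lfloor>R\<rfloor> \<le> 3" using False by linarith
  then have "real (nat \<lfloor>R\<rfloor>) \<le> 3" by linarith
  ultimately have S: "0 \<le> ?S" "?S \<le> 6" by auto
  have J: "0 \<le> F_sgn s c x2 x3 x1 / k" "F_sgn s c x2 x3 x1 / k \<le> 4"
    using F_sgn_bounds[OF s c x2 x3, of x1] x1 k by (auto simp: divide_le_eq intro: order_trans)
  have "24 * 1 / 4 \<le> 24 * (1 + ln R)\<^sup>2 / R"
    using False R by (intro frac_le mult_left_mono) auto
  with S J show ?thesis by linarith
qed (rule F_lat_sum_large)

end

section \<open>The wedges of the odd expansion\<close>

lemma golden_bounds: "1 / 2 < golden" "golden < 1" "golden\<^sup>2 = 1 - golden" "golden \<notin> \<rat>"
proof -
  have "(2::real) = sqrt 4" by simp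
  also have "\<dots> < sqrt 5" by (simp only: real_sqrt_less_iff)
  finally have 1: "2 < sqrt 5" .
  have "sqrt 5 < sqrt 9" by (simp only: real_sqrt_less_iff)
  also have "sqrt 9 = (3::real)" using real_sqrt_abs[of 3] by simp
  finally have 2: "sqrt 5 < 3" .
  show "1 / 2 < golden" "golden < 1" using 1 2 by (auto simp: golden_def)
  show "golden\<^sup>2 = 1 - golden" by (simp add: golden_def power2_eq_square field_simps)
  show "golden \<notin> \<rat>"
  proof
    assume "golden \<in> \<rat>"
    then have "2 * golden + 1 \<in> \<rat>" by (intro Rats_add Rats_mult) auto
    moreover have "2 * golden + 1 = sqrt 5" by (simp add: golden_def field_simps)
    ultimately have "sqrt 5 \<in> \<rat>" by simp
    then obtain m n where mn: "n \<noteq> 0" "\<bar>sqrt 5\<bar> = real m / real n" "coprime m n" by (rule Rats_abs_nat_div_natE)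
    then have "real m = sqrt 5 * real n" by simp
    then have "(real m)\<^sup>2 = 5 * (real n)\<^sup>2" by (simp add: power_mult_distrib)
    then have "real (m\<^sup>2) = real (5 * n\<^sup>2)" by simp
    then have eq: "m\<^sup>2 = 5 * n\<^sup>2" by (simp only: of_nat_eq_iff)
    have p5: "prime (5::nat)" by simp
    have "5 dvd m\<^sup>2" using eq by simp
    then have m5: "5 dvd m" using p5 prime_dvd_power by blast
    then obtain j where "m = 5 * j" by blast
    then have "n\<^sup>2 = 5 * j\<^sup>2" using eq by (simp add: power2_eq_square)
    then have "5 dvd n\<^sup>2" by simp
    then have "5 dvd n" using p5 prime_dvd_power by blast
    with m5 mn(3) show False by (metis coprime_common_divisor_nat numeral_eq_one_iff semiring_norm(86))
  qed
qed

text \<open>For y = m / R this is m / W, where W is the largest of R / x2, m / x3 and R + (2 l - 1)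
  m, the beginning of row m in wedge l. The row ends at n = (2 l + g) m, which explains the constant
  1 / (2 l + g) in \<open>h_D\<close>.\<close>

definition arg_D :: "real \<Rightarrow> real \<Rightarrow> nat \<Rightarrow> real \<Rightarrow> real" where
  "arg_D x2 x3 l y = min (min (x2 * y) x3) (y / (1 + (2 * real l - 1) * y))"

text \<open>The difference of the tail integrals at the two ends of the row, times m; the maximum
  with 0 accounts for empty rows.\<close>

definition h_D :: "int \<Rightarrow> real \<Rightarrow> real \<Rightarrow> real \<Rightarrow> nat \<Rightarrow> real \<Rightarrow> real" where
  "h_D s c x2 x3 l y = max 0 (of_int s * ln (1 + of_int s * c * arg_D x2 x3 l y)
     - of_int s * ln (1 + of_int s * c / (2 * real l + golden)))"

definition J_D :: "int \<Rightarrow> real \<Rightarrow> real \<Rightarrow> real \<Rightarrow> nat \<Rightarrow> real \<Rightarrow> real" where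
  "J_D s c x2 x3 l y = integral {0..y} (\<lambda>t. h_D s c x2 x3 l t / t)"

text \<open>Arguments up to 1 / 2 keep 1 - c b at least 1 / 2, which is the origin of the Lipschitz
  constant 2.\<close>

lemma sgn_ln_mono:
  fixes s :: int and a b c :: real
  assumes s: "s = 1 \<or> s = -1" and c: "0 < c" "c \<le> 1" and ab: "0 \<le> a" "a \<le> b" "b \<le> 1 / 2"
  shows "of_int s * ln (1 + of_int s * c * a) \<le> of_int s * ln (1 + of_int s * c * b)"
    and "of_int s * ln (1 + of_int s * c * b) - of_int s * ln (1 + of_int s * c * a) \<le> 2 * (b - a)"
proof -
  have cab: "0 \<le> c * a" "c * a \<le> c * b" using c ab by (auto intro: mult_left_mono)
  have cb: "c * b \<le> 1 / 2" using mult_mono[of c 1 b "1/2"] c ab by simp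
  have d: "c * b - c * a \<le> b - a" using mult_right_mono[of c 1 "b - a"] c ab by (simp add: algebra_simps)
  show "of_int s * ln (1 + of_int s * c * a) \<le> of_int s * ln (1 + of_int s * c * b)"
    using s cab cb by auto
  have "ln ((1 + c * b) / (1 + c * a)) \<le> (1 + c * b) / (1 + c * a) - 1"
    using cab cb by (intro ln_le_minus_one) auto
  also have "\<dots> = (c * b - c * a) / (1 + c * a)" using cab by (simp add: field_simps)
  also have "\<dots> \<le> (c * b - c * a) / 1" using cab by (intro divide_left_mono) auto
  finally have 1: "ln (1 + c * b) - ln (1 + c * a) \<le> 2 * (b - a)" using cab cb d ab by (simp add: ln_div)
  have "ln ((1 - c * a) / (1 - c * b)) \<le> (1 - c * a) / (1 - c * b) - 1"
    using cab cb by (intro ln_le_minus_one) auto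
  also have "\<dots> = (c * b - c * a) / (1 - c * b)" using cb by (simp add: field_simps)
  also have "\<dots> \<le> (b - a) / (1 / 2)" using cab cb d by (intro frac_le) auto
  finally have 2: "ln (1 - c * a) - ln (1 - c * b) \<le> 2 * (b - a)" using cab cb d by (simp add: ln_div)
  show "of_int s * ln (1 + of_int s * c * b) - of_int s * ln (1 + of_int s * c * a) \<le> 2 * (b - a)"
    using s 1 2 by auto
qed

context
  fixes s :: int and c x2 x3 :: real and l :: nat
  assumes s: "s = 1 \<or> s = -1" and c: "0 < c" "c \<le> 1" and x2: "0 < x2" "x2 \<le> 1" and x3: "0 < x3" "x3 \<le> 1"
    and l: "l \<ge> 1"
begin

lemma arg_D_bounds:
  assumes "0 \<le> y" "y \<le> 1"
  shows "0 \<le> arg_D x2 x3 l y" "arg_D x2 x3 l y \<le> 1 / (2 * real l)" "arg_D x2 x3 l y \<le> 1 / 2"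
proof -
  have l1: "real l \<ge> 1" using l by simp
  have p: "1 + (2 * real l - 1) * y > 0" using assms l1 by (simp add: add_pos_nonneg)
  show "0 \<le> arg_D x2 x3 l y" using assms p x2 x3 l1 by (auto simp: arg_D_def)
  have "y / (1 + (2 * real l - 1) * y) \<le> 1 / (2 * real l)"
    using p l1 assms by (simp add: divide_simps) (simp add: algebra_simps)
  then show *: "arg_D x2 x3 l y \<le> 1 / (2 * real l)" unfolding arg_D_def by linarith
  have "1 / (2 * real l) \<le> 1 / 2" using l1 by (simp add: field_simps)
  with * show "arg_D x2 x3 l y \<le> 1 / 2" by linarith
qed

lemma arg_D_mono:
  assumes "0 \<le> a" "a \<le> b" "b \<le> 1"
  shows "arg_D x2 x3 l a \<le> arg_D x2 x3 l b"
proof -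
  have l1: "real l \<ge> 1" using l by simp
  have "1 + (2 * real l - 1) * a > 0" "1 + (2 * real l - 1) * b > 0"
    using assms l1 by (auto intro: add_pos_nonneg)
  then have "a / (1 + (2 * real l - 1) * a) \<le> b / (1 + (2 * real l - 1) * b)"
    using assms by (simp add: divide_simps) (simp add: algebra_simps)
  then show ?thesis unfolding arg_D_def using assms x2 by (intro min.mono mult_left_mono) auto
qed

lemma end_D_bounds: "0 < 1 / (2 * real l + golden)" "1 / (2 * real l + golden) \<le> 1 / (2 * real l)"
    "1 / (2 * real l) - 1 / (2 * real l + golden) \<le> 1 / (4 * (real l)\<^sup>2)" "1 / (2 * real l + golden) \<le> 1 / 2"
proof -
  have l1: "real l \<ge> 1" using l by simp
  note g = golden_bounds
  show "0 < 1 / (2 * real l + golden)" using l1 g by simp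
  show 1: "1 / (2 * real l + golden) \<le> 1 / (2 * real l)" using l1 g by (intro divide_left_mono) auto
  have "1 / (2 * real l) - 1 / (2 * real l + golden) = golden / (2 * real l * (2 * real l + golden))"
    using l1 g by (simp add: field_simps)
  also have "\<dots> \<le> 1 / (2 * real l * (2 * real l))"
    using l1 g by (intro frac_le mult_left_mono) auto
  finally show "1 / (2 * real l) - 1 / (2 * real l + golden) \<le> 1 / (4 * (real l)\<^sup>2)" by (simp add: power2_eq_square)
  have "1 / (2 * real l) \<le> 1 / 2" using l1 by (simp add: field_simps)
  with 1 show "1 / (2 * real l + golden) \<le> 1 / 2" by linarith
qed

lemma h_D_nonneg: "0 \<le> h_D s c x2 x3 l y" by (simp add: h_D_def)

lemma h_D_mono:
  assumes "0 \<le> a" "a \<le> b" "b \<le> 1"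
  shows "h_D s c x2 x3 l a \<le> h_D s c x2 x3 l b"
  using sgn_ln_mono(1)[OF s c _ arg_D_mono[OF assms]] arg_D_bounds[of a] arg_D_bounds[of b] assms
  unfolding h_D_def by (intro max.mono diff_right_mono) auto

text \<open>The ratios m / n in wedge l lie between 1 / (2 l + g) and 1 / (2 l), an interval of
  length at most 1 / (4 l^2). The Lipschitz bound of \<open>sgn_ln_mono\<close> turns this into the
  decay that makes the series over l converge.\<close>

lemma h_D_le:
  assumes y: "0 \<le> y" "y \<le> 1"
  shows "h_D s c x2 x3 l y \<le> 1 / (real l)\<^sup>2"
proof -
  let ?b = "1 / (2 * real l + golden)"
  have eq: "of_int s * c / (2 * real l + golden) = of_int s * c * ?b" by simp
  have "of_int s * ln (1 + of_int s * c * arg_D x2 x3 l y) - of_int s * ln (1 + of_int s * c * ?b) \<le> 1 / (real l)\<^sup>2"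
  proof (cases "?b \<le> arg_D x2 x3 l y")
    case True
    have "of_int s * ln (1 + of_int s * c * arg_D x2 x3 l y) - of_int s * ln (1 + of_int s * c * ?b)
        \<le> 2 * (arg_D x2 x3 l y - ?b)"
      by (rule sgn_ln_mono(2)[OF s c _ True]) (use end_D_bounds arg_D_bounds y in auto)
    also have "\<dots> \<le> 2 * (1 / (4 * (real l)\<^sup>2))"
      using order_trans[OF diff_right_mono[OF arg_D_bounds(2)[OF y]] end_D_bounds(3)] by (rule mult_left_mono) simp
    also have "\<dots> \<le> 1 / (real l)\<^sup>2" using l by (simp add: divide_simps)
    finally show ?thesis .
  next
    case False
    have "of_int s * ln (1 + of_int s * c * arg_D x2 x3 l y) \<le> of_int s * ln (1 + of_int s * c * ?b)"
      by (rule sgn_ln_mono(1)[OF s c]) (use False end_D_bounds arg_D_bounds[OF y] in auto)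
    moreover have "1 / (real l)\<^sup>2 \<ge> 0" by simp
    ultimately show ?thesis by linarith
  qed
  then show ?thesis unfolding h_D_def eq by simp
qed

lemma h_D_eq_0:
  assumes "0 \<le> y" "y \<le> 1" "arg_D x2 x3 l y \<le> 1 / (2 * real l + golden)"
  shows "h_D s c x2 x3 l y = 0"
proof -
  have "of_int s * ln (1 + of_int s * c * arg_D x2 x3 l y) \<le> of_int s * ln (1 + of_int s * c * (1 / (2 * real l + golden)))"
    by (rule sgn_ln_mono(1)[OF s c _ assms(3)]) (use end_D_bounds arg_D_bounds assms in auto)
  then show ?thesis by (simp add: h_D_def)
qed

text \<open>Wedge l meets row m only if R < (1 + g) m, that is m / R > 1 / (1 + g) = g > 1 / 2. So
  the quotient of \<open>h_D\<close> by y has no singularity at 0.\<close>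

lemma h_D_half:
  assumes "0 \<le> y" "y \<le> 1 / 2"
  shows "h_D s c x2 x3 l y = 0"
proof (rule h_D_eq_0)
  have l1: "real l \<ge> 1" using l by simp
  have p: "1 + (2 * real l - 1) * y > 0" using assms l1 by (simp add: add_pos_nonneg)
  have "y * (1 + golden) \<le> 1 / 2 * 2" using assms golden_bounds by (intro mult_mono) auto
  then have "y / (1 + (2 * real l - 1) * y) \<le> 1 / (2 * real l + golden)"
    using p l1 golden_bounds by (intro divide_le_divide_cross) (auto simp: algebra_simps)
  then show "arg_D x2 x3 l y \<le> 1 / (2 * real l + golden)" unfolding arg_D_def by linarith
qed (use assms in auto)

lemma continuous_on_h_D: "continuous_on {0..1} (h_D s c x2 x3 l)"
proof -
  have l1: "real l \<ge> 1" using l by simp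
  have p: "1 + (2 * real l - 1) * y \<noteq> 0" if "y \<in> {0..1}" for y
  proof -
    have "(2 * real l - 1) * y \<ge> 0" using that l1 by simp
    then show ?thesis by linarith
  qed
  have a: "continuous_on {0..1} (arg_D x2 x3 l)"
    unfolding arg_D_def[abs_def] using p by (intro continuous_intros) auto
  have "1 + of_int s * c * arg_D x2 x3 l y \<noteq> 0" if "y \<in> {0..1}" for y
  proof -
    have "0 \<le> c * arg_D x2 x3 l y" using arg_D_bounds[of y] that c by simp
    moreover have "c * arg_D x2 x3 l y \<le> 1 * (1 / 2)"
      using arg_D_bounds[of y] that c by (intro mult_mono) auto
    ultimately show ?thesis using s by auto
  qed
  then show ?thesis unfolding h_D_def[abs_def] by (intro continuous_intros a) auto
qed

lemma h_D_integrable: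
  assumes "0 \<le> a" "b \<le> 1"
  shows "(\<lambda>t. h_D s c x2 x3 l t / t) integrable_on {a..b}"
proof -
  \<comment> \<open>Replacing t by max t (1 / 2) does not change the integrand, as the numerator
    vanishes for t \<le> 1 / 2, and makes its continuity evident.\<close>
  have "continuous_on {a..b} (\<lambda>t. h_D s c x2 x3 l t / max t (1 / 2))"
    using assms by (intro continuous_intros continuous_on_subset[OF continuous_on_h_D]) auto
  then have "(\<lambda>t. h_D s c x2 x3 l t / max t (1 / 2)) integrable_on {a..b}" by (rule integrable_continuous_interval)
  moreover have "h_D s c x2 x3 l t / max t (1 / 2) = h_D s c x2 x3 l t / t" if "t \<in> {a..b}" for t
    using h_D_half[of t] that assms by (cases "t \<le> 1 / 2") auto
  ultimately show ?thesis by (rule integrable_eq)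
qed

lemma J_D_diff:
  assumes "0 \<le> a" "a \<le> b" "b \<le> 1"
  shows "J_D s c x2 x3 l b - J_D s c x2 x3 l a = integral {a..b} (\<lambda>t. h_D s c x2 x3 l t / t)"
  using Henstock_Kurzweil_Integration.integral_combine[OF assms(1,2) h_D_integrable[OF order_refl assms(3)]]
  by (simp add: J_D_def)

lemma J_D_increment:
  assumes "0 < a" "a \<le> b" "b \<le> 1"
  shows "(b - a) * h_D s c x2 x3 l a / b \<le> J_D s c x2 x3 l b - J_D s c x2 x3 l a"
    and "J_D s c x2 x3 l b - J_D s c x2 x3 l a \<le> (b - a) * h_D s c x2 x3 l b / a"
proof -
  let ?f = "\<lambda>t. h_D s c x2 x3 l t / t"
  have bd: "h_D s c x2 x3 l a / b \<le> ?f t \<and> ?f t \<le> h_D s c x2 x3 l b / a" if "t \<in> {a..b}" for t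
    using that assms h_D_mono[of a t] h_D_mono[of t b] h_D_nonneg by (intro conjI frac_le) auto
  have I: "?f integrable_on {a..b}" using assms by (intro h_D_integrable) auto
  have "integral {a..b} (\<lambda>_. h_D s c x2 x3 l a / b) \<le> integral {a..b} ?f"
    by (rule integral_le[OF integrable_const_ivl I]) (use bd in auto)
  then show "(b - a) * h_D s c x2 x3 l a / b \<le> J_D s c x2 x3 l b - J_D s c x2 x3 l a"
    using assms J_D_diff[of a b] by simp
  have "integral {a..b} ?f \<le> integral {a..b} (\<lambda>_. h_D s c x2 x3 l b / a)"
    by (rule integral_le[OF I integrable_const_ivl]) (use bd in auto)
  then show "J_D s c x2 x3 l b - J_D s c x2 x3 l a \<le> (b - a) * h_D s c x2 x3 l b / a"
    using assms J_D_diff[of a b] by simp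
qed

lemma J_D_half:
  assumes "0 \<le> y" "y \<le> 1 / 2"
  shows "J_D s c x2 x3 l y = 0"
proof -
  have "J_D s c x2 x3 l y = integral {0..y} (\<lambda>_. 0)"
    unfolding J_D_def by (rule Henstock_Kurzweil_Integration.integral_cong) (use h_D_half assms in auto)
  then show ?thesis by simp
qed

lemma J_D_bounds:
  assumes y: "0 \<le> y" "y \<le> 1"
  shows "0 \<le> J_D s c x2 x3 l y" "J_D s c x2 x3 l y \<le> 1 / (real l)\<^sup>2"
proof -
  have "0 \<le> J_D s c x2 x3 l y \<and> J_D s c x2 x3 l y \<le> 1 / (real l)\<^sup>2"
  proof (cases "y \<le> 1 / 2")
    case True
    then show ?thesis using J_D_half y by simp
  next
    case False
    note j = J_D_increment[of "1 / 2" y] J_D_half[of "1 / 2"]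
    have "(y - 1 / 2) * h_D s c x2 x3 l y / (1 / 2) \<le> 1 * (1 / (real l)\<^sup>2)"
      using h_D_le[OF y] h_D_nonneg[of y] False y mult_mono[of "(y - 1/2) * 2" 1 "h_D s c x2 x3 l y" "1 / (real l)\<^sup>2"]
      by (simp add: algebra_simps)
    moreover have "0 \<le> (y - 1 / 2) * h_D s c x2 x3 l (1 / 2) / y" using h_D_nonneg False by simp
    ultimately show ?thesis using j False y by linarith
  qed
  then show "0 \<le> J_D s c x2 x3 l y" "J_D s c x2 x3 l y \<le> 1 / (real l)\<^sup>2" by auto
qed

end

text \<open>If 2 l - 1 is the last digit, then n - (2 l - 1) m is the denominator preceding m, up to
  sign. The last two inequalities say that it exceeds R, so that R was passed before, and that it
  lies below the upper end (1 + g) m of the window.\<close>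

definition reg_D :: "nat \<Rightarrow> real \<Rightarrow> real \<Rightarrow> real \<Rightarrow> real \<Rightarrow> nat \<Rightarrow> nat \<Rightarrow> bool" where
  "reg_D l x1 x2 x3 R m n \<longleftrightarrow> real m \<le> x1 * R \<and> R \<le> x2 * real n \<and> real m \<le> x3 * real n
     \<and> R + (2 * real l - 1) * real m < real n \<and> real n < (2 * real l + golden) * real m"

lemma reg_D_ne: "\<lbrakk>l \<ge> 1; R > 0; reg_D l x1 x2 x3 R m n\<rbrakk> \<Longrightarrow> R < real n \<and> m < n \<and> m \<ge> 1"
proof -
  assume a: "l \<ge> 1" "R > 0" "reg_D l x1 x2 x3 R m n"
  then have lo: "1 * real m \<le> (2 * real l - 1) * real m" by (intro mult_right_mono) auto
  have b: "R + (2 * real l - 1) * real m < real n" "real n < (2 * real l + golden) * real m"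
    using a by (auto simp: reg_D_def)
  have "real m \<ge> 0" by simp
  with lo b a(2) have 1: "R < real n" "real m < real n" by linarith+
  have "m \<noteq> 0"
  proof
    assume "m = 0"
    with b a show False by simp
  qed
  with 1 show ?thesis by simp
qed

definition D_total :: "int \<Rightarrow> real \<Rightarrow> real \<Rightarrow> real \<Rightarrow> real \<Rightarrow> nat \<Rightarrow> real" where
  "D_total s c x1 x2 x3 l0 = (\<Sum>i. J_D s c x2 x3 (i + l0) x1)"

definition reg_O :: "real \<Rightarrow> real \<Rightarrow> real \<Rightarrow> nat \<Rightarrow> real \<Rightarrow> nat \<Rightarrow> nat \<Rightarrow> bool" where
  "reg_O x1 x2 x3 l0 R m n \<longleftrightarrow> reg_F 1 x1 x2 x3 R m n \<and> \<not> (\<exists>l\<ge>l0. reg_D l x1 x2 x3 R m n)"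

context
  fixes s :: int and c x1 x2 x3 :: real
  assumes s: "s = 1 \<or> s = -1" and c: "0 < c" "c \<le> 1" and x1: "0 < x1" "x1 \<le> 1"
    and x2: "0 < x2" "x2 \<le> 1" and x3: "0 < x3" "x3 \<le> 1"
begin

lemma h_D_wt_tail:
  fixes m R :: real
  assumes m: "0 < m" "m \<le> R" and l: "l \<ge> 1"
  defines "W \<equiv> max (max (R / x2) (m / x3)) (R + (2 * real l - 1) * m)" and "Z \<equiv> (2 * real l + golden) * m"
  shows "h_D s c x2 x3 l (m / R) / m = (if W < Z then wt_tail s c m W - wt_tail s c m Z else 0)"
proof -
  have R: "R > 0" using m by simp
  have l1: "real l \<ge> 1" using l by simp
  have y: "0 \<le> m / R" "m / R \<le> 1" using m R by auto
  have C0: "R + (2 * real l - 1) * m > 0" using R l1 m by (intro add_pos_nonneg) auto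
  have W0: "W > 0" using C0 by (simp add: W_def less_max_iff_disj)
  have Z0: "Z > 0" unfolding Z_def using m golden_bounds l1 by (intro mult_pos_pos add_nonneg_pos) auto
  have \<alpha>: "m / W = arg_D x2 x3 l (m / R)"
  proof -
    have inv: "m / max a b = min (m / a) (m / b)" if "a > 0" "b > 0" for a b :: real
      using that m by (cases "a \<le> b") (auto simp: min_def max_def field_simps)
    have 3: "m / (R + (2 * real l - 1) * m) = (m / R) / (1 + (2 * real l - 1) * (m / R))"
      using R by (simp add: divide_simps)
    have "m / (R / x2) = x2 * (m / R)" "m / (m / x3) = x3" using m by auto
    moreover have "R / x2 > 0" "m / x3 > 0" using R x2 x3 m by auto
    ultimately show ?thesis
      unfolding W_def arg_D_def 3[symmetric] using C0
      using inv[of "max (R / x2) (m / x3)" "R + (2 * real l - 1) * m"] inv[of "R / x2" "m / x3"]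
      by (simp only: less_max_iff_disj simp_thms)
  qed
  have \<beta>: "m / Z = 1 / (2 * real l + golden)" using m by (simp add: Z_def)
  show ?thesis
  proof (cases "W < Z")
    case False
    have "arg_D x2 x3 l (m / R) \<le> 1 / (2 * real l + golden)"
      unfolding \<alpha>[symmetric] \<beta>[symmetric] using False m W0 Z0 by (intro divide_left_mono mult_pos_pos) auto
    then have "h_D s c x2 x3 l (m / R) = 0" by (intro h_D_eq_0[OF s c x2 x3 l y])
    then show ?thesis using False by simp
  next
    case True
    have "1 / (2 * real l + golden) \<le> arg_D x2 x3 l (m / R)"
      unfolding \<alpha>[symmetric] \<beta>[symmetric] using True W0 Z0 m by (intro divide_left_mono mult_pos_pos) auto
    then have "of_int s * ln (1 + of_int s * c * (1 / (2 * real l + golden))) \<le> of_int s * ln (1 + of_int s * c * arg_D x2 x3 l (m / R))"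
      using arg_D_bounds[OF s c x2 x3 l y] end_D_bounds[OF s c x2 x3 l] by (intro sgn_ln_mono(1)[OF s c]) auto
    then have "h_D s c x2 x3 l (m / R) = of_int s * ln (1 + of_int s * c * (m / W)) - of_int s * ln (1 + of_int s * c * (m / Z))"
      unfolding h_D_def \<alpha> \<beta> by simp
    then show ?thesis using True by (simp add: wt_tail_def diff_divide_distrib)
  qed
qed

text \<open>A row of the wedge is a difference of two rays, beginning at W and at Z. A row with W <
  Z forces R < (1 + g) m, hence m > R / 2, and W \<ge> 2 l m; so the weight at either end is at most
  2 / (l^2 R^2).\<close>

lemma D_inner:
  assumes m: "1 \<le> m" "real m \<le> x1 * R" and R: "R \<ge> 1" and l: "l \<ge> 1"
  shows "\<bar>(\<Sum>\<^sub>\<infinity>n\<in>{n. n \<ge> 1 \<and> reg_D l x1 x2 x3 R m n}. wt s c m n) - h_D s c x2 x3 l (m / R) / m\<bar>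
    \<le> 4 / ((real l)\<^sup>2 * R\<^sup>2)"
proof -
  define W where "W = max (max (R / x2) (m / x3)) (R + (2 * real l - 1) * m)"
  define Z where "Z = (2 * real l + golden) * m"
  define UW where "UW = {n. R \<le> x2 * real n \<and> real m \<le> x3 * real n \<and> R + (2 * real l - 1) * real m < real n}"
  define UZ where "UZ = {n. Z \<le> real n}"
  note g = golden_bounds
  have m0: "real m > 0" and l1: "real l \<ge> 1" using m l by auto
  have mR: "real m \<le> R" using m(2) x1 R mult_right_mono[of x1 1 R] by linarith
  have W0: "W \<ge> 2 * real l * m"
  proof -
    have "2 * real l * m \<le> R + (2 * real l - 1) * m" using mR by (simp add: algebra_simps)
    then show ?thesis by (simp add: W_def)
  qed
  have lm: "real l * m \<ge> m" using l1 m0 mult_right_mono[of 1 "real l" "real m"] by simp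
  have "W \<ge> 2 * (real l * m)" using W0 by (simp add: mult.assoc)
  then have Wm: "W - m \<ge> real l * m" "W > m" "W \<ge> real l * m" "W > 0" using lm m0 by linarith+
  note hD = h_D_wt_tail[OF m0 mR l, folded W_def Z_def]
  have set: "{n. n \<ge> 1 \<and> reg_D l x1 x2 x3 R m n} = UW - UZ"
  proof -
    have "n \<ge> 1" if "R \<le> x2 * real n" for n using that R by (cases n) auto
    then show ?thesis using m(2) by (auto simp: UW_def UZ_def Z_def reg_D_def not_le)
  qed
  have Uc: "W \<le> real n \<longleftrightarrow> R \<le> x2 * real n \<and> real m \<le> x3 * real n \<and> R + (2 * real l - 1) * real m \<le> real n" for n
    using x2 x3 by (simp add: W_def field_simps)
  have UW: "W \<le> real n" if "n \<in> UW" for n using that Uc[of n] by (simp add: UW_def)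
  have UW': "n \<in> UW" if "W < real n" for n
  proof -
    have "R + (2 * real l - 1) * real m \<le> W" by (simp add: W_def)
    then show ?thesis using that Uc[of n] by (simp add: UW_def)
  qed
  show ?thesis
  proof (cases "W < Z")
    case False
    have E: "UW - UZ = {}"
    proof -
      have "n \<in> UZ" if "n \<in> UW" for n using UW[OF that] False unfolding UZ_def by simp
      then show ?thesis by blast
    qed
    have h0: "h_D s c x2 x3 l (m / R) / m = 0" using hD False by simp
    show ?thesis unfolding set E h0 by simp
  next
    case True
    have u1: "{n \<in> UW. n mod 1 = 0 mod 1} = UW" "{n \<in> UZ. n mod 1 = 0 mod 1} = UZ" by simp_all
    note pW = wt_progression[OF s c m0 \<open>W > m\<close>, of 1 UW 0, unfolded u1]
    have sW: "(\<lambda>n. wt s c m n) summable_on UW" by (rule pW(1)) (use UW UW' in auto)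
    have bW: "\<bar>(\<Sum>\<^sub>\<infinity>n\<in>UW. wt s c m n) - wt_tail s c m W / real 1\<bar> \<le> wt s c m W" by (rule pW(2)) (use UW UW' in auto)
    have Zm: "Z > m" using True Wm by simp
    note pZ = wt_progression[OF s c m0 Zm, of 1 UZ 0, unfolded u1]
    have sZ: "(\<lambda>n. wt s c m n) summable_on UZ" by (rule pZ(1)) (auto simp: UZ_def)
    have bZ: "\<bar>(\<Sum>\<^sub>\<infinity>n\<in>UZ. wt s c m n) - wt_tail s c m Z / real 1\<bar> \<le> wt s c m Z" by (rule pZ(2)) (auto simp: UZ_def)
    have "UZ \<subseteq> UW" using UW' True by (auto simp: UZ_def)
    then have diff: "(\<Sum>\<^sub>\<infinity>n\<in>UW - UZ. wt s c m n) = (\<Sum>\<^sub>\<infinity>n\<in>UW. wt s c m n) - (\<Sum>\<^sub>\<infinity>n\<in>UZ. wt s c m n)"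
      by (rule infsum_Diff[OF sW sZ])
    have hD': "h_D s c x2 x3 l (m / R) / m = wt_tail s c m W - wt_tail s c m Z" using hD True by simp
    have small: "wt s c m v \<le> 2 / ((real l)\<^sup>2 * R\<^sup>2)" if v: "v \<ge> W" for v
    proof -
      have "R + (2 * real l - 1) * m < (2 * real l + golden) * m" using True by (simp add: W_def Z_def)
      then have "R < (1 + golden) * m" by (simp add: algebra_simps)
      also have "\<dots> \<le> 2 * real m" using g m0 by (intro mult_right_mono) auto
      finally have Rm: "R / 2 \<le> m" by simp
      have "2 * real l * m * (real l * m) \<ge> 2 * real l * (R / 2) * (real l * (R / 2))"
        using Rm l1 R by (intro mult_mono) auto
      then have lo: "(real l)\<^sup>2 * R\<^sup>2 / 2 \<le> 2 * real l * m * (real l * m)" by (simp add: power2_eq_square mult_ac)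
      have "2 * real l * m * (real l * m) \<le> v * (v - m)"
        using v W0 Wm m0 l1 by (intro mult_mono) auto
      with lo have "(real l)\<^sup>2 * R\<^sup>2 / 2 \<le> v * (v - m)" by linarith
      moreover have "(real l)\<^sup>2 * R\<^sup>2 / 2 > 0" using l1 R by simp
      ultimately have "1 / (v * (v - m)) \<le> 1 / ((real l)\<^sup>2 * R\<^sup>2 / 2)"
        using v Wm(2,4) by (intro divide_left_mono mult_pos_pos) linarith+
      then show ?thesis using wt_bounds(2)[OF s c, of m v] v Wm m0 by simp
    qed
    have "\<bar>(\<Sum>\<^sub>\<infinity>n\<in>UW - UZ. wt s c m n) - h_D s c x2 x3 l (m / R) / m\<bar> \<le> wt s c m W + wt s c m Z"
      using bW bZ unfolding diff hD' by simp
    also have "\<dots> \<le> 2 / ((real l)\<^sup>2 * R\<^sup>2) + 2 / ((real l)\<^sup>2 * R\<^sup>2)"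
      using small[of W] small[of Z] True by (intro add_mono) auto
    also have "\<dots> = 4 / ((real l)\<^sup>2 * R\<^sup>2)" unfolding add_divide_distrib[symmetric] by simp
    finally show ?thesis unfolding set .
  qed
qed

text \<open>The row ends, the passage from sum to integral and the shift of the upper end to
  \<open>x1\<close> all cost a multiple of 1 / l^2, the bound on \<open>h_D\<close>. Keeping this
  factor is what allows summation over l afterwards.\<close>

lemma D_lat_sum:
  assumes R: "R \<ge> 1" and l: "l \<ge> 1"
  shows "\<bar>lat_sum (reg_D l x1 x2 x3) (\<lambda>m n. wt s c m n) R - J_D s c x2 x3 l x1\<bar>
    \<le> 1 / (real l)\<^sup>2 * (60 * (1 + ln R)\<^sup>2 / R)"
proof -
  define K where "K = 1 / (real l)\<^sup>2"
  define L where "L = 1 + ln R"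
  define M where "M = nat \<lfloor>R\<rfloor>"
  define N where "N = nat \<lfloor>x1 * R\<rfloor>"
  define T where "T m = (\<Sum>\<^sub>\<infinity>n\<in>{n. n \<ge> 1 \<and> reg_D l x1 x2 x3 R m n}. wt s c m n)" for m :: nat
  define h where "h = h_D s c x2 x3 l"
  define J where "J = J_D s c x2 x3 l"
  note hn = h_D_nonneg[OF s c x2 x3 l] and hle = h_D_le[OF s c x2 x3 l]
  have K: "K > 0" using l by (simp add: K_def)
  have L1: "L \<ge> 1" using R by (simp add: L_def)
  then have L2: "L\<^sup>2 \<ge> L" using mult_left_mono[of 1 L L] by (simp add: power2_eq_square)
  have x1R: "x1 * R > 0" "x1 * R \<le> R" using x1 R by auto
  have Nle: "1 \<le> m \<Longrightarrow> m \<le> N \<longleftrightarrow> real m \<le> x1 * R" for m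
    using le_nat_floor_iff[of m "x1 * R"] by (simp add: N_def)
  have N1: "real N \<le> x1 * R" "x1 * R - 1 \<le> real N" using x1R unfolding N_def by linarith+
  have NM: "N \<le> M" using x1R unfolding N_def M_def by (intro nat_mono floor_mono)
  have NR: "real N \<le> R" using N1 x1R by linarith
  have "T m = 0" if "m \<in> {1..M} - {1..N}" for m
    unfolding T_def using that Nle[of m] by (intro infsum_0) (auto simp: reg_D_def)
  then have lat: "lat_sum (reg_D l x1 x2 x3) (\<lambda>m n. wt s c m n) R = (\<Sum>m\<in>{1..N}. T m)"
    unfolding lat_sum_def M_def[symmetric] T_def[symmetric] using NM by (intro sum.mono_neutral_right) auto
  have inner: "\<bar>T m - h (m / R) / m\<bar> \<le> 4 * K / R\<^sup>2" if "m \<in> {1..N}" for m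
    using D_inner[of m R l] that Nle[of m] R l by (simp add: T_def h_def K_def)
  have E1: "\<bar>(\<Sum>m\<in>{1..N}. T m) - (\<Sum>m\<in>{1..N}. h (m / R) / m)\<bar> \<le> 4 * K / R"
  proof -
    have "\<bar>(\<Sum>m\<in>{1..N}. T m) - (\<Sum>m\<in>{1..N}. h (m / R) / m)\<bar> \<le> (\<Sum>m\<in>{1..N}. 4 * K / R\<^sup>2)"
      unfolding sum_subtractf[symmetric] by (rule sum_abs[THEN order_trans], rule sum_mono) (rule inner)
    also have "\<dots> \<le> R * (4 * K / R\<^sup>2)" using NR K by (simp add: mult_right_mono divide_right_mono)
    also have "\<dots> = 4 * K / R" using R by (simp add: power2_eq_square)
    finally show ?thesis .
  qed
  have J1: "0 \<le> J x1" "J x1 \<le> K" using J_D_bounds[OF s c x2 x3 l, of x1] x1 by (auto simp: J_def K_def)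
  have main: "\<bar>(\<Sum>m\<in>{1..N}. T m) - J x1\<bar> \<le> K * (60 * L\<^sup>2 / R)"
  proof (cases "R \<ge> 4")
    case False
    have hm: "0 \<le> h (m / R) / m \<and> h (m / R) / m \<le> K" if m: "m \<in> {1..N}" for m
    proof -
      have "m / R \<le> 1" using m NR R by simp
      then have "h (m / R) \<le> K" using hle[of "m / R"] R by (simp add: h_def K_def)
      moreover have "h (m / R) / m \<le> h (m / R) / 1"
        using m hn[of "m / R"] by (intro divide_left_mono) (auto simp: h_def)
      ultimately show ?thesis using hn[of "m / R"] by (simp add: h_def)
    qed
    have "0 \<le> (\<Sum>m\<in>{1..N}. h (m / R) / m)" using hm by (intro sum_nonneg) auto
    moreover have "(\<Sum>m\<in>{1..N}. h (m / R) / m) \<le> (\<Sum>m\<in>{1..N}. K)" using hm by (intro sum_mono) auto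
    moreover have "real N * K \<le> 4 * K" using NR False K by (intro mult_right_mono) auto
    moreover have "4 * K / R \<le> 4 * K / 1" using R K by (intro divide_left_mono) auto
    ultimately have "\<bar>(\<Sum>m\<in>{1..N}. T m) - J x1\<bar> \<le> 9 * K" using E1 J1 by simp
    also have "\<dots> \<le> K * (60 * 1 / 4)" using K by simp
    also have "\<dots> \<le> K * (60 * L\<^sup>2 / R)"
      using False R K L1 L2 by (intro mult_left_mono frac_le) auto
    finally show ?thesis .
  next
    case True
    have E2: "\<bar>(\<Sum>m\<in>{1..N}. h (m / R) / m) - J (N / R)\<bar> \<le> 6 * K * L\<^sup>2 / R"
    proof (cases "N \<ge> 1")
      case False
      then have "N = 0" by simp
      then show ?thesis using J_D_half[OF s c x2 x3 l, of 0] K R by (simp add: J_def)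
    next
      case N: True
      have "\<bar>(\<Sum>m\<in>{1..N}. h (m / R) / m) - (J (N / R) - J (1 / R))\<bar> \<le> 3 * (2 * K / R) * (1 + ln N)"
      proof (rule outer_sum)
        show "R > 0" "N \<ge> 1" using R N by auto
        have "N / R \<le> 1" using NR R by simp
        then show "(b - a) * h a / b \<le> J b - J a \<and> J b - J a \<le> (b - a) * h b / a" if "0 < a" "a \<le> b" "b \<le> N / R" for a b
          using J_D_increment[OF s c x2 x3 l, of a b] that by (auto simp: J_def h_def)
        fix m :: nat assume m: "1 \<le> m" "m \<le> N"
        have y: "0 \<le> m / R" "m / R \<le> 1" using m NR R by auto
        have "h (m / R) \<le> 2 * K * (m / R)"
        proof (cases "m / R \<le> 1 / 2")
          case True
          then have "h (m / R) = 0" using h_D_half[OF s c x2 x3 l y(1)] by (simp add: h_def)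
          moreover have "0 \<le> 2 * K * (m / R)" using K y(1) by (intro mult_nonneg_nonneg) auto
          ultimately show ?thesis by simp
        next
          case False
          have "h (m / R) \<le> K * 1" using hle[OF y] by (simp add: h_def K_def)
          also have "\<dots> \<le> K * (2 * (m / R))" using False K by (intro mult_left_mono) linarith+
          also have "\<dots> = 2 * K * (m / R)" by simp
          finally show ?thesis .
        qed
        then show "0 \<le> h (m / R) \<and> h (m / R) \<le> 2 * K / R * m" using hn[of "m / R"] by (simp add: h_def)
      qed
      also have "\<dots> \<le> 3 * (2 * K / R) * L"
        unfolding L_def using N NR R K by (intro mult_left_mono add_left_mono ln_mono) auto
      also have "\<dots> = 6 * K / R * L" by simp
      also have "\<dots> \<le> 6 * K / R * L\<^sup>2" using L2 K R by (intro mult_left_mono) auto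
      also have "\<dots> = 6 * K * L\<^sup>2 / R" by simp
      finally show ?thesis using J_D_half[OF s c x2 x3 l, of "1 / R"] True by (simp add: J_def)
    qed
    \<comment> \<open>For x1 \<le> 1 / 2 both values vanish. Otherwise R \<ge> 4 gives N / R \<ge> 1
      / 4, and dividing by N / R in the increment bound costs the factor 4.\<close>
    have E3: "\<bar>J x1 - J (N / R)\<bar> \<le> 4 * K / R"
    proof (cases "x1 \<le> 1 / 2")
      case True
      have "N / R \<le> x1" using N1 R by (simp add: pos_divide_le_eq)
      then have "N / R \<le> 1 / 2" "0 \<le> N / R" using True R by (linarith, simp)
      then have "J (N / R) = 0" "J x1 = 0"
        using J_D_half[OF s c x2 x3 l, of x1] J_D_half[OF s c x2 x3 l, of "N / R"] True x1 by (simp_all add: J_def)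
      moreover have "0 \<le> 4 * K / R" using K R by (intro divide_nonneg_nonneg) auto
      ultimately show ?thesis by simp
    next
      case False
      have "(x1 * R - 1) / R \<le> N / R" using N1 R by (intro divide_right_mono) auto
      moreover have "(x1 * R - 1) / R = x1 - 1 / R" using R by (simp add: diff_divide_distrib)
      ultimately have a: "x1 - 1 / R \<le> N / R" "N / R \<le> x1" using N1 R by (simp_all add: pos_divide_le_eq)
      have "1 / R \<le> 1 / 4" using True by simp
      then have a4: "N / R \<ge> 1 / 4" using a False by linarith
      have NR0: "0 < N / R" using a4 by linarith
      note inc = J_D_increment[OF s c x2 x3 l NR0 a(2) x1(2), folded J_def h_def]
      have "0 \<le> (x1 - N / R) * h (N / R) / x1"
        using a(2) x1 hn[of "N / R"] by (intro divide_nonneg_nonneg mult_nonneg_nonneg) (auto simp: h_def)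
      with inc have "J x1 - J (N / R) \<le> (x1 - N / R) * h x1 / (N / R)" "0 \<le> J x1 - J (N / R)" by linarith+
      moreover have "(x1 - N / R) * h x1 / (N / R) \<le> (1 / R) * K / (1 / 4)"
      proof (rule frac_le)
        have "h x1 \<le> K" "0 \<le> h x1" using hn[of x1] hle[of x1] x1 by (auto simp: h_def K_def)
        then show "(x1 - N / R) * h x1 \<le> (1 / R) * K" using a(1) R by (intro mult_mono) auto
        show "0 \<le> (1 / R) * K" using R K by (intro mult_nonneg_nonneg) auto
      qed (use a4 in auto)
      moreover have "(1 / R) * K / (1 / 4) = 4 * K / R" by simp
      ultimately show ?thesis by linarith
    qed
    have "\<bar>(\<Sum>m\<in>{1..N}. T m) - J x1\<bar> \<le> 4 * K / R + 6 * K * L\<^sup>2 / R + 4 * K / R"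
      using E1 E2 E3 by linarith
    also have "\<dots> = (8 + 6 * L\<^sup>2) * K / R" by (simp add: algebra_simps add_divide_distrib)
    also have "\<dots> \<le> (60 * L\<^sup>2) * K / R" using L1 L2 K R by (intro divide_right_mono mult_right_mono) auto
    finally show ?thesis by (simp add: mult_ac)
  qed
  then show ?thesis unfolding lat by (simp add: K_def L_def J_def)
qed

text \<open>The wedges are disjoint. As m \<le> R, a point of wedge j has n > R + (2 j - 1) m \<ge>
  2 j m, whereas a point of wedge i < j has n < (2 i + g) m < 2 j m. Each row of the union is thus a
  disjoint union, and its convergent sum splits over l.\<close>

lemma bad_lat_sums:
  assumes R: "R \<ge> 1" and l0: "l0 \<ge> 1"
  shows "(\<lambda>i. lat_sum (reg_D (i + l0) x1 x2 x3) (\<lambda>m n. wt s c m n) R) sums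
    lat_sum (\<lambda>R m n. \<exists>l\<ge>l0. reg_D l x1 x2 x3 R m n) (\<lambda>m n. wt s c m n) R"
  unfolding lat_sum_def
proof (rule sums_sum)
  fix m assume m: "m \<in> {1..nat \<lfloor>R\<rfloor>}"
  define N where "N i = {n. n \<ge> 1 \<and> reg_D (i + l0) x1 x2 x3 R m n}" for i
  define B where "B = {n. n \<ge> 1 \<and> (\<exists>l\<ge>l0. reg_D l x1 x2 x3 R m n)}"
  define f where "f n = wt s c (real m) (real n)" for n :: nat
  have m1: "m \<ge> 1" "real m \<le> R" using m le_nat_floor_iff[of m R] by auto
  have nm: "m < n" if "n \<in> B" for n
  proof -
    obtain l where "l \<ge> l0" "reg_D l x1 x2 x3 R m n" using \<open>n \<in> B\<close> by (auto simp: B_def)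
    then show ?thesis using reg_D_ne[of l R x1 x2 x3 m n] R l0 by linarith
  qed
  have fB: "f summable_on B" unfolding f_def by (rule wt_ray_infsum(1)[OF s c m1(1) nm])
  have NB: "B = (\<Union>i. N i)"
  proof (intro equalityI subsetI)
    fix n assume "n \<in> B"
    then obtain l where l: "l \<ge> l0" "n \<ge> 1" "reg_D l x1 x2 x3 R m n" by (auto simp: B_def)
    then have "n \<in> N (l - l0)" by (simp add: N_def)
    then show "n \<in> (\<Union>i. N i)" by blast
  next
    fix n assume "n \<in> (\<Union>i. N i)"
    then obtain i where "n \<ge> 1" "reg_D (i + l0) x1 x2 x3 R m n" by (auto simp: N_def)
    then show "n \<in> B" unfolding B_def by (intro CollectI conjI exI[of _ "i + l0"]) auto
  qed
  have disj: "i = j" if "n \<in> N i" "n \<in> N j" for i j n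
  proof (rule ccontr)
    have *: False if "n \<in> N i" "n \<in> N j" "i < j" for i j
    proof -
      have "real n < (2 * real (i + l0) + golden) * real m" "R + (2 * real (j + l0) - 1) * real m < real n"
        using that by (auto simp: N_def reg_D_def)
      moreover have "(2 * real (i + l0) + golden) * real m \<le> (2 * real (j + l0) - 1 + 1) * real m"
      proof (rule mult_right_mono)
        have "real i + 1 \<le> real j" using that by simp
        then show "2 * real (i + l0) + golden \<le> 2 * real (j + l0) - 1 + 1" using golden_bounds(2) by simp
      qed simp
      moreover have "(2 * real (j + l0) - 1 + 1) * real m = (2 * real (j + l0) - 1) * real m + real m" by (simp add: algebra_simps)
      ultimately show False using m1 by linarith
    qed
    assume "i \<noteq> j"
    then consider "i < j" | "j < i" by linarith
    then show False using * that by cases auto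
  qed
  have "inj_on snd (Sigma UNIV N)" using disj by (auto simp: inj_on_def)
  moreover have "snd ` Sigma UNIV N = B" unfolding NB by force
  ultimately have "((f \<circ> snd) has_sum infsum f B) (Sigma UNIV N)"
    using has_sum_reindex[of snd "Sigma UNIV N" f] has_sum_infsum[OF fB] by simp
  then have "((\<lambda>i. infsum f (N i)) has_sum infsum f B) UNIV"
  proof (rule has_sum_SigmaD)
    fix i :: nat
    have "f summable_on N i" by (rule summable_on_subset_banach[OF fB]) (auto simp: NB)
    then show "((\<lambda>y. (f \<circ> snd) (i, y)) has_sum infsum f (N i)) (N i)" by (simp add: has_sum_infsum)
  qed
  then show "(\<lambda>i. \<Sum>\<^sub>\<infinity>n\<in>{n. n \<ge> 1 \<and> reg_D (i + l0) x1 x2 x3 R m n}. wt s c (real m) (real n)) sums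
      (\<Sum>\<^sub>\<infinity>n\<in>{n. n \<ge> 1 \<and> (\<exists>l\<ge>l0. reg_D l x1 x2 x3 R m n)}. wt s c (real m) (real n))"
    unfolding f_def N_def B_def by (rule has_sum_imp_sums)
qed

lemma inverse_squares_shift:
  assumes "l0 \<ge> 1"
  shows "summable (\<lambda>i. 1 / (real (i + l0))\<^sup>2)" "(\<Sum>i. 1 / (real (i + l0))\<^sup>2) \<le> 2"
proof -
  have le: "1 / (real (i + l0))\<^sup>2 \<le> 1 / (real (Suc i))\<^sup>2" for i
    using assms by (intro divide_left_mono power_mono) auto
  have s1: "(\<lambda>i. 1 / (real (Suc i))\<^sup>2) sums (pi\<^sup>2 / 6)" using inverse_squares_sums by simp
  show sm: "summable (\<lambda>i. 1 / (real (i + l0))\<^sup>2)"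
    by (rule summable_comparison_test[OF _ sums_summable[OF s1]]) (use le in auto)
  have "(\<Sum>i. 1 / (real (i + l0))\<^sup>2) \<le> (\<Sum>i. 1 / (real (Suc i))\<^sup>2)"
    by (rule suminf_le[OF le sm sums_summable[OF s1]])
  also have "\<dots> = pi\<^sup>2 / 6" using s1 by (rule sums_unique[symmetric])
  also have "\<dots> \<le> 2"
  proof -
    have "pi < 3.2" using pi_less_4 pi_approx by simp
    then have "pi * pi \<le> 3.2 * 3.2" by (intro mult_mono) auto
    then show ?thesis by (simp add: power2_eq_square)
  qed
  finally show "(\<Sum>i. 1 / (real (i + l0))\<^sup>2) \<le> 2" .
qed

lemma D_total_summable: "l0 \<ge> 1 \<Longrightarrow> summable (\<lambda>i. J_D s c x2 x3 (i + l0) x1)"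
proof (rule summable_comparison_test[OF _ inverse_squares_shift(1)], intro exI[of _ 0] allI impI)
  fix i assume "l0 \<ge> 1"
  then have "i + l0 \<ge> 1" by simp
  then show "norm (J_D s c x2 x3 (i + l0) x1) \<le> 1 / (real (i + l0))\<^sup>2"
    using J_D_bounds[OF s c x2 x3 \<open>i + l0 \<ge> 1\<close> less_imp_le[OF x1(1)] x1(2)] by (simp only: real_norm_def abs_of_nonneg)
qed

lemma D_total_bounds:
  assumes "l0 \<ge> 1"
  shows "0 \<le> D_total s c x1 x2 x3 l0" "D_total s c x1 x2 x3 l0 \<le> 2"
proof -
  have b: "0 \<le> J_D s c x2 x3 (i + l0) x1" "J_D s c x2 x3 (i + l0) x1 \<le> 1 / (real (i + l0))\<^sup>2" for i
  proof -
    have "i + l0 \<ge> 1" "0 \<le> x1" using assms x1 by simp_all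
    from J_D_bounds[OF s c x2 x3 this x1(2)]
    show "0 \<le> J_D s c x2 x3 (i + l0) x1" "J_D s c x2 x3 (i + l0) x1 \<le> 1 / (real (i + l0))\<^sup>2" .
  qed
  show "0 \<le> D_total s c x1 x2 x3 l0" unfolding D_total_def by (rule suminf_nonneg[OF D_total_summable[OF assms] b(1)])
  have "D_total s c x1 x2 x3 l0 \<le> (\<Sum>i. 1 / (real (i + l0))\<^sup>2)"
    unfolding D_total_def by (rule suminf_le[OF b(2) D_total_summable[OF assms] inverse_squares_shift(1)[OF assms]])
  with inverse_squares_shift(2)[OF assms] show "D_total s c x1 x2 x3 l0 \<le> 2" by linarith
qed

lemma bad_lat_sum_asymp:
  assumes R: "R \<ge> 1" and l0: "l0 \<ge> 1"
  shows "\<bar>lat_sum (\<lambda>R m n. \<exists>l\<ge>l0. reg_D l x1 x2 x3 R m n) (\<lambda>m n. wt s c m n) R - D_total s c x1 x2 x3 l0\<bar>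
    \<le> 120 * (1 + ln R)\<^sup>2 / R"
proof -
  define E where "E = 60 * (1 + ln R)\<^sup>2 / R"
  have E: "E \<ge> 0" using R by (simp add: E_def)
  let ?S = "\<lambda>i. lat_sum (reg_D (i + l0) x1 x2 x3) (\<lambda>m n. wt s c m n) R"
  let ?J = "\<lambda>i. J_D s c x2 x3 (i + l0) x1"
  note S = bad_lat_sums[OF R l0] and J = D_total_summable[OF l0] and Q = inverse_squares_shift[OF l0]
  have d: "\<bar>?S i - ?J i\<bar> \<le> 1 / (real (i + l0))\<^sup>2 * E" for i
    using D_lat_sum[OF R, of "i + l0"] l0 by (simp add: E_def)
  have sQ: "summable (\<lambda>i. 1 / (real (i + l0))\<^sup>2 * E)" by (rule summable_mult2[OF Q(1)])
  have sa: "summable (\<lambda>i. \<bar>?S i - ?J i\<bar>)"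
  proof (rule summable_comparison_test[OF _ sQ], intro exI[of _ 0] allI impI)
    fix i show "norm \<bar>?S i - ?J i\<bar> \<le> 1 / (real (i + l0))\<^sup>2 * E" using d[of i] by (simp only: real_norm_def abs_idempotent)
  qed
  have eq: "lat_sum (\<lambda>R m n. \<exists>l\<ge>l0. reg_D l x1 x2 x3 R m n) (\<lambda>m n. wt s c m n) R - D_total s c x1 x2 x3 l0 = (\<Sum>i. ?S i - ?J i)"
    unfolding D_total_def sums_unique[OF S] by (rule suminf_diff[OF sums_summable[OF S] J])
  have "\<bar>\<Sum>i. ?S i - ?J i\<bar> \<le> (\<Sum>i. \<bar>?S i - ?J i\<bar>)" by (rule summable_rabs[OF sa])
  also have "\<dots> \<le> (\<Sum>i. 1 / (real (i + l0))\<^sup>2 * E)" by (rule suminf_le[OF d sa sQ])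
  also have "\<dots> = (\<Sum>i. 1 / (real (i + l0))\<^sup>2) * E" by (rule suminf_mult2[OF Q(1), symmetric])
  also have "\<dots> \<le> 2 * E" using Q(2) E by (rule mult_right_mono)
  finally show ?thesis unfolding eq by (simp add: E_def)
qed

text \<open>Every wedge lies inside \<open>reg_F 1\<close>, since its points satisfy R < n, so
  discarding the wedges subtracts one summable family from another. The constant is 144 = 24 +
  120.\<close>

lemma reg_O_lat_sum:
  assumes R: "R \<ge> 1" and l0: "l0 \<ge> 1"
  shows "\<bar>lat_sum (reg_O x1 x2 x3 l0) (\<lambda>m n. wt s c m n) R - (F_sgn s c x2 x3 x1 - D_total s c x1 x2 x3 l0)\<bar> \<le> 144 * (1 + ln R)\<^sup>2 / R"
proof -
  let ?B = "\<lambda>R m n. \<exists>l\<ge>l0. reg_D l x1 x2 x3 R m n"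
  let ?f = "\<lambda>m n. wt s c (real m) (real n)"
  have "lat_sum (reg_O x1 x2 x3 l0) ?f R = lat_sum (reg_F 1 x1 x2 x3) ?f R - lat_sum ?B ?f R"
    unfolding lat_sum_def sum_subtractf[symmetric]
  proof (intro sum.cong refl)
    fix m assume m: "m \<in> {1..nat \<lfloor>R\<rfloor>}"
    then have m1: "m \<ge> 1" "real m \<le> R" using le_nat_floor_iff[of m R] by auto
    let ?F = "{n. n \<ge> 1 \<and> reg_F 1 x1 x2 x3 R m n}" and ?G = "{n. n \<ge> 1 \<and> ?B R m n}"
    have lt: "m < n" if "n \<in> ?F" for n
    proof -
      have "real m < real n" using that m1 unfolding reg_F_def by auto
      then show ?thesis by simp
    qed
    have sub: "?G \<subseteq> ?F"
    proof
      fix n assume "n \<in> ?G"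
      then obtain l where l: "l \<ge> l0" "reg_D l x1 x2 x3 R m n" "n \<ge> 1" by auto
      then have "R < real n" using reg_D_ne[of l R x1 x2 x3 m n] R l0 by auto
      then show "n \<in> ?F" using l by (auto simp: reg_F_def reg_D_def)
    qed
    have sF: "?f m summable_on ?F" using lt by (rule wt_ray_infsum(1)[OF s c m1(1)])
    have sG: "?f m summable_on ?G" using sub by (rule summable_on_subset_banach[OF sF])
    have "{n. n \<ge> 1 \<and> reg_O x1 x2 x3 l0 R m n} = ?F - ?G" by (auto simp: reg_O_def)
    then show "infsum (?f m) {n. n \<ge> 1 \<and> reg_O x1 x2 x3 l0 R m n} = infsum (?f m) ?F - infsum (?f m) ?G"
      using infsum_Diff[OF sF sG sub] by simp
  qed
  moreover have "\<bar>lat_sum (reg_F 1 x1 x2 x3) ?f R - F_sgn s c x2 x3 x1\<bar> \<le> 24 * (1 + ln R)\<^sup>2 / R"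
    using F_lat_sum[OF s c x1 x2 x3 le_refl R] by simp
  moreover note bad_lat_sum_asymp[OF R l0]
  moreover have "144 * (1 + ln R)\<^sup>2 / R = 24 * (1 + ln R)\<^sup>2 / R + 120 * (1 + ln R)\<^sup>2 / R"
    by (simp add: add_divide_distrib[symmetric])
  ultimately show ?thesis by linarith
qed

end

section \<open>The integrals of the wedges\<close>

context
  fixes s :: int and c x1 x2 x3 :: real and l :: nat
  assumes s: "s = 1 \<or> s = -1" and c: "0 < c" "c \<le> 1" and x1: "0 < x1" "x1 \<le> 1"
    and x2: "0 < x2" "x2 \<le> 1" and x3: "0 < x3" "x3 \<le> 1" and l: "l \<ge> 1"
begin

text \<open>In the inner interval the constraint \<open>y \<le> x / (2 l)\<close> follows from
  \<open>y \<le> (x - 1) / (2 l - 1)\<close> and \<open>y \<le> x1 \<le> 1\<close>, so for fixed \<open>y\<close> the variable \<open>x\<close> ranges over an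
  interval with the endpoints occurring in \<open>h_D_wt_tail\<close> for \<open>R = 1\<close>.\<close>

lemma I_eq_J_D:
  "integral {1 / x2..A_bound x1 l} (\<lambda>x. integral {x / (2 * real l + golden)..B_bound x1 x3 l x} (\<lambda>y. wt s c y x))
    = J_D s c x2 x3 l x1"
proof -
  have l1: "real l \<ge> 1" using l by simp
  note g = golden_bounds
  define z where "z = 2 * real l + golden"
  have z2: "z > 2" using l1 g by (simp add: z_def)
  define P where "P x y \<longleftrightarrow> 1 / x2 \<le> x \<and> x \<le> z * x1 \<and> x / z \<le> y \<and> y \<le> x3 * x \<and> y \<le> x1
    \<and> y \<le> x / (2 * real l) \<and> y \<le> (x - 1) / (2 * real l - 1)" for x y
  define f where "f = (\<lambda>(x, y). if P x y then ennreal (wt s c y x) else 0)"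
  have x21: "1 / x2 \<ge> 1" using x2 by simp
  have P_pos: "0 < y \<and> y < x \<and> 1 \<le> x" if "P x y" for x y
  proof -
    have "1 \<le> x" using that x21 unfolding P_def by linarith
    moreover have "x / z > 0" using \<open>1 \<le> x\<close> z2 by simp
    moreover have "x / (2 * real l) < x" using \<open>1 \<le> x\<close> l1 by (simp add: divide_less_eq)
    ultimately show ?thesis using that unfolding P_def by linarith
  qed
  have meas: "f \<in> borel_measurable (lborel \<Otimes>\<^sub>M lborel)"
    unfolding f_def P_def wt_def by measurable
  have B: "B_bound x1 x3 l x = min (x3 * x) (min x1 (min (x / (2 * real l)) ((x - 1) / (2 * real l - 1))))" for x
    by (simp add: B_bound_def)
  define G where "G x = (if x \<in> {1 / x2..z * x1} then integral {x / z..B_bound x1 x3 l x} (\<lambda>y. wt s c y x) else 0)" for x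
  have inner_y: "(\<integral>\<^sup>+ y. f (x, y) \<partial>lborel) = ennreal (G x)" "0 \<le> G x" for x
  proof -
    have "(\<integral>\<^sup>+ y. f (x, y) \<partial>lborel) = ennreal (G x) \<and> 0 \<le> G x"
    proof (cases "x \<in> {1 / x2..z * x1}")
      case False
      then have "\<not> P x y" for y by (auto simp: P_def)
      then have "f (x, y) = 0" for y by (simp add: f_def)
      moreover have "G x = 0" unfolding G_def using False by (rule if_not_P)
      ultimately show ?thesis by simp
    next
      case True
      define I where "I = {x / z..B_bound x1 x3 l x}"
      have PI: "P x y \<longleftrightarrow> y \<in> I" for y using True by (auto simp: P_def I_def B)
      have pos: "x + of_int s * c * y > 0" "x > 0" if "y \<in> I" for y
        using P_pos[of x y] PI[of y] that wt_pos[OF s c, of y x] by auto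
      have cont: "continuous_on I (\<lambda>y. wt s c y x)"
        unfolding wt_def using pos by (intro continuous_intros) (auto simp: less_imp_neq[symmetric])
      have nn: "0 \<le> wt s c y x" if "y \<in> I" for y
        unfolding wt_def using pos[OF that] c by (intro divide_nonneg_nonneg mult_nonneg_nonneg) auto
      have hi: "((\<lambda>y. wt s c y x) has_integral G x) I"
        using integrable_continuous_interval[OF cont[unfolded I_def]] True
        by (simp add: G_def I_def integrable_integral)
      have "(\<integral>\<^sup>+ y. f (x, y) \<partial>lborel) = (\<integral>\<^sup>+ y. ennreal (wt s c y x) * indicator I y \<partial>lborel)"
        by (intro nn_integral_cong) (simp add: f_def PI indicator_def)
      also have "\<dots> = ennreal (G x)" by (rule nn_integral_has_integral_lebesgue'[OF nn hi])
      finally show ?thesis using has_integral_nonneg[OF hi nn] by simp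
    qed
    then show "(\<integral>\<^sup>+ y. f (x, y) \<partial>lborel) = ennreal (G x)" "0 \<le> G x" by auto
  qed
  have inner_x: "(\<integral>\<^sup>+ x. f (x, y) \<partial>lborel) = ennreal (h_D s c x2 x3 l y / y) * indicator {0..x1} y" for y
  proof (cases "0 < y \<and> y \<le> x1")
    case False
    then have "\<not> P x y" for x using P_pos[of x y] by (auto simp: P_def)
    moreover have "ennreal (h_D s c x2 x3 l y / y) * indicator {0..x1} y = 0"
      using False by (cases "y = 0") (auto simp: indicator_def)
    ultimately show ?thesis by (simp add: f_def)
  next
    case True
    define W where "W = max (max (1 / x2) (y / x3)) (1 + (2 * real l - 1) * y)"
    define Z where "Z = z * y"
    have y1: "0 < y" "y \<le> 1" using True x1 by auto
    have h: "h_D s c x2 x3 l y / y = (if W < Z then wt_tail s c y W - wt_tail s c y Z else 0)"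
      using h_D_wt_tail[OF s c x1 x2 x3 y1 l] unfolding W_def Z_def z_def by simp
    have W2: "W \<ge> 2 * real l * y"
    proof -
      have "2 * real l * y \<le> 1 + (2 * real l - 1) * y" using y1 by (simp add: algebra_simps)
      then show ?thesis by (simp add: W_def)
    qed
    have "2 * real l * y \<ge> 2 * y" using l1 y1 by (intro mult_right_mono) auto
    then have Wy: "y < W" using W2 y1 by linarith
    have PI: "P x y \<longleftrightarrow> x \<in> {W..Z}" for x
    proof -
      have 1: "x / z \<le> y \<longleftrightarrow> x \<le> Z" using z2 by (simp add: Z_def pos_divide_le_eq mult.commute)
      have 2: "y \<le> x3 * x \<longleftrightarrow> y / x3 \<le> x" using x3 by (simp add: pos_divide_le_eq mult.commute)
      have 3: "y \<le> (x - 1) / (2 * real l - 1) \<longleftrightarrow> 1 + (2 * real l - 1) * y \<le> x"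
        using l1 by (simp add: pos_le_divide_eq) (simp add: algebra_simps)
      have 4: "y \<le> x / (2 * real l) \<longleftrightarrow> 2 * real l * y \<le> x" using l1 by (simp add: pos_le_divide_eq mult.commute)
      have 5: "Z \<le> z * x1" using True z2 by (simp add: Z_def)
      show ?thesis unfolding P_def 1 2 3 4 using 5 True W2 by (auto simp: W_def)
    qed
    have nn: "0 \<le> wt s c y x" if "x \<in> {W..Z}" for x
      using wt_bounds(1)[OF s c, of y x] that Wy y1 by auto
    have "(\<integral>\<^sup>+ x. f (x, y) \<partial>lborel) = (\<integral>\<^sup>+ x. ennreal (wt s c y x) * indicator {W..Z} x \<partial>lborel)"
      by (intro nn_integral_cong) (simp add: f_def PI indicator_def)
    also have "\<dots> = ennreal (h_D s c x2 x3 l y / y)"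
    proof (cases "W < Z")
      case True
      have "((\<lambda>x. wt s c y x) has_integral (- wt_tail s c y Z) - (- wt_tail s c y W)) {W..Z}"
      proof (rule fundamental_theorem_of_calculus)
        fix x assume "x \<in> {W..Z}"
        then have "y < x" using Wy by auto
        from DERIV_minus[OF wt_tail_has_derivative[OF s c y1(1) this]]
        have "((\<lambda>x. - wt_tail s c y x) has_real_derivative wt s c y x) (at x within {W..Z})"
          by (simp add: has_field_derivative_at_within)
        then show "((\<lambda>x. - wt_tail s c y x) has_vector_derivative wt s c y x) (at x within {W..Z})"
          by (simp add: has_real_derivative_iff_has_vector_derivative)
      qed (use True in simp)
      then have hi: "((\<lambda>x. wt s c y x) has_integral (h_D s c x2 x3 l y / y)) {W..Z}" using True h by simp
      show ?thesis by (rule nn_integral_has_integral_lebesgue'[OF nn hi])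
    next
      \<comment> \<open>The interval {W..Z} contains at most the point W and is null, in agreement
        with the vanishing of \<open>h_D\<close>.\<close>
      case False
      have "(\<integral>\<^sup>+ x. ennreal (wt s c y x) * indicator {W..Z} x \<partial>lborel) = (\<integral>\<^sup>+ x. ennreal (wt s c y x) * indicator {W..Z} x * indicator {W..W} x \<partial>lborel)"
        using False by (intro nn_integral_cong) (auto simp: indicator_def)
      also have "\<dots> = 0"
        by (rule nn_integral_null_set) (simp add: finite_imp_null_set_lborel)
      finally show ?thesis unfolding h using False by simp
    qed
    finally show ?thesis using True by simp
  qed
  have "((\<lambda>y. h_D s c x2 x3 l y / y) has_integral J_D s c x2 x3 l x1) {0..x1}"
    unfolding J_D_def using h_D_integrable[OF s c x2 x3 l order_refl x1(2)] by (rule integrable_integral)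
  then have J: "(\<integral>\<^sup>+ y. ennreal (h_D s c x2 x3 l y / y) * indicator {0..x1} y \<partial>lborel) = ennreal (J_D s c x2 x3 l x1)"
    by (rule nn_integral_has_integral_lebesgue'[rotated]) (use h_D_nonneg[OF s c x2 x3 l] in auto)
  have "(\<integral>\<^sup>+ x. \<integral>\<^sup>+ y. f (x, y) \<partial>lborel \<partial>lborel) = (\<integral>\<^sup>+ y. \<integral>\<^sup>+ x. f (x, y) \<partial>lborel \<partial>lborel)"
    using lborel_pair.Fubini'[of "\<lambda>x y. f (x, y)"] meas by simp
  then have tot: "(\<integral>\<^sup>+ x. ennreal (G x) \<partial>lborel) = ennreal (J_D s c x2 x3 l x1)"
    unfolding inner_y inner_x J .
  \<comment> \<open>Measurability of \<open>G\<close> is read off from the inner integral of the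
    jointly measurable \<open>f\<close>, instead of being derived from the moving bounds of
    integration.\<close>
  have "(\<lambda>x. \<integral>\<^sup>+ y. f (x, y) \<partial>lborel) \<in> borel_measurable lborel"
    by (rule lborel.borel_measurable_nn_integral) (use meas in simp)
  then have "(\<lambda>x. enn2real (ennreal (G x))) \<in> borel_measurable lborel"
    unfolding inner_y by (rule borel_measurable_enn2real)
  then have "G \<in> borel_measurable borel" using inner_y(2) by simp
  from nn_integral_has_integral[OF this inner_y(2) tot]
  have "(G has_integral J_D s c x2 x3 l x1) UNIV"
    using J_D_bounds(1)[OF s c x2 x3 l, of x1] x1 by simp
  then have "((\<lambda>x. integral {x / z..B_bound x1 x3 l x} (\<lambda>y. wt s c y x)) has_integral J_D s c x2 x3 l x1) {1 / x2..z * x1}"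
    unfolding G_def by (subst (asm) has_integral_restrict_UNIV)
  then show ?thesis unfolding z_def A_bound_def by (rule integral_unique)
qed

end

lemma I_plus_eq:
  assumes "0 < x4" "x4 \<le> 1" "0 < x1" "x1 \<le> 1" "0 < x2" "x2 \<le> 1" "0 < x3" "x3 \<le> 1" "l \<ge> 1"
  shows "I_plus x1 x2 x3 x4 l = J_D 1 x4 x2 x3 l x1"
  using I_eq_J_D[of 1 x4 x1 x2 x3 l] assms by (simp add: I_plus_def wt_def)

lemma I_minus_eq:
  assumes "0 < x4" "x4 \<le> 1" "0 < x1" "x1 \<le> 1" "0 < x2" "x2 \<le> 1" "0 < x3" "x3 \<le> 1" "l \<ge> 1"
  shows "I_minus x1 x2 x3 x4 l = J_D (-1) x4 x2 x3 l x1"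
  using I_eq_J_D[of "-1" x4 x1 x2 x3 l] assms by (simp add: I_minus_def wt_def)

lemma D1_eq:
  assumes "0 < x4" "x4 \<le> 1" "0 < x1" "x1 \<le> 1" "0 < x2" "x2 \<le> 1" "0 < x3" "x3 \<le> 1"
  shows "D1 x1 x2 x3 x4 = D_total 1 x4 x1 x2 x3 1"
  unfolding D1_def D_total_def using I_plus_eq[OF assms] by simp

lemma D3_eq:
  assumes "0 < x4" "x4 \<le> 1" "0 < x1" "x1 \<le> 1" "0 < x2" "x2 \<le> 1" "0 < x3" "x3 \<le> 1"
  shows "D3 x1 x2 x3 x4 = D_total (-1) x4 x1 x2 x3 2"
  unfolding D3_def D_total_def using I_minus_eq[OF assms] by simp

section \<open>Renewal pairs and the two measures\<close>

text \<open>Countable additivity over n within a row, finite additivity over the rows m \<le> R;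
  pairs that are not admissible contribute the empty set. Disjointness has to come from
  \<open>P\<close>, because one x has infinitely many pairs of successive denominators.\<close>

lemma (in parity_cf) gap_union_measure:
  assumes s: "s = 1 \<or> s = -1" and c: "0 < c" "c \<le> 1"
    and P: "\<And>m n. P m n \<Longrightarrow> 1 \<le> m \<and> real m \<le> R \<and> 1 \<le> n"
    and disj: "\<And>x m n m' n'. P m n \<Longrightarrow> P m' n' \<Longrightarrow> x \<in> gap_set s c (int m) (int n) \<Longrightarrow>
       x \<in> gap_set s c (int m') (int n') \<Longrightarrow> m = m' \<and> n = n'"
  shows "(\<Union>(m, n)\<in>{(m, n). P m n}. gap_set s c (int m) (int n)) \<in> lmeasurable"
    and "measure lebesgue (\<Union>(m, n)\<in>{(m, n). P m n}. gap_set s c (int m) (int n))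
      = lat_sum (\<lambda>R m n. P m n \<and> admissible s (int m) (int n)) (\<lambda>m n. wt s c m n) R"
proof -
  define A where "A m n = (if P m n then gap_set s c (int m) (int n) else {})" for m n
  define M where "M = nat \<lfloor>R\<rfloor>"
  have Am: "A m n \<in> lmeasurable" for m n
    unfolding A_def using gap_set_measure(1)[OF s c] by (cases "P m n") simp_all
  have sub: "A m n \<subseteq> {0..1}" for m n
    unfolding A_def gap_set_def Omega_def by auto
  have dis: "m = m' \<and> n = n'" if "x \<in> A m n" "x \<in> A m' n'" for x m n m' n'
    using that disj[of m n m' n' x] unfolding A_def by (auto split: if_splits)
  have lm: "B \<in> lmeasurable" if "B \<in> sets lebesgue" "B \<subseteq> {0..1::real}" for B
    by (rule fmeasurableI2[OF _ that(2,1)]) simp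
  define U where "U m = (\<Union>n. A m n)" for m
  have U: "U m \<in> lmeasurable" for m
    unfolding U_def
  proof (rule lm)
    show "(\<Union>n. A m n) \<in> sets lebesgue" using Am by (intro sets.countable_UN) (auto simp: fmeasurableD)
  qed (intro UN_least sub)
  have "(\<lambda>n. measure lebesgue (A m n)) sums measure lebesgue (U m)" for m
    unfolding U_def
  proof (rule measure_UNION)
    show "range (A m) \<subseteq> sets lebesgue" using Am by (auto simp: fmeasurableD)
    show "disjoint_family (A m)" unfolding disjoint_family_on_def
    proof (intro ballI impI equals0I)
      fix n n' x assume "n \<noteq> n'" "x \<in> A m n \<inter> A m n'"
      with dis[of x m n m n'] show False by simp
    qed
    show "emeasure lebesgue (\<Union> (range (A m))) \<noteq> \<infinity>"
      using fmeasurableD2[OF U[of m]] unfolding U_def by simp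
  qed
  then have "((\<lambda>n. measure lebesgue (A m n)) has_sum measure lebesgue (U m)) UNIV" for m
    by (rule sums_nonneg_imp_has_sum) simp
  note mU1 = infsumI[OF this, symmetric]
  have mU2: "(\<Sum>\<^sub>\<infinity>n. measure lebesgue (A m n))
      = (\<Sum>\<^sub>\<infinity>n\<in>{n. n \<ge> 1 \<and> P m n \<and> admissible s (int m) (int n)}. wt s c m n)" for m
    using P by (intro infsum_cong_neutral) (auto simp: A_def gap_set_measure(2)[OF s c] wt_def split: if_splits)
  have mU: "measure lebesgue (U m) = (\<Sum>\<^sub>\<infinity>n\<in>{n. n \<ge> 1 \<and> P m n \<and> admissible s (int m) (int n)}. wt s c m n)" for m
    unfolding mU1 mU2 ..
  have eq: "(\<Union>(m, n)\<in>{(m, n). P m n}. gap_set s c (int m) (int n)) = (\<Union>m\<in>{1..M}. U m)"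
  proof (intro equalityI subsetI)
    fix x assume "x \<in> (\<Union>(m, n)\<in>{(m, n). P m n}. gap_set s c (int m) (int n))"
    then obtain m n where mn: "P m n" "x \<in> gap_set s c (int m) (int n)" by auto
    have "m \<in> {1..M}" using P[OF mn(1)] le_nat_floor_iff[of m R] by (simp add: M_def)
    moreover have "x \<in> U m" using mn by (auto simp: U_def A_def)
    ultimately show "x \<in> (\<Union>m\<in>{1..M}. U m)" by blast
  next
    fix x assume "x \<in> (\<Union>m\<in>{1..M}. U m)"
    then obtain m n where "x \<in> A m n" by (auto simp: U_def)
    then have "P m n" "x \<in> gap_set s c (int m) (int n)" by (auto simp: A_def split: if_splits)
    then show "x \<in> (\<Union>(m, n)\<in>{(m, n). P m n}. gap_set s c (int m) (int n))" by blast
  qed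
  show "(\<Union>(m, n)\<in>{(m, n). P m n}. gap_set s c (int m) (int n)) \<in> lmeasurable"
    unfolding eq using U by (intro fmeasurable.finite_UN) auto
  have "measure lebesgue (\<Union>m\<in>{1..M}. U m) = (\<Sum>m\<in>{1..M}. measure lebesgue (U m))"
  proof (rule measure_finite_Union)
    show "U ` {1..M} \<subseteq> sets lebesgue" using U by (auto simp: fmeasurableD)
    show "disjoint_family_on U {1..M}" unfolding disjoint_family_on_def
    proof (intro ballI impI equals0I)
      fix m m' x assume "m \<noteq> m'" "x \<in> U m \<inter> U m'"
      then obtain n n' where "x \<in> A m n" "x \<in> A m' n'" by (auto simp: U_def)
      with dis[of x m n m' n'] \<open>m \<noteq> m'\<close> show False by simp
    qed
    show "emeasure lebesgue (U m) \<noteq> \<infinity>" for m using fmeasurableD2[OF U[of m]] by simp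
  qed simp
  then show "measure lebesgue (\<Union>(m, n)\<in>{(m, n). P m n}. gap_set s c (int m) (int n))
      = lat_sum (\<lambda>R m n. P m n \<and> admissible s (int m) (int n)) (\<lambda>m n. wt s c m n) R"
    unfolding eq lat_sum_def M_def[symmetric] by (simp add: mU)
qed

section \<open>Growth of the denominators and the renewal time\<close>

lemma parity_cf_E: "parity_cf D_E 0 1"
  by unfold_locales (simp_all add: mem_D_E_iff odd_iff_mod_2_eq_one)

lemma parity_cf_O: "parity_cf D_O 1 (1 - golden)"
proof -
  have "1 - golden \<notin> \<rat>"
  proof
    assume "1 - golden \<in> \<rat>"
    then have "1 - (1 - golden) \<in> \<rat>" by (rule Rats_diff[OF Rats_1])
    with golden_bounds(4) show False by simp
  qed
  moreover have "t \<in> D_O \<longleftrightarrow> \<lfloor>1 / t\<rfloor> mod 2 \<noteq> 1" if "t \<in> Omega" for t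
    using mem_D_O_iff[OF that] by (simp add: even_iff_mod_2_eq_zero)
  moreover have "(2 - (1 - golden)) * (2 - real_of_int 1 - (1 - golden)) = 1"
    "(1 - golden) * (2 + real_of_int 1 - (1 - golden)) = 1"
    using golden_bounds(3) by (simp_all add: power2_eq_square algebra_simps)
  ultimately show ?thesis using golden_bounds(1,2) by unfold_locales simp_all
qed

interpretation E: parity_cf D_E 0 1 by (rule parity_cf_E)
interpretation O: parity_cf D_O 1 "1 - golden" by (rule parity_cf_O)

lemma E_q_increasing:
  assumes "x \<in> Omega"
  shows "cf_q D_E x n < cf_q D_E x (Suc n)"
proof -
  define u v where "u = cf_e D_E x (Suc n) * cf_q D_E x n" and "v = cf_q D_E x (Suc n)"
  have "- 1 * real_of_int v < of_int u" "of_int u < (2 - 1) * real_of_int v"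
    using E.cf_q_window[OF assms, of n] unfolding u_def v_def by blast+
  then have "real_of_int (- v) < real_of_int u" "real_of_int u < real_of_int v" by simp_all
  then have "- v < u" "u < v" by (simp_all only: of_int_less_iff)
  then have "- cf_q D_E x (Suc n) < cf_e D_E x (Suc n) * cf_q D_E x n" "cf_e D_E x (Suc n) * cf_q D_E x n < cf_q D_E x (Suc n)"
    unfolding u_def v_def .
  then show ?thesis using E.cf_e_cases[of x "Suc n"] by auto
qed

text \<open>OCF denominators may drop in one step but not over two. With sign 1 the recurrence adds
  q; with sign -1 the window gives q < (1 - g) q' < q' / 2, so even the smallest digit leaves q' - q
  > q.\<close>

lemma O_q_growth:
  assumes "x \<in> Omega"
  shows "cf_q D_O x n < cf_q D_O x (Suc (Suc n))"
proof -
  define a e where "a = cf_a D_O x (Suc (Suc n))" and "e = cf_e D_O x (Suc n)"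
  define q q' where "q = cf_q D_O x n" and "q' = cf_q D_O x (Suc n)"
  have pos: "q > 0" "q' > 0" using O.cf_q_pos[OF assms] by (auto simp: q_def q'_def)
  have a: "a \<ge> 1" using O.digit_ok_orbit[OF assms, of "Suc n"] by (auto simp: O.digit_ok_def a_def)
  then have aq: "a * q' \<ge> 1 * q'" using pos by (intro mult_right_mono) auto
  have eq: "cf_q D_O x (Suc (Suc n)) = a * q' + e * q" by (simp add: a_def e_def q_def q'_def)
  show ?thesis
  proof (cases "e = 1")
    case True
    then show ?thesis using eq aq pos by (simp add: q_def)
  next
    case False
    then have e: "e = -1" using O.cf_e_cases[of x "Suc n"] by (auto simp: e_def)
    have "- (1 - golden) * real_of_int q' < of_int (e * q)"
      using O.cf_q_window[OF assms, of n] by (simp add: q_def q'_def e_def)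
    then have "of_int q < (1 - golden) * real_of_int q'" using e by (simp add: algebra_simps)
    also have "\<dots> \<le> 1 / 2 * real_of_int q'" using golden_bounds pos by (intro mult_right_mono) auto
    finally have "2 * q < q'" by linarith
    then show ?thesis using eq e aq by (simp add: q_def)
  qed
qed

lemma O_q_unbounded:
  assumes "x \<in> Omega"
  shows "\<exists>n\<ge>1. real_of_int (cf_q D_O x n) > R"
proof -
  have "int k + 1 \<le> cf_q D_O x (2 * k)" for k
  proof (induction k)
    case (Suc k)
    then show ?case using O_q_growth[OF assms, of "2 * k"] by simp
  qed simp
  then have k: "real k + 1 \<le> cf_q D_O x (2 * k)" for k
    by (metis of_int_1 of_int_add of_int_le_iff of_int_of_nat_eq)
  obtain k :: nat where "R < real k" using reals_Archimedean2 by blast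
  then have "R < cf_q D_O x (2 * (k + 1))" using k[of "k + 1"] by simp
  then show ?thesis by (intro exI[of _ "2 * (k + 1)"]) auto
qed

lemma renewal_time_props:
  assumes "x \<in> Omega" "R > 1"
  obtains N where "renewal_time D_O R x = Suc N" "real_of_int (cf_q D_O x N) \<le> R" "real_of_int (cf_q D_O x (Suc N)) > R"
proof -
  let ?P = "\<lambda>n. n \<ge> 1 \<and> real_of_int (cf_q D_O x n) > R"
  have P: "?P (renewal_time D_O R x)"
    unfolding renewal_time_def using O_q_unbounded[OF assms(1), of R] by (intro LeastI_ex[of ?P]) auto
  then obtain N where N: "renewal_time D_O R x = Suc N" by (cases "renewal_time D_O R x") auto
  have "real_of_int (cf_q D_O x N) \<le> R"
  proof (cases "N = 0")
    case False
    have "\<not> ?P N" using not_less_Least[of N ?P] N unfolding renewal_time_def by simp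
    then show ?thesis using False by simp
  qed (use assms(2) in simp)
  then show ?thesis using that N P by simp
qed

text \<open>OCF denominators can exceed \<open>R\<close>, drop to at most \<open>R\<close> for a single step and exceed \<open>R\<close>
  again. A drop forces the digit pair \<open>(a, e) = (1, 1)\<close> just after a sign \<open>-1\<close>, and this is what
  the inequalities on \<open>l\<close> express.\<close>

lemma renewal_time_iff:
  assumes x: "x \<in> Omega" and R: "R > 1"
    and q: "real_of_int (cf_q D_O x N) \<le> R" "real_of_int (cf_q D_O x (Suc N)) > R"
  defines "m \<equiv> real_of_int (cf_q D_O x N)" and "n \<equiv> real_of_int (cf_q D_O x (Suc N))"
  shows "renewal_time D_O R x = Suc N \<longleftrightarrow>
    \<not> (\<exists>l\<ge>(if cf_e D_O x (Suc N) = 1 then 1 else 2 :: nat). R + (2 * real l - 1) * m < n \<and> n < (2 * real l + golden) * m)"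
proof -
  let ?q = "\<lambda>j. cf_q D_O x j"
  let ?P = "\<lambda>n. n \<ge> 1 \<and> real_of_int (cf_q D_O x n) > R"
  note g = golden_bounds
  have gg: "golden * (1 + golden) = 1" using g(3) by (simp add: power2_eq_square algebra_simps)
  have qpos: "?q j > 0" for j by (rule O.cf_q_pos[OF x])
  have m0: "m > 0" using qpos[of N] by (simp add: m_def)
  have le: "renewal_time D_O R x \<le> k" if "?P k" for k
    unfolding renewal_time_def by (rule Least_le[of ?P]) (rule that)
  have digit: "O.digit_ok (cf_a D_O x (Suc j)) (cf_e D_O x (Suc j))" for j by (rule O.digit_ok_orbit[OF x])
  show ?thesis
  proof (intro iffI notI)
    assume ren: "renewal_time D_O R x = Suc N"
    assume "\<exists>l\<ge>(if cf_e D_O x (Suc N) = 1 then 1 else 2 :: nat). R + (2 * real l - 1) * m < n \<and> n < (2 * real l + golden) * m"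
    then obtain l :: nat where l0: "l \<ge> (if cf_e D_O x (Suc N) = 1 then 1 else 2)"
      and l: "R + (2 * real l - 1) * m < n" "n < (2 * real l + golden) * m" by blast
    have "l \<ge> 1" using l0 by (cases "cf_e D_O x (Suc N) = 1") auto
    show False
    proof (cases N)
      \<comment> \<open>Here m = q_0 = 1, and R > 1 together with g < 1 would place the integer n
        strictly between 2 l and 2 l + 1.\<close>
      case 0
      then have "m = 1" by (simp add: m_def)
      then have "2 * real l < n" "n < 2 * real l + 1" using l R g by auto
      then have "2 * int l < ?q (Suc N)" "?q (Suc N) < 2 * int l + 1" unfolding n_def by linarith+
      then show False by linarith
    next
      case (Suc i)
      define a e where "a = cf_a D_O x (Suc N)" and "e = cf_e D_O x N"
      have n: "n = of_int a * m + of_int (e * ?q i)" by (simp add: n_def m_def a_def e_def Suc)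
      have w: "- (1 - golden) * m < of_int (e * ?q i)" "of_int (e * ?q i) < (2 - (1 - golden)) * m"
        using O.cf_q_window[OF x, of i] unfolding m_def e_def Suc by auto
      define r where "r = n - (2 * real l - 1) * m"
      have r: "R < r" "r < (1 + golden) * m" using l by (auto simp: r_def algebra_simps)
      \<comment> \<open>In the wedge, r lies in the remainder window, so the last digit must be 2 l
        - 1 and r is the signed previous denominator. As r > R, the level R was passed at the index
        i < N.\<close>
      have "a = 2 * int l - 1"
      proof (rule O.same_parity_close[of _ _ m "of_int (e * ?q i)" r])
        show "a mod 2 = (2 * int l - 1) mod 2"
          using O.digit_ok_mod[OF digit[of N]] unfolding a_def by presburger
        show "real_of_int a * m + of_int (e * ?q i) = real_of_int (2 * int l - 1) * m + r"
          using n by (simp add: r_def)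
        have "0 < (1 - golden) * m" using g m0 by simp
        then have "- ((1 - golden) * m) < r" using r R by linarith
        then show "- (1 - golden) * m < r" by (simp only: mult_minus_left)
      qed (use w m0 r in auto)
      then have "of_int (e * ?q i) = r" using n by (simp add: r_def)
      moreover have "e = 1 \<or> e = -1" unfolding e_def by (rule O.cf_e_cases)
      ultimately have "real_of_int (?q i) = r" using r R qpos[of i] by auto
      then have "real_of_int (?q i) > R" using r by simp
      moreover have "i \<noteq> 0" using calculation R by (cases i) auto
      ultimately have "renewal_time D_O R x \<le> i" by (intro le) simp
      then show False using ren Suc by simp
    qed
  next
    assume nb: "\<not> (\<exists>l\<ge>(if cf_e D_O x (Suc N) = 1 then 1 else 2 :: nat). R + (2 * real l - 1) * m < n \<and> n < (2 * real l + golden) * m)"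
    show "renewal_time D_O R x = Suc N"
    proof (rule ccontr)
      assume ne: "renewal_time D_O R x \<noteq> Suc N"
      \<comment> \<open>If the first passage lies before Suc N, this set is nonempty. Its maximum j
        is the last passage before the pair, and all later denominators up to index N are at most
        R.\<close>
      define S where "S = {j. 1 \<le> j \<and> j \<le> N \<and> real_of_int (?q j) > R}"
      have fin: "finite S" unfolding S_def by (rule finite_subset[of _ "{..N}"]) auto
      have "?P (renewal_time D_O R x)"
        unfolding renewal_time_def by (rule LeastI[of ?P "Suc N"]) (use q in simp)
      moreover have "renewal_time D_O R x \<le> Suc N" by (rule le) (use q in simp)
      ultimately have "renewal_time D_O R x \<in> S" using ne by (simp add: S_def)
      then have "Max S \<in> S" using Max_in[OF fin] by blast
      define j where "j = Max S"
      have j: "1 \<le> j" "j \<le> N" "real_of_int (?q j) > R" using \<open>Max S \<in> S\<close> by (auto simp: j_def S_def)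
      have jN: "j < N" using j q by (cases "j = N") auto
      have after: "real_of_int (?q k) \<le> R" if "j < k" "k \<le> N" for k
      proof (rule ccontr)
        assume "\<not> real_of_int (?q k) \<le> R"
        then have "k \<in> S" using that j by (simp add: S_def)
        then have "k \<le> j" using Max_ge[OF fin] by (simp add: j_def)
        with that show False by simp
      qed
      obtain i where i: "j = Suc i" using j by (cases j) auto
      define a e where "a = cf_a D_O x (Suc j)" and "e = cf_e D_O x j"
      have qj: "?q (Suc j) = a * ?q j + e * ?q i" by (simp add: i a_def e_def)
      \<comment> \<open>The drop from above R to at most R, combined with the window bound on e q_i,
        leaves only a = 1 and e = -1.\<close>
      have drop: "?q (Suc j) < ?q j" using after[of "Suc j"] j jN by simp
      have w: "- (1 - golden) * real_of_int (?q j) < of_int (e * ?q i)"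
        using O.cf_q_window[OF x, of i] unfolding e_def i by auto
      have "a * ?q j + e * ?q i < ?q j" using drop qj by simp
      then have "of_int (a * ?q j + e * ?q i) < real_of_int (?q j)" by (simp only: of_int_less_iff)
      then have "(of_int a - (1 - golden)) * real_of_int (?q j) < 1 * real_of_int (?q j)"
        using w by (simp add: algebra_simps)
      then have "of_int a - (1 - golden) < 1" using qpos[of j] by (simp only: mult_less_cancel_right_pos of_int_0_less_iff)
      then have "a < 2" using g by linarith
      moreover have "a \<ge> 1" using digit[of j] by (auto simp: O.digit_ok_def a_def)
      ultimately have a1: "a = 1" by simp
      have "e * ?q i < 0" using \<open>a * ?q j + e * ?q i < ?q j\<close> a1 by simp
      then have e1: "e = -1" using O.cf_e_cases[of x j] qpos[of i] by (auto simp: e_def)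
      \<comment> \<open>The digit 1 cannot carry the sign -1. Hence q_j is added in the next step,
        which exceeds R again: the drop lasts exactly one step and N = j + 1.\<close>
      have ej: "cf_e D_O x (Suc j) = 1" using digit[of j] a1 by (auto simp: O.digit_ok_def a_def)
      define a' where "a' = cf_a D_O x (Suc (Suc j))"
      have qjj: "?q (Suc (Suc j)) = a' * ?q (Suc j) + ?q j" by (simp add: a'_def ej)
      have a': "a' \<ge> 1" using digit[of "Suc j"] by (auto simp: O.digit_ok_def a'_def)
      then have "a' * ?q (Suc j) > 0" using qpos[of "Suc j"] by simp
      then have "real_of_int (?q (Suc (Suc j))) > R" using qjj j(3) by linarith
      then have "\<not> Suc (Suc j) \<le> N" using after[of "Suc (Suc j)"] by auto
      then have N: "N = Suc j" using jN by simp
      define l where "l = nat ((a' + 1) div 2)"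
      have odd: "a' mod 2 = 1" using O.digit_ok_mod[OF digit[of "Suc j"]] by (simp add: a'_def)
      have "a' = 2 * ((a' + 1) div 2) - 1" using odd by presburger
      moreover have "(a' + 1) div 2 \<ge> 1" using a' by presburger
      ultimately have l: "a' = 2 * int l - 1" "l \<ge> 1" unfolding l_def by linarith+
      have ral: "real_of_int a' = 2 * real l - 1" using l(1) by simp
      \<comment> \<open>The sign -1 requires the digit 2 l - 1 to be at least 3. For this reason the
        series \<open>D3\<close> starts at l = 2 whereas \<open>D1\<close> starts at l = 1.\<close>
      have lg: "l \<ge> (if cf_e D_O x (Suc N) = 1 then 1 else 2)"
      proof (cases "cf_e D_O x (Suc N) = 1")
        case False
        then have "a' \<ge> 3" using digit[of "Suc j"] by (auto simp: O.digit_ok_def a'_def N)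
        then show ?thesis using l(1) by auto
      qed (use l in simp)
      have n: "n = (2 * real l - 1) * m + ?q j" unfolding n_def m_def N qjj by (simp add: ral)
      have m: "m = ?q j - ?q i" unfolding m_def N qj a1 e1 by simp
      \<comment> \<open>The window after sign -1 gives m = q_j - q_i > g q_j; since g (1 + g) = 1
        this is q_j < (1 + g) m, the upper edge of the wedge.\<close>
      have "real_of_int (?q i) < (1 - golden) * ?q j" using w e1 by (simp add: algebra_simps)
      then have "golden * ?q j < m" using m by (simp add: algebra_simps)
      then have "(1 + golden) * (golden * ?q j) < (1 + golden) * m" using g by (intro mult_strict_left_mono) auto
      moreover have "(1 + golden) * (golden * ?q j) = golden * (1 + golden) * ?q j" by (simp add: mult_ac)
      ultimately have "?q j < (1 + golden) * m" using gg by simp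
      then have "n < (2 * real l + golden) * m" using n by (simp add: algebra_simps)
      moreover have "R + (2 * real l - 1) * m < n" using n j(3) by simp
      ultimately show False using nb lg by blast
    qed
  qed
qed

section \<open>Condition (a) on naturals, zeta constants and homogeneity\<close>

lemma cond_a_iff:
  assumes "R > 0" "n \<ge> 1"
  shows "cond_a x1 x2 x3 R (int m) (int n) \<longleftrightarrow> real m \<le> x1 * R \<and> R \<le> x2 * real n \<and> real m \<le> x3 * real n"
  using assms by (simp add: cond_a_def pos_divide_le_eq)

lemma odd_inverse_squares_sums:
  "(\<lambda>n. if Suc n \<in> {d. odd d} then 1 / (real (Suc n))\<^sup>2 else 0) sums (3 / 4 * zeta2)"
proof -
  have a: "(\<lambda>n. 1 / (real (Suc n))\<^sup>2) sums zeta2" using inverse_squares_sums by (simp add: zeta2_def)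
  from sums_if'[OF sums_mult[OF a, of "1 / 4"]]
  have "(\<lambda>n. if even n then 0 else 1 / 4 * (1 / (real (Suc ((n - 1) div 2)))\<^sup>2)) sums (1 / 4 * zeta2)" .
  from sums_diff[OF a this]
  have "(\<lambda>n. 1 / (real (Suc n))\<^sup>2 - (if even n then 0 else 1 / 4 * (1 / (real (Suc ((n - 1) div 2)))\<^sup>2))) sums (3 / 4 * zeta2)"
    by simp
  moreover have "1 / (real (Suc n))\<^sup>2 - (if even n then 0 else 1 / 4 * (1 / (real (Suc ((n - 1) div 2)))\<^sup>2))
    = (if Suc n \<in> {d. odd d} then 1 / (real (Suc n))\<^sup>2 else 0)" for n
  proof (cases "even n")
    case False
    then obtain k where k: "n = 2 * k + 1" by (rule oddE)
    then have "(n - 1) div 2 = k" "real (Suc n) = 2 * real (Suc k)" by simp_all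
    then have "(n - 1) div 2 = k" "(real (Suc n))\<^sup>2 = 4 * (real (Suc k))\<^sup>2" by (simp, simp only: power_mult_distrib, simp)
    then show ?thesis using False by (simp del: of_nat_Suc)
  qed simp
  ultimately show ?thesis by simp
qed

lemma wt_homogeneous:
  "d \<ge> 1 \<Longrightarrow> wt s c (real (d * m)) (real (d * n)) = wt s c (real m) (real n) / (real d)\<^sup>2"
proof -
  assume "d \<ge> 1"
  have eq: "real (d * n) * (real (d * n) + of_int s * c * real (d * m)) = (real d)\<^sup>2 * (real n * (real n + of_int s * c * real m))"
    by (simp add: algebra_simps power2_eq_square)
  show ?thesis unfolding wt_def eq by (simp only: divide_divide_eq_left mult.commute)
qed

lemma scaled_inequalities:
  fixes R x :: real and d m n :: nat
  assumes "d \<ge> 1"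
  shows "real (d * m) \<le> x * R \<longleftrightarrow> real m \<le> x * (R / d)"
    and "R < real (d * n) \<longleftrightarrow> R / d < real n"
    and "R \<le> x * real (d * n) \<longleftrightarrow> R / d \<le> x * real n"
    and "real (d * m) \<le> x * real (d * n) \<longleftrightarrow> real m \<le> x * real n"
    and "R + x * real (d * m) < real (d * n) \<longleftrightarrow> R / d + x * real m < real n"
    and "real (d * n) < x * real (d * m) \<longleftrightarrow> real n < x * real m"
proof -
  have d: "real d > 0" using assms by simp
  show "real (d * m) \<le> x * R \<longleftrightarrow> real m \<le> x * (R / d)"
    "R < real (d * n) \<longleftrightarrow> R / d < real n"
    "R \<le> x * real (d * n) \<longleftrightarrow> R / d \<le> x * real n"
    using d by (simp_all add: field_simps)
  show "real (d * m) \<le> x * real (d * n) \<longleftrightarrow> real m \<le> x * real n"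
    using mult_le_cancel_left_pos[OF d, of "real m" "x * real n"] by (simp add: mult_ac)
  show "real (d * n) < x * real (d * m) \<longleftrightarrow> real n < x * real m"
    using mult_less_cancel_left_pos[OF d, of "real n" "x * real m"] by (simp add: mult_ac)
  have "real d * (R / d + x * real m) = R + x * real (d * m)" using d by (simp add: algebra_simps)
  then show "R + x * real (d * m) < real (d * n) \<longleftrightarrow> R / d + x * real m < real n"
    using mult_less_cancel_left_pos[OF d, of "R / d + x * real m" "real n"] by simp
qed

section \<open>The even expansion\<close>

context
  fixes s :: int and c x1 x2 x3 :: real
  assumes s: "s = 1 \<or> s = -1" and c: "0 < c" "c \<le> 1" and x1: "0 < x1" "x1 \<le> 1"
    and x2: "0 < x2" "x2 \<le> 1" and x3: "0 < x3" "x3 \<le> 1"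
begin

text \<open>ECF denominators increase strictly, so each x has exactly one pair with m \<le> R < n.
  Condition (a) also admits n = R when R is an integer and x2 = 1, and then x may have a second
  pair. The pairs with n = R have total measure at most the sum of 1 / (R (R - m)) over m < R, which
  is the stated error.\<close>

lemma LE_lat_sum:
  assumes R: "R > 1"
  shows "\<bar>LE_meas x1 x2 x3 (gap_range s c) R
    - lat_sum (\<lambda>R m n. reg_F 2 x1 x2 x3 R m n \<and> coprime m n) (\<lambda>m n. wt s c m n) R\<bar> \<le> (1 + ln R) / R"
proof -
  define Q where "Q m n \<longleftrightarrow> 1 \<le> m \<and> 1 \<le> n \<and> real m \<le> x1 * R \<and> R \<le> x2 * real n \<and> real m \<le> x3 * real n" for m n :: nat
  let ?G = "\<lambda>m n. E.gap_set s c (int m) (int n)"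
  let ?U = "\<lambda>P. \<Union>(m, n)\<in>{(m, n). P m n}. ?G m n"
  have x1R: "x1 * R \<le> R" using x1 R by simp
  have Q_le: "real m \<le> R \<and> R \<le> real n" if "Q m n" for m n
  proof -
    have "x2 * real n \<le> 1 * real n" using x2 by (intro mult_right_mono) auto
    then show ?thesis using that x1R unfolding Q_def by linarith
  qed
  have set: "{x \<in> Omega. \<exists>n\<ge>1. successive_ok D_E x1 x2 x3 (gap_range s c) R x n} = ?U Q"
  proof (intro equalityI subsetI)
    fix x assume "x \<in> {x \<in> Omega. \<exists>n\<ge>1. successive_ok D_E x1 x2 x3 (gap_range s c) R x n}"
    then obtain n where x: "x \<in> Omega" and n: "n \<ge> 1" "successive_ok D_E x1 x2 x3 (gap_range s c) R x n" by auto
    then obtain N where N: "n = Suc N" by (cases n) auto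
    define m n' where "m = nat (cf_q D_E x N)" and "n' = nat (cf_q D_E x (Suc N))"
    have pos: "cf_q D_E x N > 0" "cf_q D_E x (Suc N) > 0" by (rule E.cf_q_pos[OF x])+
    then have mn: "int m = cf_q D_E x N" "int n' = cf_q D_E x (Suc N)" "m \<ge> 1" "n' \<ge> 1" by (auto simp: m_def n'_def)
    have "cond_a x1 x2 x3 R (int m) (int n')" "x \<in> ?G m n'"
      using n(2) x unfolding successive_ok_def N E.gap_set_def mn by auto
    then have "Q m n'" using cond_a_iff[of R n' x1 x2 x3 m] R mn by (simp add: Q_def)
    with \<open>x \<in> ?G m n'\<close> show "x \<in> ?U Q" by blast
  next
    fix x assume "x \<in> ?U Q"
    then obtain m n where mn: "Q m n" "x \<in> ?G m n" by auto
    then obtain N where N: "x \<in> Omega" "cf_q D_E x N = int m" "cf_q D_E x (Suc N) = int n"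
      "gap_ratio x (cf_p D_E x N) (int m) (cf_p D_E x (Suc N)) (int n) \<in> gap_range s c"
      by (auto simp: E.gap_set_def)
    have "cond_a x1 x2 x3 R (int m) (int n)" using mn(1) cond_a_iff[of R n x1 x2 x3 m] R by (simp add: Q_def)
    then have "successive_ok D_E x1 x2 x3 (gap_range s c) R x (Suc N)"
      using N by (simp only: successive_ok_def diff_Suc_1 simp_thms)
    then show "x \<in> {x \<in> Omega. \<exists>n\<ge>1. successive_ok D_E x1 x2 x3 (gap_range s c) R x n}"
      using N(1) by (intro CollectI conjI exI[of _ "Suc N"]) auto
  qed
  define P1 where "P1 m n \<longleftrightarrow> Q m n \<and> R < real n" for m n
  define P2 where "P2 m n \<longleftrightarrow> Q m n \<and> real n = R" for m n
  have mono: "strict_mono (\<lambda>N. cf_q D_E x N)" if "x \<in> Omega" for x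
    using E_q_increasing[OF that] by (simp add: strict_mono_Suc_iff)
  have gap: "\<exists>N. x \<in> Omega \<and> cf_q D_E x N = int m \<and> cf_q D_E x (Suc N) = int n" if "x \<in> ?G m n" for x m n
    using that by (auto simp: E.gap_set_def)
  have d1: "m = m' \<and> n = n'" if P: "P1 m n" "P1 m' n'" and x: "x \<in> ?G m n" "x \<in> ?G m' n'" for x m n m' n'
  proof -
    obtain N where N: "x \<in> Omega" "cf_q D_E x N = int m" "cf_q D_E x (Suc N) = int n" using gap[OF x(1)] by blast
    obtain N' where N': "cf_q D_E x N' = int m'" "cf_q D_E x (Suc N') = int n'" using gap[OF x(2)] by blast
    have lt: "real m < real n'" "real m' < real n" using Q_le[of m n] Q_le[of m' n'] P unfolding P1_def by auto
    then have "int m < int n'" "int m' < int n" by auto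
    then have "N < Suc N'" "N' < Suc N" using N N' strict_mono_less[OF mono[OF N(1)]] by metis+
    then have "N = N'" by simp
    then show ?thesis using N N' by simp
  qed
  have d2: "m = m' \<and> n = n'" if P: "P2 m n" "P2 m' n'" and x: "x \<in> ?G m n" "x \<in> ?G m' n'" for x m n m' n'
  proof -
    obtain N where N: "x \<in> Omega" "cf_q D_E x N = int m" "cf_q D_E x (Suc N) = int n" using gap[OF x(1)] by blast
    obtain N' where N': "cf_q D_E x N' = int m'" "cf_q D_E x (Suc N') = int n'" using gap[OF x(2)] by blast
    have "real n = real n'" using P unfolding P2_def by simp
    then have "n = n'" by simp
    then have "Suc N = Suc N'" using N N' strict_mono_eq[OF mono[OF N(1)]] by metis
    then show ?thesis using N N' \<open>n = n'\<close> by simp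
  qed
  have b1: "1 \<le> m \<and> real m \<le> R \<and> 1 \<le> n" if "P1 m n" for m n using that Q_le[of m n] unfolding P1_def Q_def by auto
  have b2: "1 \<le> m \<and> real m \<le> R \<and> 1 \<le> n" if "P2 m n" for m n using that Q_le[of m n] unfolding P2_def Q_def by auto
  note m1 = E.gap_union_measure[OF s c b1 d1]
  note m2 = E.gap_union_measure[OF s c b2 d2]
  have adm: "E.admissible s (int m) (int n) \<longleftrightarrow> m < n \<and> coprime m n \<and> odd (m + n)" if "1 \<le> m" "1 \<le> n" for m n
  proof -
    have "- 1 * real n < real_of_int (s * int m) \<and> real_of_int (s * int m) < (2 - 1) * real n \<longleftrightarrow> m < n"
      using s by auto
    then show ?thesis using that unfolding E.admissible_def E.pair_ok_def by auto
  qed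
  have lat1: "lat_sum (\<lambda>R m n. P1 m n \<and> E.admissible s (int m) (int n)) (\<lambda>m n. wt s c m n) R
    = lat_sum (\<lambda>R m n. reg_F 2 x1 x2 x3 R m n \<and> coprime m n) (\<lambda>m n. wt s c m n) R"
    unfolding lat_sum_def
  proof (intro sum.cong refl arg_cong2[where f = infsum] Collect_cong)
    fix m n assume m: "m \<in> {1..nat \<lfloor>R\<rfloor>}"
    have par: "n mod 2 = (m + 1) mod 2 \<longleftrightarrow> odd (m + n)" by presburger
    have "m < n" if "real m \<le> x1 * R" "R < real n" using that x1R by linarith
    then show "1 \<le> n \<and> P1 m n \<and> E.admissible s (int m) (int n) \<longleftrightarrow> 1 \<le> n \<and> reg_F 2 x1 x2 x3 R m n \<and> coprime m n"
      using m adm[of m n] unfolding P1_def Q_def reg_F_def par by auto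
  qed
  have U: "?U Q = ?U P1 \<union> ?U P2"
  proof -
    have "Q m n \<longleftrightarrow> P1 m n \<or> P2 m n" for m n using Q_le[of m n] unfolding P1_def P2_def by auto
    then show ?thesis by auto
  qed
  have "measure lebesgue (?U P2) \<le> (1 + ln R) / R"
  proof (cases "\<exists>n. real n = R")
    case False
    then have "{(m, n). P2 m n} = {}" unfolding P2_def by auto
    then have "measure lebesgue (?U P2) = 0" by simp
    moreover have "0 \<le> (1 + ln R) / R" using R by simp
    ultimately show ?thesis by linarith
  next
    case True
    then obtain n0 where n0: "real n0 = R" by blast
    have "measure lebesgue (?U P2) = lat_sum (\<lambda>R m n. P2 m n \<and> E.admissible s (int m) (int n)) (\<lambda>m n. wt s c m n) R"
      by (rule m2(2))
    also have "\<dots> \<le> (\<Sum>m\<in>{1..n0}. if m < n0 then 1 / (R * (R - m)) else 0)"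
      unfolding lat_sum_def
    proof (rule sum_mono2[THEN order_trans, rotated 3], rule sum_mono)
      fix m assume m: "m \<in> {1..n0}"
      have "{n. 1 \<le> n \<and> P2 m n \<and> E.admissible s (int m) (int n)} \<subseteq> {n0}"
        using n0 by (auto simp: P2_def)
      then have "{n. 1 \<le> n \<and> P2 m n \<and> E.admissible s (int m) (int n)} = {} \<or>
        {n. 1 \<le> n \<and> P2 m n \<and> E.admissible s (int m) (int n)} = {n0} \<and> E.admissible s (int m) (int n0)" by blast
      then show "(\<Sum>\<^sub>\<infinity>n\<in>{n. 1 \<le> n \<and> P2 m n \<and> E.admissible s (int m) (int n)}. wt s c m n)
        \<le> (if m < n0 then 1 / (R * (R - m)) else 0)"
      proof
        assume e: "{n. 1 \<le> n \<and> P2 m n \<and> E.admissible s (int m) (int n)} = {}"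
        show ?thesis unfolding e using n0 R by auto
      next
        assume e: "{n. 1 \<le> n \<and> P2 m n \<and> E.admissible s (int m) (int n)} = {n0} \<and> E.admissible s (int m) (int n0)"
        then have "m < n0" using adm[of m n0] m by auto
        then show ?thesis using e wt_bounds(2)[OF s c, of "real m" "real n0"] n0 by simp
      qed
    qed (use n0 in auto)
    also have "\<dots> = (\<Sum>m\<in>{1..n0 - 1}. 1 / (R * (R - m)))"
      by (rule sum.mono_neutral_cong_right) auto
    also have "\<dots> = (\<Sum>m\<in>{1..n0 - 1}. 1 / (R - m)) / R" by (simp add: sum_divide_distrib mult.commute)
    also have "\<dots> \<le> (1 + ln R) / R"
      using n0 R by (intro divide_right_mono harmonic_reverse_le) (auto simp: of_nat_diff)
    finally show ?thesis .
  qed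
  moreover have "measure lebesgue (?U Q) \<le> measure lebesgue (?U P1) + measure lebesgue (?U P2)"
    unfolding U by (intro measure_Un_le fmeasurableD m1(1) m2(1))
  moreover have "measure lebesgue (?U P1) \<le> measure lebesgue (?U Q)"
    unfolding U by (intro measure_mono_fmeasurable fmeasurableD fmeasurable.Un m1(1) m2(1)) auto
  ultimately have "\<bar>measure lebesgue (?U Q) - measure lebesgue (?U P1)\<bar> \<le> (1 + ln R) / R" by linarith
  moreover have "measure lebesgue (?U P1)
      = lat_sum (\<lambda>R m n. reg_F 2 x1 x2 x3 R m n \<and> coprime m n) (\<lambda>m n. wt s c m n) R"
    by (rule trans[OF m1(2) lat1])
  moreover have "LE_meas x1 x2 x3 (gap_range s c) R = measure lebesgue (?U Q)" unfolding LE_meas_def set ..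
  ultimately show ?thesis by (simp only:)
qed

text \<open>The factor 1 / 2 from opposite parity, divided by the odd part 3 / 4 of zeta(2),
  produces the factor 2 / 3 of the main term.\<close>

lemma LE_asymp:
  assumes R: "R > 1"
  shows "\<bar>LE_meas x1 x2 x3 (gap_range s c) R - 2 * F_sgn s c x2 x3 x1 / (3 * zeta2)\<bar> \<le> 200 * (1 + ln R) ^ 3 / R"
proof -
  define L where "L = 1 + ln R"
  have L: "L \<ge> 1" using R by (simp add: L_def)
  define F where "F = F_sgn s c x2 x3 x1"
  have F: "0 \<le> F" "F \<le> 4" using F_sgn_bounds[OF s c x2 x3, of x1] x1 by (auto simp: F_def)
  let ?S = "lat_sum (\<lambda>R m n. reg_F 2 x1 x2 x3 R m n \<and> coprime m n) (\<lambda>m n. wt s c m n) R"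
  have "\<bar>?S - (F / 2) / (3 / 4 * zeta2)\<bar> \<le> (24 + 2 * \<bar>F / 2\<bar>) * (1 + ln R) ^ 3 / R"
  proof (rule lat_sum_coprime_asymp[OF odd_inverse_squares_sums])
    show "(1::nat) \<in> {d. odd d}" by simp
    show "d * m \<in> {d. odd d} \<longleftrightarrow> d \<in> {d. odd d} \<and> m \<in> {d. odd d}" for d m :: nat by simp
    show "R \<ge> 1" using R by simp
    show "reg_F 2 x1 x2 x3 R (d * m) (d * n) \<longleftrightarrow> d \<in> {d. odd d} \<and> reg_F 2 x1 x2 x3 (R / d) m n"
      if "d \<ge> 1" for d m n
    proof -
      have "(d * n) mod 2 = (d * m + 1) mod 2 \<longleftrightarrow> odd (d * m + d * n)" by presburger
      moreover have "n mod 2 = (m + 1) mod 2 \<longleftrightarrow> odd (m + n)" by presburger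
      moreover have "odd (d * m + d * n) \<longleftrightarrow> odd d \<and> odd (m + n)" by (metis distrib_left even_mult_iff)
      ultimately show ?thesis unfolding reg_F_def scaled_inequalities[OF that] by auto
    qed
    show "wt s c (real (d * m)) (real (d * n)) = wt s c m n / (real d)\<^sup>2" if "d \<ge> 1" for d m n
      by (rule wt_homogeneous[OF that])
    show "(\<lambda>n. wt s c m n) summable_on {n. 1 \<le> n \<and> reg_F 2 x1 x2 x3 R m n}" if "m \<ge> 1" for m
    proof (rule wt_ray_infsum(1)[OF s c that])
      fix n assume "n \<in> {n. 1 \<le> n \<and> reg_F 2 x1 x2 x3 R m n}"
      then have "real m \<le> x1 * R" "R < real n" by (auto simp: reg_F_def)
      moreover have "x1 * R \<le> R" using x1 R by simp
      ultimately have "real m < real n" by linarith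
      then show "m < n" by simp
    qed
    show "\<bar>lat_sum (reg_F 2 x1 x2 x3) (\<lambda>m n. wt s c m n) R' - F / 2\<bar> \<le> 24 * (1 + ln R')\<^sup>2 / R'" if "R' \<ge> 1" for R'
      using F_lat_sum[OF s c x1 x2 x3 _ that, of 2] by (simp add: F_def)
  qed
  also have "\<dots> \<le> 28 * L ^ 3 / R"
    unfolding L_def[symmetric] using F R L by (intro divide_right_mono mult_right_mono) auto
  finally have "\<bar>?S - (F / 2) / (3 / 4 * zeta2)\<bar> \<le> 28 * L ^ 3 / R" .
  moreover have "(F / 2) / (3 / 4 * zeta2) = 2 * F / (3 * zeta2)" by (simp add: field_simps)
  ultimately have "\<bar>?S - 2 * F / (3 * zeta2)\<bar> \<le> 28 * L ^ 3 / R" by (simp only:)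
  moreover have "\<bar>a - b\<bar> \<le> u + v" if "\<bar>a - t\<bar> \<le> u" "\<bar>t - b\<bar> \<le> v" for a b t u v :: real using that by linarith
  ultimately have "\<bar>LE_meas x1 x2 x3 (gap_range s c) R - 2 * F / (3 * zeta2)\<bar> \<le> L / R + 28 * L ^ 3 / R"
    using LE_lat_sum[OF R] unfolding L_def[symmetric] by blast
  also have "\<dots> = (L + 28 * L ^ 3) / R" by (simp add: add_divide_distrib)
  also have "\<dots> \<le> 200 * L ^ 3 / R"
  proof (rule divide_right_mono)
    have "L \<le> L ^ 3" using L by (simp add: self_le_power)
    moreover have "L ^ 3 \<ge> 0" using L by simp
    ultimately show "L + 28 * L ^ 3 \<le> 200 * L ^ 3" by linarith
  qed (use R in simp)
  finally show ?thesis by (simp add: L_def F_def)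
qed

end

section \<open>The odd expansion\<close>

lemma zeta2_sums: "(\<lambda>n. if Suc n \<in> UNIV then 1 / (real (Suc n))\<^sup>2 else 0) sums zeta2"
  using inverse_squares_sums by (simp add: zeta2_def)

text \<open>The window for the signed ratio is automatic for \<open>s = 1\<close>; for \<open>s = -1\<close> it amounts to
  replacing \<open>x3\<close> by \<open>min x3 (1 - golden)\<close>.\<close>

definition O_x3 :: "int \<Rightarrow> real \<Rightarrow> real" where
  "O_x3 s x3 = (if s = 1 then x3 else min x3 (1 - golden))"

definition O_l0 :: "int \<Rightarrow> nat" where
  "O_l0 s = (if s = 1 then 1 else 2)"

context
  fixes s :: int and c x1 x2 x3 :: real
  assumes s: "s = 1 \<or> s = -1" and c: "0 < c" "c \<le> 1" and x1: "0 < x1" "x1 \<le> 1"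
    and x2: "0 < x2" "x2 \<le> 1" and x3: "0 < x3" "x3 \<le> 1"
begin

lemma O_x3: "0 < O_x3 s x3" "O_x3 s x3 \<le> 1"
  using x3 golden_bounds by (auto simp: O_x3_def)

lemma O_l0: "O_l0 s \<ge> 1"
  by (simp add: O_l0_def)

text \<open>In contrast to the even case this is an identity: the renewal index is unique and forces
  R < n. By \<open>renewal_time_iff\<close> a pair that straddles R is the renewal pair exactly when
  it avoids the wedges allowed for its sign, so the sets of different pairs are disjoint.\<close>

lemma LO_lat_sum:
  assumes R: "R > 1"
  shows "LO_meas x1 x2 x3 (gap_range s c) R
    = lat_sum (\<lambda>R m n. reg_O x1 x2 (O_x3 s x3) (O_l0 s) R m n \<and> coprime m n) (\<lambda>m n. wt s c m n) R"
proof -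
  define bad where "bad m n \<longleftrightarrow> (\<exists>l\<ge>O_l0 s. R + (2 * real l - 1) * m < n \<and> n < (2 * real l + golden) * m)" for m n :: real
  define P where "P m n \<longleftrightarrow> 1 \<le> m \<and> 1 \<le> n \<and> real m \<le> x1 * R \<and> R \<le> x2 * real n \<and> real m \<le> x3 * real n
    \<and> R < real n \<and> \<not> bad m n" for m n :: nat
  let ?G = "\<lambda>m n. O.gap_set s c (int m) (int n)"
  let ?U = "\<Union>(m, n)\<in>{(m, n). P m n}. ?G m n"
  have x1R: "x1 * R \<le> R" using x1 R by simp
  have ren: "renewal_time D_O R x = Suc N"
    if x: "x \<in> Omega" and q: "cf_q D_O x N = int m" "cf_q D_O x (Suc N) = int n"
      and gr: "gap_ratio x (cf_p D_O x N) (int m) (cf_p D_O x (Suc N)) (int n) \<in> gap_range s c" and P: "P m n" for x N m n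
  proof -
    have e: "cf_e D_O x (Suc N) = s" using O.gap_set_sign[OF x s, of N c] gr q by simp
    have "real_of_int (cf_q D_O x N) \<le> R" "real_of_int (cf_q D_O x (Suc N)) > R"
      using P q x1R unfolding P_def by auto
    from renewal_time_iff[OF x R this] show ?thesis
      using P unfolding P_def bad_def e q O_l0_def by simp
  qed
  have set: "{x \<in> Omega. successive_ok D_O x1 x2 x3 (gap_range s c) R x (renewal_time D_O R x)} = ?U"
  proof (intro equalityI subsetI)
    fix x assume "x \<in> {x \<in> Omega. successive_ok D_O x1 x2 x3 (gap_range s c) R x (renewal_time D_O R x)}"
    then have x: "x \<in> Omega" and ok: "successive_ok D_O x1 x2 x3 (gap_range s c) R x (renewal_time D_O R x)" by auto
    obtain N where N: "renewal_time D_O R x = Suc N" "real_of_int (cf_q D_O x N) \<le> R" "real_of_int (cf_q D_O x (Suc N)) > R"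
      by (rule renewal_time_props[OF x R])
    define m n where "m = nat (cf_q D_O x N)" and "n = nat (cf_q D_O x (Suc N))"
    have pos: "cf_q D_O x N > 0" "cf_q D_O x (Suc N) > 0" by (rule O.cf_q_pos[OF x])+
    then have mn: "int m = cf_q D_O x N" "int n = cf_q D_O x (Suc N)" "m \<ge> 1" "n \<ge> 1" by (auto simp: m_def n_def)
    have mnr: "real_of_int (cf_q D_O x N) = real m" "real_of_int (cf_q D_O x (Suc N)) = real n"
      unfolding mn(1,2)[symmetric] by simp_all
    have ca: "cond_a x1 x2 x3 R (int m) (int n)"
      and gr: "gap_ratio x (cf_p D_O x N) (int m) (cf_p D_O x (Suc N)) (int n) \<in> gap_range s c"
      using ok unfolding successive_ok_def N(1) mn by simp_all
    have e: "cf_e D_O x (Suc N) = s" using O.gap_set_sign[OF x s, of N c] gr mn by simp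
    have "\<not> bad m n"
      using iffD1[OF renewal_time_iff[OF x R N(2,3)] N(1)] unfolding bad_def e mnr O_l0_def by simp
    then have "P m n" using ca cond_a_iff[of R n x1 x2 x3 m] R mn N(3) unfolding P_def mnr by simp
    moreover have "x \<in> ?G m n" unfolding O.gap_set_def using x gr mn by auto
    ultimately show "x \<in> ?U" by blast
  next
    fix x assume "x \<in> ?U"
    then obtain m n where mn: "P m n" "x \<in> ?G m n" by auto
    then obtain N where N: "x \<in> Omega" "cf_q D_O x N = int m" "cf_q D_O x (Suc N) = int n"
      "gap_ratio x (cf_p D_O x N) (int m) (cf_p D_O x (Suc N)) (int n) \<in> gap_range s c"
      by (auto simp: O.gap_set_def)
    have "cond_a x1 x2 x3 R (int m) (int n)" using mn(1) cond_a_iff[of R n x1 x2 x3 m] R by (simp add: P_def)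
    then have "successive_ok D_O x1 x2 x3 (gap_range s c) R x (renewal_time D_O R x)"
      unfolding ren[OF N mn(1)] using N by (simp only: successive_ok_def diff_Suc_1 simp_thms)
    then show "x \<in> {x \<in> Omega. successive_ok D_O x1 x2 x3 (gap_range s c) R x (renewal_time D_O R x)}"
      using N(1) by simp
  qed
  have disj: "m = m' \<and> n = n'" if P: "P m n" "P m' n'" and x: "x \<in> ?G m n" "x \<in> ?G m' n'" for x m n m' n'
  proof -
    obtain N where N: "x \<in> Omega" "cf_q D_O x N = int m" "cf_q D_O x (Suc N) = int n"
      "gap_ratio x (cf_p D_O x N) (int m) (cf_p D_O x (Suc N)) (int n) \<in> gap_range s c"
      using x(1) by (auto simp: O.gap_set_def)
    obtain N' where N': "x \<in> Omega" "cf_q D_O x N' = int m'" "cf_q D_O x (Suc N') = int n'"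
      "gap_ratio x (cf_p D_O x N') (int m') (cf_p D_O x (Suc N')) (int n') \<in> gap_range s c"
      using x(2) by (auto simp: O.gap_set_def)
    have "Suc N = Suc N'" using ren[OF N P(1)] ren[OF N' P(2)] by simp
    then show ?thesis using N(2,3) N'(2,3) by simp
  qed
  have b: "1 \<le> m \<and> real m \<le> R \<and> 1 \<le> n" if "P m n" for m n using that x1R unfolding P_def by auto
  have "measure lebesgue ?U = lat_sum (\<lambda>R m n. P m n \<and> O.admissible s (int m) (int n)) (\<lambda>m n. wt s c m n) R"
    by (rule O.gap_union_measure(2)[OF s c b disj])
  also have "\<dots> = lat_sum (\<lambda>R m n. reg_O x1 x2 (O_x3 s x3) (O_l0 s) R m n \<and> coprime m n) (\<lambda>m n. wt s c m n) R"
    unfolding lat_sum_def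
  proof (intro sum.cong refl arg_cong2[where f = infsum] Collect_cong)
    fix m n assume "m \<in> {1..nat \<lfloor>R\<rfloor>}"
    then have m: "m \<ge> 1" by simp
    show "1 \<le> n \<and> P m n \<and> O.admissible s (int m) (int n) \<longleftrightarrow>
        1 \<le> n \<and> reg_O x1 x2 (O_x3 s x3) (O_l0 s) R m n \<and> coprime m n"
    proof (cases "1 \<le> n \<and> real m \<le> x1 * R \<and> R < real n \<and> R \<le> x2 * real n \<and> real m \<le> x3 * real n")
      case False
      moreover have "real m \<le> x3 * real n" if "real m \<le> O_x3 s x3 * real n"
        using that mult_right_mono[of "O_x3 s x3" x3 "real n"] by (simp add: O_x3_def split: if_splits)
      ultimately show ?thesis unfolding P_def reg_O_def reg_F_def by blast
    next
      case True
      then have lt: "real m < real n" using x1R by linarith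
      \<comment> \<open>For s = 1 the window follows from m < n. For s = -1 it reads m < (1 - g) n,
        and irrationality of g lets the strict bound be merged with m \<le> x3 n into a single
        non-strict one.\<close>
      have w: "- (1 - golden) * of_int (int n) < of_int (s * int m) \<and> of_int (s * int m) < (2 - (1 - golden)) * of_int (int n)
          \<longleftrightarrow> real m \<le> O_x3 s x3 * real n"
      proof (cases "s = 1")
        case s1: True
        have "0 < (1 - golden) * real n" using True golden_bounds by simp
        moreover have "1 * real n \<le> (1 + golden) * real n" using golden_bounds by (intro mult_right_mono) auto
        moreover have "- (1 - golden) * real n = - ((1 - golden) * real n)" by (simp only: mult_minus_left)
        moreover have "(2 - (1 - golden)) * real n = (1 + golden) * real n" by simp
        ultimately have "- (1 - golden) * real n < real m" "real m < (2 - (1 - golden)) * real n"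
          using lt by linarith+
        then show ?thesis using s1 True unfolding O_x3_def by simp
      next
        case False
        then have sm: "s = -1" using s by simp
        have ne: "real m \<noteq> (1 - golden) * real n"
        proof
          assume eq: "real m = (1 - golden) * real n"
          have "golden = 1 - real m / real n" using eq True by (simp add: field_simps)
          also have "\<dots> \<in> \<rat>" by simp
          finally show False using golden_bounds by simp
        qed
        have 1: "real m \<le> O_x3 s x3 * real n \<longleftrightarrow> real m < (1 - golden) * real n"
        proof (cases "x3 \<le> 1 - golden")
          case x3g: True
          then have "x3 * real n \<le> (1 - golden) * real n" by (intro mult_right_mono) auto
          moreover have "O_x3 s x3 = x3" using x3g sm by (simp add: O_x3_def)
          ultimately have "real m < (1 - golden) * real n" using True ne by linarith
          then show ?thesis using True \<open>O_x3 s x3 = x3\<close> by simp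
        next
          case False
          then have "O_x3 s x3 = 1 - golden" using sm by (simp add: O_x3_def)
          then show ?thesis using ne by auto
        qed
        have e: "real_of_int (s * int m) = - real m" "real_of_int (int n) = real n" using sm by simp_all
        have "0 < (2 - (1 - golden)) * real n" using golden_bounds True by (intro mult_pos_pos) auto
        then have B: "- real m < (2 - (1 - golden)) * real n" by linarith
        have A: "- (1 - golden) * real n < - real m \<longleftrightarrow> real m < (1 - golden) * real n"
          unfolding mult_minus_left neg_less_iff_less ..
        show ?thesis unfolding 1 e using A B by blast
      qed
      have adm: "O.admissible s (int m) (int n) \<longleftrightarrow> coprime m n \<and> real m \<le> O_x3 s x3 * real n"
        unfolding O.admissible_def O.pair_ok_def w using m True by auto
      have "reg_D l x1 x2 (O_x3 s x3) R m n \<longleftrightarrow> R + (2 * real l - 1) * real m < real n \<and> real n < (2 * real l + golden) * real m"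
        if "real m \<le> O_x3 s x3 * real n" for l
        using True that unfolding reg_D_def by blast
      then have "bad m n \<longleftrightarrow> (\<exists>l\<ge>O_l0 s. reg_D l x1 x2 (O_x3 s x3) R m n)" if "real m \<le> O_x3 s x3 * real n"
        unfolding bad_def using that by blast
      moreover have "n mod 1 = (m + 1) mod 1" by simp
      ultimately show ?thesis unfolding adm reg_O_def P_def reg_F_def using True m by blast
    qed
  qed
  finally show ?thesis unfolding LO_meas_def set .
qed

lemma reg_O_homogeneous:
  assumes "d \<ge> 1"
  shows "reg_O x1 x2 y l0 R (d * m) (d * n) \<longleftrightarrow> reg_O x1 x2 y l0 (R / d) m n"
proof -
  have "reg_F 1 x1 x2 y R (d * m) (d * n) \<longleftrightarrow> reg_F 1 x1 x2 y (R / d) m n"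
    unfolding reg_F_def scaled_inequalities(1-4)[OF assms] using assms by auto
  moreover have "reg_D l x1 x2 y R (d * m) (d * n) \<longleftrightarrow> reg_D l x1 x2 y (R / d) m n" for l
    unfolding reg_D_def scaled_inequalities(1,3-6)[OF assms] using assms by simp
  ultimately show ?thesis unfolding reg_O_def by simp
qed

lemma LO_asymp:
  assumes R: "R > 1"
  shows "\<bar>LO_meas x1 x2 x3 (gap_range s c) R
    - (F_sgn s c x2 (O_x3 s x3) x1 - D_total s c x1 x2 (O_x3 s x3) (O_l0 s)) / zeta2\<bar> \<le> 200 * (1 + ln R) ^ 3 / R"
proof -
  define I where "I = F_sgn s c x2 (O_x3 s x3) x1 - D_total s c x1 x2 (O_x3 s x3) (O_l0 s)"
  have I: "\<bar>I\<bar> \<le> 4"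
    using F_sgn_bounds[OF s c x2 O_x3, of x1] D_total_bounds[OF s c x1 x2 O_x3 O_l0] x1 unfolding I_def by auto
  have "\<bar>LO_meas x1 x2 x3 (gap_range s c) R - I / zeta2\<bar> \<le> (144 + 2 * \<bar>I\<bar>) * (1 + ln R) ^ 3 / R"
    unfolding LO_lat_sum[OF R]
  proof (rule lat_sum_coprime_asymp[OF zeta2_sums])
    show "reg_O x1 x2 (O_x3 s x3) (O_l0 s) R (d * m) (d * n) \<longleftrightarrow> d \<in> UNIV \<and> reg_O x1 x2 (O_x3 s x3) (O_l0 s) (R / d) m n"
      if "d \<ge> 1" for d m n using reg_O_homogeneous[OF that] by simp
    show "wt s c (real (d * m)) (real (d * n)) = wt s c m n / (real d)\<^sup>2" if "d \<ge> 1" for d m n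
      by (rule wt_homogeneous[OF that])
    show "(\<lambda>n. wt s c m n) summable_on {n. 1 \<le> n \<and> reg_O x1 x2 (O_x3 s x3) (O_l0 s) R m n}" if "m \<ge> 1" for m
    proof (rule wt_ray_infsum(1)[OF s c that])
      fix n assume "n \<in> {n. 1 \<le> n \<and> reg_O x1 x2 (O_x3 s x3) (O_l0 s) R m n}"
      then have "real m \<le> x1 * R" "R < real n" by (auto simp: reg_O_def reg_F_def)
      moreover have "x1 * R \<le> R" using x1 R by simp
      ultimately have "real m < real n" by linarith
      then show "m < n" by simp
    qed
    show "\<bar>lat_sum (reg_O x1 x2 (O_x3 s x3) (O_l0 s)) (\<lambda>m n. wt s c m n) R' - I\<bar> \<le> 144 * (1 + ln R')\<^sup>2 / R'" if "R' \<ge> 1" for R'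
      unfolding I_def by (rule reg_O_lat_sum[OF s c x1 x2 O_x3 that O_l0])
  qed (use R in auto)
  also have "\<dots> \<le> 200 * (1 + ln R) ^ 3 / R"
    using I R by (intro divide_right_mono mult_right_mono) auto
  finally show ?thesis unfolding I_def .
qed

end

text \<open>In wedges with l \<ge> 2 the ratio m / n is at most y / (1 + 3 y) \<le> 1 / 4, below 1 -
  g. So the bound of the window is inactive there, and \<open>D3\<close> can be stated with
  \<open>x3\<close> itself.\<close>

lemma D_total_min:
  assumes c: "0 < c" "c \<le> 1" and x1: "0 < x1" "x1 \<le> 1" and x2: "0 < x2" "x2 \<le> 1"
  shows "D_total (-1) c x1 x2 (min x3 (1 - golden)) 2 = D_total (-1) c x1 x2 x3 2"
proof -
  have g: "1 / 4 \<le> 1 - golden"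
  proof (rule ccontr)
    assume "\<not> 1 / 4 \<le> 1 - golden"
    then have "3 / 4 * (3 / 4) < golden * golden" by (intro mult_strict_mono') auto
    then show False using golden_bounds(3) \<open>\<not> 1 / 4 \<le> 1 - golden\<close> by (simp add: power2_eq_square)
  qed
  have arg: "arg_D x2 (min x3 (1 - golden)) (i + 2) y = arg_D x2 x3 (i + 2) y" if y: "0 \<le> y" "y \<le> x1" for i y
  proof -
    have "(2 * real (i + 2) - 1) * y \<ge> 3 * y" using y by (intro mult_right_mono) auto
    then have "0 < 1 + (2 * real (i + 2) - 1) * y" "4 * y \<le> 1 + (2 * real (i + 2) - 1) * y" using y x1 by linarith+
    then have "y / (1 + (2 * real (i + 2) - 1) * y) \<le> 1 / 4" by (simp add: pos_divide_le_eq)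
    then show ?thesis using g unfolding arg_D_def by linarith
  qed
  have "J_D (-1) c x2 (min x3 (1 - golden)) (i + 2) x1 = J_D (-1) c x2 x3 (i + 2) x1" for i
    unfolding J_D_def h_D_def
  proof (rule Henstock_Kurzweil_Integration.integral_cong)
    fix y assume "y \<in> {0..x1}"
    then have "arg_D x2 (min x3 (1 - golden)) (i + 2) y = arg_D x2 x3 (i + 2) y" by (intro arg) auto
    then show "max 0 (of_int (- 1) * ln (1 + of_int (- 1) * c * arg_D x2 (min x3 (1 - golden)) (i + 2) y)
        - of_int (- 1) * ln (1 + of_int (- 1) * c / (2 * real (i + 2) + golden))) / y
      = max 0 (of_int (- 1) * ln (1 + of_int (- 1) * c * arg_D x2 x3 (i + 2) y)
        - of_int (- 1) * ln (1 + of_int (- 1) * c / (2 * real (i + 2) + golden))) / y" by (simp only:)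
  qed
  then show ?thesis by (simp add: D_total_def)
qed

text \<open>Each of the three logarithms is absorbed by R to the power \<epsilon> / 3, through ln b
  \<le> b for b = \<open>R powr (\<epsilon> / 3)\<close>; this gives the constant K (1 + 3 /
  \<epsilon>)^3. Any exponent a \<ge> -1 is weaker than the bound with 1 / R, which covers both -1
  and -1 / 2.\<close>

lemma uniform_asympI:
  assumes K: "\<And>x1 x2 x3 x4 R. x1 \<in> {0<..1} \<Longrightarrow> x2 \<in> {0<..1} \<Longrightarrow> x3 \<in> {0<..1} \<Longrightarrow> x4 \<in> {0<..1} \<Longrightarrow> R > 1 \<Longrightarrow>
      \<bar>f x1 x2 x3 x4 R - M x1 x2 x3 x4\<bar> \<le> K * (1 + ln R) ^ 3 / R"
    and a: "a \<ge> -1" and K0: "K \<ge> 0"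
  shows "uniform_asymp f M a"
  unfolding uniform_asymp_def
proof (intro allI impI)
  fix \<epsilon> :: real assume e: "\<epsilon> > 0"
  have pw: "K * (1 + ln R) ^ 3 / R \<le> K * (1 + 3 / \<epsilon>) ^ 3 * R powr (a + \<epsilon>)" if R: "R > 1" for R
  proof -
    define b where "b = R powr (\<epsilon> / 3)"
    have b1: "b \<ge> 1" unfolding b_def using R e by (intro ge_one_powr_ge_zero) auto
    have "ln b \<le> b" using b1 ln_le_minus_one[of b] by simp
    then have "\<epsilon> / 3 * ln R \<le> b" using R by (simp add: b_def ln_powr)
    then have "ln R \<le> 3 / \<epsilon> * b" using e by (simp add: field_simps)
    then have "1 + ln R \<le> (1 + 3 / \<epsilon>) * b" using b1 by (simp add: distrib_right)
    then have "(1 + ln R) ^ 3 \<le> ((1 + 3 / \<epsilon>) * b) ^ 3" using R by (intro power_mono) auto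
    also have "\<dots> = (1 + 3 / \<epsilon>) ^ 3 * R powr \<epsilon>"
    proof -
      have "b ^ 3 = b powr 3" using b1 by simp
      then show ?thesis unfolding power_mult_distrib by (simp add: b_def powr_powr)
    qed
    finally have "(1 + ln R) ^ 3 / R \<le> (1 + 3 / \<epsilon>) ^ 3 * R powr \<epsilon> / R" using R by (intro divide_right_mono) auto
    also have "\<dots> = (1 + 3 / \<epsilon>) ^ 3 * R powr (\<epsilon> - 1)" using R by (simp add: powr_diff)
    also have "\<dots> \<le> (1 + 3 / \<epsilon>) ^ 3 * R powr (a + \<epsilon>)"
      using R a e by (intro mult_left_mono powr_mono) auto
    finally have "(1 + ln R) ^ 3 / R \<le> (1 + 3 / \<epsilon>) ^ 3 * R powr (a + \<epsilon>)" .
    from mult_left_mono[OF this K0] show ?thesis by (simp add: mult.assoc)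
  qed
  show "\<exists>C. \<forall>x1\<in>{0<..1}. \<forall>x2\<in>{0<..1}. \<forall>x3\<in>{0<..1}. \<forall>x4\<in>{0<..1}. \<forall>R>1.
      \<bar>f x1 x2 x3 x4 R - M x1 x2 x3 x4\<bar> \<le> C * R powr (a + \<epsilon>)"
    using order_trans[OF K pw] by blast
qed

lemma uniform_asymp_tendsto:
  assumes f: "uniform_asymp f M a" and a: "a < 0"
    and x: "x1 \<in> {0<..1}" "x2 \<in> {0<..1}" "x3 \<in> {0<..1}" "x4 \<in> {0<..1}"
  shows "(f x1 x2 x3 x4 \<longlongrightarrow> M x1 x2 x3 x4) at_top"
proof -
  \<comment> \<open>Taking \<epsilon> = -a / 2 leaves the negative exponent a / 2.\<close>
  have "- a / 2 > 0" using a by simp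
  then obtain C where C: "\<And>R. R > 1 \<Longrightarrow> \<bar>f x1 x2 x3 x4 R - M x1 x2 x3 x4\<bar> \<le> C * R powr (a + - a / 2)"
    using f x unfolding uniform_asymp_def by metis
  have lim: "((\<lambda>R. C * R powr (a / 2)) \<longlongrightarrow> 0) at_top"
  proof -
    have "((\<lambda>R. R powr (a / 2)) \<longlongrightarrow> 0) at_top"
      using a by (intro tendsto_neg_powr filterlim_ident) auto
    then show ?thesis by (rule tendsto_mult_right_zero)
  qed
  have ev: "\<forall>\<^sub>F R in at_top. norm (f x1 x2 x3 x4 R - M x1 x2 x3 x4) \<le> C * R powr (a / 2)"
    using eventually_gt_at_top[of 1]
  proof eventually_elim
    case (elim R)
    have "a + - a / 2 = a / 2" by simp
    with C[OF elim] show ?case by (simp only: real_norm_def)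
  qed
  show ?thesis by (rule LIM_zero_cancel[OF Lim_null_comparison[OF ev lim]])
qed

theorem theorem1p1:
  shows "(\<forall>x1\<in>{0<..1}. \<forall>x2\<in>{0<..1}. \<forall>x3\<in>{0<..1}. \<forall>x4\<in>{0<..1}.
            (\<exists>L. (LE_plus x1 x2 x3 x4 \<longlongrightarrow> L) at_top) \<and>
            (\<exists>L. (LE_minus x1 x2 x3 x4 \<longlongrightarrow> L) at_top) \<and>
            (\<exists>L. (LO_plus x1 x2 x3 x4 \<longlongrightarrow> L) at_top) \<and>
            (\<exists>L. (LO_minus x1 x2 x3 x4 \<longlongrightarrow> L) at_top))
       \<and> uniform_asymp LE_plus
           (\<lambda>x1 x2 x3 x4. 2 * F_plus x1 x2 x3 x4 / (3 * zeta2)) (- 1)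
       \<and> uniform_asymp LE_minus
           (\<lambda>x1 x2 x3 x4. 2 * F_minus x1 x2 x3 x4 / (3 * zeta2)) (- 1)
       \<and> uniform_asymp LO_plus
           (\<lambda>x1 x2 x3 x4. (F_plus x1 x2 x3 x4 - D1 x1 x2 x3 x4) / zeta2) (- 1 / 2)
       \<and> uniform_asymp LO_minus
           (\<lambda>x1 x2 x3 x4.
              (F_minus x1 x2 x3 x4 - D2 x1 x2 x3 x4 - D3 x1 x2 x3 x4) / zeta2) (- 1 / 2)"
proof -
  have EP: "uniform_asymp LE_plus (\<lambda>x1 x2 x3 x4. 2 * F_plus x1 x2 x3 x4 / (3 * zeta2)) (- 1)"
  proof (rule uniform_asympI[where K = 200])
    fix x1 x2 x3 x4 R :: real
    assume x: "x1 \<in> {0<..1}" "x2 \<in> {0<..1}" "x3 \<in> {0<..1}" "x4 \<in> {0<..1}" "R > 1"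
    then show "\<bar>LE_plus x1 x2 x3 x4 R - 2 * F_plus x1 x2 x3 x4 / (3 * zeta2)\<bar> \<le> 200 * (1 + ln R) ^ 3 / R"
      using LE_asymp[of 1 x4 x1 x2 x3 R] by (simp add: LE_plus_def gap_range_simps F_sgn_plus)
  qed auto
  have EM: "uniform_asymp LE_minus (\<lambda>x1 x2 x3 x4. 2 * F_minus x1 x2 x3 x4 / (3 * zeta2)) (- 1)"
  proof (rule uniform_asympI[where K = 200])
    fix x1 x2 x3 x4 R :: real
    assume x: "x1 \<in> {0<..1}" "x2 \<in> {0<..1}" "x3 \<in> {0<..1}" "x4 \<in> {0<..1}" "R > 1"
    then show "\<bar>LE_minus x1 x2 x3 x4 R - 2 * F_minus x1 x2 x3 x4 / (3 * zeta2)\<bar> \<le> 200 * (1 + ln R) ^ 3 / R"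
      using LE_asymp[of "-1" x4 x1 x2 x3 R] by (simp add: LE_minus_def gap_range_simps F_sgn_minus)
  qed auto
  have OP: "uniform_asymp LO_plus (\<lambda>x1 x2 x3 x4. (F_plus x1 x2 x3 x4 - D1 x1 x2 x3 x4) / zeta2) (- 1 / 2)"
  proof (rule uniform_asympI[where K = 200])
    fix x1 x2 x3 x4 R :: real
    assume x: "x1 \<in> {0<..1}" "x2 \<in> {0<..1}" "x3 \<in> {0<..1}" "x4 \<in> {0<..1}" "R > 1"
    then show "\<bar>LO_plus x1 x2 x3 x4 R - (F_plus x1 x2 x3 x4 - D1 x1 x2 x3 x4) / zeta2\<bar> \<le> 200 * (1 + ln R) ^ 3 / R"
      using LO_asymp[of 1 x4 x1 x2 x3 R]
      by (simp add: LO_plus_def gap_range_simps F_sgn_plus O_x3_def O_l0_def D1_eq)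
  qed auto
  have OM: "uniform_asymp LO_minus
    (\<lambda>x1 x2 x3 x4. (F_minus x1 x2 x3 x4 - D2 x1 x2 x3 x4 - D3 x1 x2 x3 x4) / zeta2) (- 1 / 2)"
  proof (rule uniform_asympI[where K = 200])
    fix x1 x2 x3 x4 R :: real
    assume x: "x1 \<in> {0<..1}" "x2 \<in> {0<..1}" "x3 \<in> {0<..1}" "x4 \<in> {0<..1}" "R > 1"
    have m: "0 < min x3 (1 - golden)" using x golden_bounds by simp
    \<comment> \<open>\<open>D2\<close> is the loss in \<open>F_minus\<close> when x3 is cut at g^2
      = 1 - g, so subtracting it inserts the window bound into F; \<open>D3\<close> takes the same
      cut by \<open>D_total_min\<close>.\<close>
    have main: "F_minus x1 x2 x3 x4 - D2 x1 x2 x3 x4 - D3 x1 x2 x3 x4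
      = F_sgn (-1) x4 x2 (min x3 (1 - golden)) x1 - D_total (-1) x4 x1 x2 (min x3 (1 - golden)) 2"
      using x F_sgn_minus[OF m] D_total_min[of x4 x1 x2 x3]
      by (simp add: D2_def golden_bounds(3) D3_eq)
    have "\<bar>LO_meas x1 x2 x3 (gap_range (-1) x4) R - (F_sgn (-1) x4 x2 (O_x3 (-1) x3) x1
        - D_total (-1) x4 x1 x2 (O_x3 (-1) x3) (O_l0 (-1))) / zeta2\<bar> \<le> 200 * (1 + ln R) ^ 3 / R"
      using x by (intro LO_asymp) auto
    moreover have "LO_meas x1 x2 x3 (gap_range (-1) x4) R = LO_minus x1 x2 x3 x4 R"
      by (simp only: LO_minus_def gap_range_simps)
    moreover have "O_x3 (-1) x3 = min x3 (1 - golden)" "O_l0 (-1) = 2"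
      by (simp_all add: O_x3_def O_l0_def)
    ultimately show "\<bar>LO_minus x1 x2 x3 x4 R - (F_minus x1 x2 x3 x4 - D2 x1 x2 x3 x4 - D3 x1 x2 x3 x4) / zeta2\<bar>
        \<le> 200 * (1 + ln R) ^ 3 / R"
      by (simp only: main)
  qed auto
  have neg: "- 1 < (0 :: real)" "- 1 / 2 < (0 :: real)" by simp_all
  show ?thesis
  proof (intro conjI ballI EP EM OP OM)
    fix x1 x2 x3 x4 :: real
    assume x: "x1 \<in> {0<..1}" "x2 \<in> {0<..1}" "x3 \<in> {0<..1}" "x4 \<in> {0<..1}"
    show "\<exists>L. (LE_plus x1 x2 x3 x4 \<longlongrightarrow> L) at_top" using uniform_asymp_tendsto[OF EP neg(1) x] by (rule exI)
    show "\<exists>L. (LE_minus x1 x2 x3 x4 \<longlongrightarrow> L) at_top" using uniform_asymp_tendsto[OF EM neg(1) x] by (rule exI)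
    show "\<exists>L. (LO_plus x1 x2 x3 x4 \<longlongrightarrow> L) at_top" using uniform_asymp_tendsto[OF OP neg(2) x] by (rule exI)
    show "\<exists>L. (LO_minus x1 x2 x3 x4 \<longlongrightarrow> L) at_top" using uniform_asymp_tendsto[OF OM neg(2) x] by (rule exI)
  qed
qed

end
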